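(* There is a Kähler–Einstein toric Fano orbifold $X$ with $\dim X=3$ which is Chow unstable with respect to $-2K_X$.
   Context: A toric Fano orbifold is a projective toric variety with at worst finite quotient (orbifold) singularities (equivalently, with complete simplicial fan) whose anticanonical divisor $-K_X$ is an ample $\mathbb{Q}$-Cartier divisor. "Kähler–Einstein" means $X$ admits an (orbifold) Kähler–Einstein metric. For an $n$-dimensional irreducible projective variety $Y\subset\mathbb{CP}^N$ of degree $d$, the set of $(N-n-1)$-dimensional linear subspaces meeting $Y$ is an irreducible hypersurface of degree $d$ in the Grassmannian $\mathbb{G}(N-n-1,\mathbb{CP}^N)$, the zero locus of a section $R_Y^*\in H^0(\mathbb{G}(N-n-1,\mathbb{CP}^N),\mathcal{O}(d))$, unique up to scalar, called the Chow form. $Y$ is Chow semistable if the closure of the $\mathrm{SL}(N+1,\mathbb{C})$-orbit of $R_Y^*$ does not contain $0$, and Chow unstable otherwise. For a very ample line bundle $L$ on $X$, $X$ is Chow unstable with respect to $L$ if the image of $X$ in $\mathbb{P}(H^0(X,L)^* )$ is Chow unstable. *)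

theory Defs
  imports "HOL-Analysis.Analysis" "HOL-Library.Function_Algebras"
begin

section \<open>Polynomials and forms, as functions\<close>

text \<open>\<open>forms X d\<close> is the space of homogeneous polynomials of degree \<open>d\<close>, with complex
  coefficients, in the functions \<open>X\<close>; zero is a form of every degree.\<close>

inductive_set forms_graded :: "('a \<Rightarrow> complex) set \<Rightarrow> (nat \<times> ('a \<Rightarrow> complex)) set"
  for X :: "('a \<Rightarrow> complex) set" where
  const: "(0, \<lambda>x. c) \<in> forms_graded X"
| mult: "f \<in> X \<Longrightarrow> (d, g) \<in> forms_graded X \<Longrightarrow> (Suc d, \<lambda>x. f x * g x) \<in> forms_graded X"
| add: "(d, f) \<in> forms_graded X \<Longrightarrow> (d, g) \<in> forms_graded X
    \<Longrightarrow> (d, \<lambda>x. f x + g x) \<in> forms_graded X"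

definition forms :: "('a \<Rightarrow> complex) set \<Rightarrow> nat \<Rightarrow> ('a \<Rightarrow> complex) set" where
  "forms X d = {f. (d, f) \<in> forms_graded X}"

definition polynomial_map :: "(complex ^ 'n \<Rightarrow> complex) \<Rightarrow> bool" where
  "polynomial_map f \<longleftrightarrow>
    (\<exists>D g. (\<forall>d\<le>D. g d \<in> forms (range (\<lambda>i z. z $ i)) d) \<and> f = (\<lambda>z. \<Sum>d\<le>D. g d z))"


section \<open>Chow forms and Chow semistability\<close>

text \<open>A point of \<open>\<complex>P\<^sup>N\<close> is given by a nonzero vector of homogeneous coordinates
  \<open>p 0, \<dots>, p N\<close>, a function on the naturals that vanishes beyond \<open>N\<close>. A subvariety is given by
  the set \<open>Y\<close> of all homogeneous coordinate vectors of its points (its punctured affine cone).\<close>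

definition ndet :: "nat \<Rightarrow> (nat \<Rightarrow> nat \<Rightarrow> complex) \<Rightarrow> complex" where
  "ndet m A = (\<Sum>p | p permutes {..<m}. of_int (sign p) * (\<Prod>i<m. A i (p i)))"

text \<open>The dimension of the degree \<open>k\<close> part of the homogeneous coordinate ring of \<open>Y\<close>.\<close>

definition hilbert_function :: "nat \<Rightarrow> (nat \<Rightarrow> complex) set \<Rightarrow> nat \<Rightarrow> nat" where
  "hilbert_function N Y k =
    vector_space.dim (\<lambda>(c::complex) f p. c * f p)
      ((\<lambda>F p. if p \<in> Y then F p else 0) ` forms ((\<lambda>i p. p i) ` {..N}) k)"

text \<open>\<open>n!\<close> times the leading coefficient of the Hilbert polynomial, where \<open>n = dim Y\<close>.\<close>

definition has_degree :: "nat \<Rightarrow> nat \<Rightarrow> (nat \<Rightarrow> complex) set \<Rightarrow> nat \<Rightarrow> bool" where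
  "has_degree N n Y d \<longleftrightarrow>
    (\<lambda>k. fact n * real (hilbert_function N Y k) / real k ^ n) \<longlonglongrightarrow> real d"

text \<open>A linear subspace of dimension \<open>N - n - 1\<close> is the zero locus of \<open>n + 1\<close> linearly independent
  linear forms, the rows \<open>A 0, \<dots>, A n\<close> of a matrix with columns \<open>0, \<dots>, N\<close>. The maximal minors of
  \<open>A\<close> are its (dual) Pluecker coordinates. The sections of \<open>\<O>(d)\<close> over the Grassmannian are the
  forms of degree \<open>d\<close> in the Pluecker coordinates, restricted to the cone over the Grassmannian;
  here such a section is the corresponding function of \<open>A\<close>.\<close>

definition plucker_coordinates :: "nat \<Rightarrow> nat \<Rightarrow> ((nat \<Rightarrow> nat \<Rightarrow> complex) \<Rightarrow> complex) set" where
  "plucker_coordinates N n =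
    {\<lambda>A. ndet (Suc n) (\<lambda>r s. A r (J s)) | J. \<forall>s\<le>n. J s \<le> N}"

definition grassmannian_sections ::
    "nat \<Rightarrow> nat \<Rightarrow> nat \<Rightarrow> ((nat \<Rightarrow> nat \<Rightarrow> complex) \<Rightarrow> complex) set" where
  "grassmannian_sections N n d = forms (plucker_coordinates N n) d"

definition independent_forms :: "nat \<Rightarrow> nat \<Rightarrow> (nat \<Rightarrow> nat \<Rightarrow> complex) \<Rightarrow> bool" where
  "independent_forms N n A \<longleftrightarrow>
    (\<forall>c :: nat \<Rightarrow> complex. (\<forall>i\<le>N. (\<Sum>r\<le>n. c r * A r i) = 0) \<longrightarrow> (\<forall>r\<le>n. c r = 0))"

definition subspace_meets ::
    "nat \<Rightarrow> nat \<Rightarrow> (nat \<Rightarrow> nat \<Rightarrow> complex) \<Rightarrow> (nat \<Rightarrow> complex) set \<Rightarrow> bool" where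
  "subspace_meets N n A Y \<longleftrightarrow> (\<exists>p\<in>Y. \<forall>r\<le>n. (\<Sum>i\<le>N. A r i * p i) = 0)"

text \<open>For an irreducible \<open>Y\<close> of dimension \<open>n\<close>, the requirement that the degree of the section be
  the degree of \<open>Y\<close> excludes proper powers of the Chow form.\<close>

definition chow_form ::
    "nat \<Rightarrow> nat \<Rightarrow> (nat \<Rightarrow> complex) set \<Rightarrow> ((nat \<Rightarrow> nat \<Rightarrow> complex) \<Rightarrow> complex) \<Rightarrow> bool" where
  "chow_form N n Y R \<longleftrightarrow>
    (\<exists>d. has_degree N n Y d \<and> R \<in> grassmannian_sections N n d) \<and>
    (\<forall>A. independent_forms N n A \<longrightarrow> (R A = 0 \<longleftrightarrow> subspace_meets N n A Y))"

definition SL_orbit ::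
    "nat \<Rightarrow> ((nat \<Rightarrow> nat \<Rightarrow> complex) \<Rightarrow> complex) \<Rightarrow> ((nat \<Rightarrow> nat \<Rightarrow> complex) \<Rightarrow> complex) set" where
  "SL_orbit N R =
    {\<lambda>A. R (\<lambda>r i. \<Sum>j\<le>N. A r j * g j i) | g. ndet (Suc N) g = 1}"

text \<open>The closure is taken for pointwise convergence of functions, which on the finite-dimensional
  space of sections of \<open>\<O>(d)\<close> is the usual topology.\<close>

definition chow_semistable :: "nat \<Rightarrow> nat \<Rightarrow> (nat \<Rightarrow> complex) set \<Rightarrow> bool" where
  "chow_semistable N n Y \<longleftrightarrow> (\<exists>R. chow_form N n Y R \<and> (\<lambda>A. 0) \<notin> closure (SL_orbit N R))"


section \<open>Toric orbifolds\<close>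

text \<open>The cones of a simplicial fan in the lattice \<open>\<int>\<^sup>n\<close> are recorded by their sets of primitive
  ray generators.\<close>

type_synonym 'n fan = "(int ^ 'n) set set"

definition real_vec :: "int ^ 'n \<Rightarrow> real ^ 'n" where
  "real_vec v = (\<chi> i. real_of_int (v $ i))"

definition fan_cone :: "(int ^ 'n) set \<Rightarrow> (real ^ 'n) set" where
  "fan_cone S = convex_cone hull (real_vec ` S)"

definition complete_simplicial_fan :: "('n::finite) fan \<Rightarrow> bool" where
  "complete_simplicial_fan \<Sigma> \<longleftrightarrow>
    finite \<Sigma> \<and>
    (\<forall>S\<in>\<Sigma>. independent (real_vec ` S) \<and> (\<forall>v\<in>S. Gcd (range (($) v)) = 1)) \<and>
    (\<forall>S\<in>\<Sigma>. \<forall>T. T \<subseteq> S \<longrightarrow> T \<in> \<Sigma>) \<and>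
    (\<forall>S\<in>\<Sigma>. \<forall>T\<in>\<Sigma>. fan_cone S \<inter> fan_cone T = fan_cone (S \<inter> T)) \<and>
    (\<Union>S\<in>\<Sigma>. fan_cone S) = UNIV"

text \<open>The toric variety of \<open>\<Sigma>\<close> is Cox's quotient \<open>(\<complex>\<^bsup>rays\<^esup> - Z) / G\<close>, where \<open>G\<close> consists of the
  \<open>g\<close> with \<open>\<Prod>\<^sub>v g v powi \<langle>m, v\<rangle> = 1\<close> for all \<open>m\<close> in the dual lattice. Points are written in Cox
  coordinates, which are functions of the rays (values off the rays are irrelevant).\<close>

definition same_point ::
    "('n::finite) fan \<Rightarrow> (int ^ 'n \<Rightarrow> complex) \<Rightarrow> (int ^ 'n \<Rightarrow> complex) \<Rightarrow> bool" where
  "same_point \<Sigma> x y \<longleftrightarrow>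
    (\<exists>g. (\<forall>v\<in>\<Union>\<Sigma>. g v \<noteq> 0) \<and> (\<forall>i. (\<Prod>v\<in>\<Union>\<Sigma>. g v powi (v $ i)) = 1) \<and>
         (\<forall>v\<in>\<Union>\<Sigma>. y v = g v * x v))"

text \<open>Uniformizing charts: for each enumeration \<open>b\<close> of the generators of a maximal cone, the map
  \<open>\<complex>\<^sup>n \<rightarrow> X\<close> setting the remaining Cox coordinates to 1. It is the quotient of \<open>\<complex>\<^sup>n\<close> by a finite
  group that acts freely in codimension one, since the generators are primitive.\<close>

definition charts :: "('n::finite) fan \<Rightarrow> ('n \<Rightarrow> int ^ 'n) set" where
  "charts \<Sigma> = {b. inj b \<and> range b \<in> \<Sigma>}"

definition chart_point :: "('n::finite \<Rightarrow> int ^ 'n) \<Rightarrow> complex ^ 'n \<Rightarrow> int ^ 'n \<Rightarrow> complex" where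
  "chart_point b z v = (if v \<in> range b then z $ (inv b v) else 1)"

definition holomorphic_map_on ::
    "(complex ^ 'n \<Rightarrow> complex ^ 'm) \<Rightarrow> (complex ^ 'n) set \<Rightarrow> bool" where
  "holomorphic_map_on f U \<longleftrightarrow>
    (\<forall>z\<in>U. \<exists>D. (f has_derivative D) (at z) \<and> (\<forall>c v. D (c *s v) = c *s D v))"

definition jacobian :: "(complex ^ 'n \<Rightarrow> complex ^ 'm) \<Rightarrow> complex ^ 'n \<Rightarrow> complex ^ 'n ^ 'm" where
  "jacobian f z = matrix (frechet_derivative f (at z))"

text \<open>Holomorphic lifts of the identity of \<open>X\<close> to the charts. For \<open>b = c\<close> they include the local
  uniformizing group.\<close>

definition chart_change ::
    "('n::finite) fan \<Rightarrow> ('n \<Rightarrow> int ^ 'n) \<Rightarrow> ('n \<Rightarrow> int ^ 'n) \<Rightarrow>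
     (complex ^ 'n) set \<Rightarrow> (complex ^ 'n \<Rightarrow> complex ^ 'n) \<Rightarrow> bool" where
  "chart_change \<Sigma> b c U \<phi> \<longleftrightarrow>
    b \<in> charts \<Sigma> \<and> c \<in> charts \<Sigma> \<and> open U \<and> holomorphic_map_on \<phi> U \<and>
    (\<forall>z\<in>U. same_point \<Sigma> (chart_point b z) (chart_point c (\<phi> z)))"


section \<open>The sheaves \<open>\<O>(-k K\<^sub>X)\<close>\<close>

text \<open>A global section of \<open>-k K\<^sub>X\<close> is given in each chart by a \<open>k\<close>-th power of a top-degree
  multivector field, \<open>s b z (\<partial>\<^sub>1 \<and> \<dots> \<and> \<partial>\<^sub>n)\<^bsup>\<otimes>k\<^esup>\<close>, where \<open>s b\<close> is a polynomial because the image of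
  the chart is affine.\<close>

definition anticanonical_sections ::
    "('n::finite) fan \<Rightarrow> nat \<Rightarrow> (('n \<Rightarrow> int ^ 'n) \<Rightarrow> complex ^ 'n \<Rightarrow> complex) set" where
  "anticanonical_sections \<Sigma> k =
    {s. (\<forall>b\<in>charts \<Sigma>. polynomial_map (s b)) \<and> (\<forall>b. b \<notin> charts \<Sigma> \<longrightarrow> s b = (\<lambda>z. 0)) \<and>
        (\<forall>b c U \<phi>. chart_change \<Sigma> b c U \<phi> \<longrightarrow>
          (\<forall>z\<in>U. s c (\<phi> z) = det (jacobian \<phi> z) ^ k * s b z))}"

definition anticanonical_basis ::
    "('n::finite) fan \<Rightarrow> nat \<Rightarrow> nat \<Rightarrow> (nat \<Rightarrow> ('n \<Rightarrow> int ^ 'n) \<Rightarrow> complex ^ 'n \<Rightarrow> complex) \<Rightarrow> bool"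
  where
  "anticanonical_basis \<Sigma> k N s \<longleftrightarrow>
    (\<forall>i\<le>N. s i \<in> anticanonical_sections \<Sigma> k) \<and>
    (\<forall>t\<in>anticanonical_sections \<Sigma> k.
      \<exists>!c :: nat \<Rightarrow> complex. (\<forall>i>N. c i = 0) \<and> t = (\<lambda>b z. \<Sum>i\<le>N. c i * s i b z))"

definition chart_regular ::
    "('n::finite) fan \<Rightarrow> ('n \<Rightarrow> int ^ 'n) \<Rightarrow> (complex ^ 'n \<Rightarrow> complex) \<Rightarrow> bool" where
  "chart_regular \<Sigma> b f \<longleftrightarrow>
    polynomial_map f \<and>
    (\<forall>z w. same_point \<Sigma> (chart_point b z) (chart_point b w) \<longrightarrow> f z = f w)"

text \<open>The map \<open>[s 0 : \<dots> : s N]\<close> is a closed embedding of \<open>X\<close>: it has no base points, it is injective,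
  and it is surjective on local rings. It suffices to state the last condition for the regular
  functions on the affine images of the charts, as their fractions form the local rings of \<open>X\<close>.
  Absence of base points makes the rank one reflexive sheaf \<open>\<O>(-k K\<^sub>X)\<close> a line bundle.\<close>

definition very_ample_anticanonical :: "('n::finite) fan \<Rightarrow> nat \<Rightarrow> bool" where
  "very_ample_anticanonical \<Sigma> k \<longleftrightarrow>
    (\<exists>N s. anticanonical_basis \<Sigma> k N s \<and>
      (\<forall>b\<in>charts \<Sigma>. \<forall>z. \<exists>i\<le>N. s i b z \<noteq> 0) \<and>
      (\<forall>b\<in>charts \<Sigma>. \<forall>c\<in>charts \<Sigma>. \<forall>z w \<mu>. (\<forall>i\<le>N. s i c w = \<mu> * s i b z) \<longrightarrow>
         same_point \<Sigma> (chart_point b z) (chart_point c w)) \<and>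
      (\<forall>b\<in>charts \<Sigma>. \<forall>z f. chart_regular \<Sigma> b f \<longrightarrow>
         (\<exists>d. \<exists>A\<in>forms ((\<lambda>i. s i b) ` {..N}) d. \<exists>B\<in>forms ((\<lambda>i. s i b) ` {..N}) d.
            B z \<noteq> 0 \<and> (\<forall>w. f w * B w = A w))))"

definition toric_fano_orbifold :: "('n::finite) fan \<Rightarrow> bool" where
  "toric_fano_orbifold \<Sigma> \<longleftrightarrow>
    complete_simplicial_fan \<Sigma> \<and> (\<exists>k>0. very_ample_anticanonical \<Sigma> k)"

definition kodaira_image ::
    "('n::finite) fan \<Rightarrow> nat \<Rightarrow> (nat \<Rightarrow> ('n \<Rightarrow> int ^ 'n) \<Rightarrow> complex ^ 'n \<Rightarrow> complex) \<Rightarrow>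
     (nat \<Rightarrow> complex) set" where
  "kodaira_image \<Sigma> N s =
    {\<lambda>i. if i \<le> N then c * s i b z else 0 | b z c. b \<in> charts \<Sigma> \<and> c \<noteq> 0}"

text \<open>The choice of the basis does not matter, since \<open>chow_semistable\<close> is invariant under linear
  changes of coordinates.\<close>

definition chow_unstable_anticanonical :: "('n::finite) fan \<Rightarrow> nat \<Rightarrow> bool" where
  "chow_unstable_anticanonical \<Sigma> k \<longleftrightarrow>
    very_ample_anticanonical \<Sigma> k \<and>
    (\<exists>N s. anticanonical_basis \<Sigma> k N s \<and> \<not> chow_semistable N CARD('n) (kodaira_image \<Sigma> N s))"


section \<open>Orbifold Kaehler--Einstein metrics\<close>

primrec times_differentiable ::
    "nat \<Rightarrow> ('a::real_normed_vector \<Rightarrow> 'b::real_normed_vector) \<Rightarrow> bool" where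
  "times_differentiable 0 f \<longleftrightarrow> continuous_on UNIV f"
| "times_differentiable (Suc k) f \<longleftrightarrow>
    (\<forall>x. f differentiable (at x)) \<and>
    (\<forall>v. times_differentiable k (\<lambda>x. frechet_derivative f (at x) v))"

definition smooth :: "('a::real_normed_vector \<Rightarrow> 'b::real_normed_vector) \<Rightarrow> bool" where
  "smooth f \<longleftrightarrow> (\<forall>k. times_differentiable k f)"

text \<open>The Wirtinger derivatives \<open>\<partial>/\<partial>z\<^sub>j\<close> and its conjugate.\<close>

definition d_z :: "'n \<Rightarrow> (complex ^ 'n \<Rightarrow> complex) \<Rightarrow> complex ^ 'n \<Rightarrow> complex" where
  "d_z j f z = (frechet_derivative f (at z) (axis j 1)
     - \<i> * frechet_derivative f (at z) (axis j \<i>)) / 2"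

definition d_zbar :: "'n \<Rightarrow> (complex ^ 'n \<Rightarrow> complex) \<Rightarrow> complex ^ 'n \<Rightarrow> complex" where
  "d_zbar j f z = (frechet_derivative f (at z) (axis j 1)
     + \<i> * frechet_derivative f (at z) (axis j \<i>)) / 2"

text \<open>\<open>h z $ j $ k\<close> is the coefficient of \<open>dz\<^sub>j \<otimes> d\<close>(conjugate of \<open>z\<^sub>k\<close>) in the metric, so the
  last conjunct says that the Kaehler form is closed.\<close>

definition kahler_metric :: "(complex ^ 'n \<Rightarrow> complex ^ 'n ^ 'n::finite) \<Rightarrow> bool" where
  "kahler_metric h \<longleftrightarrow>
    (\<forall>j k. smooth (\<lambda>z. h z $ j $ k)) \<and>
    (\<forall>z j k. h z $ k $ j = cnj (h z $ j $ k)) \<and>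
    (\<forall>z v. v \<noteq> 0 \<longrightarrow> 0 < Re (\<Sum>j\<in>UNIV. \<Sum>k\<in>UNIV. h z $ j $ k * v $ j * cnj (v $ k))) \<and>
    (\<forall>z i j k. d_z i (\<lambda>w. h w $ j $ k) z = d_z j (\<lambda>w. h w $ i $ k) z)"

definition ricci :: "(complex ^ 'n \<Rightarrow> complex ^ 'n ^ 'n::finite) \<Rightarrow> complex ^ 'n \<Rightarrow> complex ^ 'n ^ 'n"
  where
  "ricci h z = (\<chi> j k. - d_z j (d_zbar k (\<lambda>w. of_real (ln (Re (det (h w)))))) z)"

text \<open>An orbifold metric is a metric on each chart, preserved by all chart changes.\<close>

definition kahler_einstein :: "('n::finite) fan \<Rightarrow> bool" where
  "kahler_einstein \<Sigma> \<longleftrightarrow>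
    (\<exists>(h :: ('n \<Rightarrow> int ^ 'n) \<Rightarrow> complex ^ 'n \<Rightarrow> complex ^ 'n ^ 'n) (r :: real).
      (\<forall>b\<in>charts \<Sigma>. kahler_metric (h b) \<and>
        (\<forall>z j k. ricci (h b) z $ j $ k = of_real r * h b z $ j $ k)) \<and>
      (\<forall>b c U \<phi>. chart_change \<Sigma> b c U \<phi> \<longrightarrow>
        (\<forall>z\<in>U. h b z = transpose (jacobian \<phi> z) ** h c (\<phi> z) **
                         (\<chi> i j. cnj (jacobian \<phi> z $ i $ j)))))"

end

theory Submission
  imports Defs "HOL-Complex_Analysis.Cauchy_Integral_Formula"
    "HOL-Computational_Algebra.Fundamental_Theorem_Algebra"
begin

text \<open>The orbifold is \<open>\<complex>P\<^sup>3 / \<mu>\<^sub>4\<close> with \<open>\<zeta>\<close> acting by \<open>(x\<^sub>0, x\<^sub>1, \<zeta> x\<^sub>2, \<zeta>\<^bsup>-1\<^esup> x\<^sub>3)\<close>. The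
  Fubini--Study metric descends to it, and the sections of \<open>-2K\<close> are the octics invariant under
  \<open>\<mu>\<^sub>4\<close>; they have a basis of 45 monomials. Consider the one-parameter subgroup that multiplies a
  monomial by \<open>t\<close> to the power of its weight, the total degree in \<open>x\<^sub>2\<close> and \<open>x\<^sub>3\<close>. It preserves the
  image of \<open>X\<close>, so a Chow form is an eigenvector of it. As the four octics \<open>x\<^sub>i\<^sup>8\<close> have no common
  zero, the Chow form does not vanish there, and its degree in each of the four forms shows that
  the eigenvalue is \<open>t\<^bsup>16 d\<^esup>\<close>: each of the four forms contributes \<open>d\<close> times the average weight 4 of
  the vertices of the moment simplex. But the average weight of the 45 monomials is \<open>168/45 < 4\<close>, so
  after normalization to determinant 1 the Chow form is still contracted to 0.\<close>

section \<open>The fan\<close>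

text \<open>The rays sum to zero and generate a sublattice of index 4 in the lattice, which makes
  the toric variety the quotient of projective space by a group of order 4. The degree is 8 because
  -K pulls back to \<open>\<O>(4)\<close>. Without the congruence imposed by invariance, the
  symmetry of the four coordinates would make the average weight exactly 4.

  Two obstacles shape the proof. Sections and metrics are tested against arbitrary holomorphic lifts
  \<open>\<phi>\<close>, and the group element relating the Cox coordinates of \<open>z\<close> and
  \<open>\<phi> z\<close> is given only point by point. Fourth powers remove its root of unity, the
  resulting identities are differentiated on the torus, and continuity of the Jacobian carries the
  conclusions to the whole chart.

  Secondly, the geometry controls only the zeros of a Chow form \<open>R\<close>. To turn an
  invariant zero set into an exact eigenvector equation, \<open>R\<close> is followed along the
  pencil from any matrix to that of the four octics: it becomes a polynomial in the pencil parameter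
  and in \<open>t\<close> whose zeros do not depend on \<open>t \<noteq> 0\<close>, and such a
  polynomial is a monomial in \<open>t\<close>.\<close>

definition r0 :: "int ^ 3" where "r0 = vector [-2, -4, -1]"
definition r1 :: "int ^ 3" where "r1 = vector [0, 0, 1]"
definition r2 :: "int ^ 3" where "r2 = vector [1, 4, 0]"
definition r3 :: "int ^ 3" where "r3 = vector [1, 0, 0]"

definition rays :: "(int ^ 3) set" where "rays = {r0, r1, r2, r3}"

text \<open>The same shape as the fan of projective space: the rays sum to zero and any three of
  them are independent, so the cones on three rays tile the space.\<close>

definition quotient_fan :: "3 fan" where "quotient_fan = {S. S \<subset> rays}"

lemma ray_nth [simp]:
  "r0 $ 1 = -2" "r0 $ 2 = -4" "r0 $ 3 = -1"
  "r1 $ 1 = 0" "r1 $ 2 = 0" "r1 $ 3 = 1"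
  "r2 $ 1 = 1" "r2 $ 2 = 4" "r2 $ 3 = 0"
  "r3 $ 1 = 1" "r3 $ 2 = 0" "r3 $ 3 = 0"
  by (simp_all add: r0_def r1_def r2_def r3_def)

lemma rays_distinct [simp]:
  "r0 \<noteq> r1" "r0 \<noteq> r2" "r0 \<noteq> r3" "r1 \<noteq> r0" "r1 \<noteq> r2" "r1 \<noteq> r3"
  "r2 \<noteq> r0" "r2 \<noteq> r1" "r2 \<noteq> r3" "r3 \<noteq> r0" "r3 \<noteq> r1" "r3 \<noteq> r2"
  by (auto simp: vec_eq_iff forall_3)

lemma finite_rays [simp]: "finite rays"
  by (simp add: rays_def)

lemma card_rays: "card rays = 4"
  by (simp add: rays_def)

lemma in_rays [simp]: "r0 \<in> rays" "r1 \<in> rays" "r2 \<in> rays" "r3 \<in> rays"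
  by (simp_all add: rays_def)

lemma sum_rays: "(\<Sum>v\<in>rays. f v) = f r0 + f r1 + f r2 + (f r3 :: 'a::comm_monoid_add)"
  by (simp add: rays_def add.assoc)

lemma prod_rays: "(\<Prod>v\<in>rays. f v) = f r0 * f r1 * f r2 * (f r3 :: 'a::comm_monoid_mult)"
  by (simp add: rays_def mult.assoc)

lemma Union_quotient_fan [simp]: "\<Union>quotient_fan = rays"
proof -
  have "\<exists>S. S \<subset> rays \<and> v \<in> S" if "v \<in> rays" for v
  proof -
    have "{v} \<subset> rays"
      using that by (auto simp: rays_def)
    then show ?thesis by blast
  qed
  then show ?thesis by (auto simp: quotient_fan_def)
qed

lemma inj_real_vec: "inj real_vec"
  by (auto simp: inj_def real_vec_def vec_eq_iff)

text \<open>Up to a factor, \<open>r0 + r1 + r2 + r3 = 0\<close> is the only linear relation between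
  the rays. Independence, intersections and completeness of the cones all reduce to this.\<close>

lemma ray_combination_eq_iff:
  "(\<Sum>v\<in>rays. c v *\<^sub>R real_vec v) = (\<Sum>v\<in>rays. d v *\<^sub>R real_vec v) \<longleftrightarrow>
    (\<exists>k. \<forall>v\<in>rays. c v = d v + k)" (is "?L \<longleftrightarrow> ?R")
proof
  assume ?L
  \<comment> \<open>The first coordinate, the second divided by 4, and the third.\<close>
  then have "c r3 + c r2 - 2 * c r0 = d r3 + d r2 - 2 * d r0"
    "c r2 - c r0 = d r2 - d r0" "c r1 - c r0 = d r1 - d r0"
    by (simp_all add: vec_eq_iff forall_3 sum_rays real_vec_def algebra_simps)
  then have "\<forall>v\<in>rays. c v = d v + (c r0 - d r0)"
    by (simp add: rays_def)
  then show ?R by blast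
next
  assume ?R
  then show ?L
    by (auto simp: vec_eq_iff forall_3 sum_rays real_vec_def algebra_simps)
qed

lemma ray_combination_subset:
  assumes "S \<subseteq> rays"
  shows "(\<Sum>v\<in>S. c v *\<^sub>R real_vec v) = (\<Sum>v\<in>rays. (if v \<in> S then c v else 0) *\<^sub>R real_vec v)"
proof -
  have "S = rays \<inter> S" using assms by blast
  then have "(\<Sum>v\<in>S. c v *\<^sub>R real_vec v) = (\<Sum>v\<in>rays \<inter> S. c v *\<^sub>R real_vec v)" by simp
  also have "\<dots> = (\<Sum>v\<in>rays. if v \<in> S then c v *\<^sub>R real_vec v else 0)"
    by (simp add: sum.inter_restrict)
  finally show ?thesis by (simp add: if_distrib if_distribR cong: if_cong)
qed

lemma fan_cone_eq:
  fixes S :: "(int ^ 'a::finite) set"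
  assumes "finite S"
  shows "fan_cone S = {\<Sum>v\<in>S. c v *\<^sub>R real_vec v | c. \<forall>v\<in>S. 0 \<le> c v}" (is "_ = ?C")
proof
  show "fan_cone S \<subseteq> ?C" unfolding fan_cone_def
  proof (rule hull_minimal)
    show "real_vec ` S \<subseteq> ?C"
    proof clarify
      fix v assume "v \<in> S"
      have "(\<Sum>u\<in>S. (if u = v then 1 else 0) *\<^sub>R real_vec u)
          = (\<Sum>u\<in>S. if u = v then real_vec u else 0)"
        by (intro sum.cong) auto
      then have "real_vec v = (\<Sum>u\<in>S. (if u = v then 1 else 0) *\<^sub>R real_vec u)"
        using assms \<open>v \<in> S\<close> by simp
      then show "\<exists>c. real_vec v = (\<Sum>u\<in>S. c u *\<^sub>R real_vec u) \<and> (\<forall>u\<in>S. 0 \<le> c u)"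
        by (intro exI[of _ "\<lambda>u. if u = v then 1 else 0"]) auto
    qed
    show "convex_cone ?C" unfolding convex_cone_iff
    proof safe
      show "\<exists>c. 0 = (\<Sum>v\<in>S. c v *\<^sub>R real_vec v) \<and> (\<forall>v\<in>S. 0 \<le> c v)"
        by (intro exI[of _ "\<lambda>_. 0"]) simp
    next
      fix c d :: "int ^ 'a \<Rightarrow> real" assume "\<forall>v\<in>S. 0 \<le> c v" "\<forall>v\<in>S. 0 \<le> d v"
      then show "\<exists>e. (\<Sum>v\<in>S. c v *\<^sub>R real_vec v) + (\<Sum>v\<in>S. d v *\<^sub>R real_vec v)
          = (\<Sum>v\<in>S. e v *\<^sub>R real_vec v) \<and> (\<forall>v\<in>S. 0 \<le> e v)"
        by (intro exI[of _ "\<lambda>v. c v + d v"]) (auto simp: sum.distrib scaleR_left_distrib)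
    next
      fix c :: "int ^ 'a \<Rightarrow> real" and a :: real assume "\<forall>v\<in>S. 0 \<le> c v" "a \<ge> 0"
      then show "\<exists>e. a *\<^sub>R (\<Sum>v\<in>S. c v *\<^sub>R real_vec v)
          = (\<Sum>v\<in>S. e v *\<^sub>R real_vec v) \<and> (\<forall>v\<in>S. 0 \<le> e v)"
        by (intro exI[of _ "\<lambda>v. a * c v"]) (auto simp: scaleR_sum_right)
    qed
  qed
  have "(\<Sum>v\<in>T. c v *\<^sub>R real_vec v) \<in> fan_cone S"
    if "T \<subseteq> S" "\<forall>v\<in>S. 0 \<le> c v" for T c
    using finite_subset[OF that(1) assms] that(1)
  proof (induction T rule: finite_induct)
    case empty
    then show ?case by (simp add: fan_cone_def convex_cone_hull_contains_0)
  next
    case (insert v T)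
    have "c v *\<^sub>R real_vec v \<in> fan_cone S" unfolding fan_cone_def
      using insert.prems that(2) by (intro convex_cone_hull_mul hull_inc) auto
    then show ?case using insert unfolding fan_cone_def
      by (simp add: convex_cone_hull_add)
  qed
  from this[OF order_refl] show "?C \<subseteq> fan_cone S" by auto
qed

lemma fan_coneE:
  fixes S :: "(int ^ 'a::finite) set"
  assumes "x \<in> fan_cone S" "finite S"
  obtains c where "x = (\<Sum>v\<in>S. c v *\<^sub>R real_vec v)" "\<forall>v\<in>S. 0 \<le> c v"
proof -
  from assms(1) have "\<exists>c. x = (\<Sum>v\<in>S. c v *\<^sub>R real_vec v) \<and> (\<forall>v\<in>S. 0 \<le> c v)"
    by (simp add: fan_cone_eq[OF assms(2)])
  then show thesis using that by (elim exE conjE)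
qed

text \<open>Extended by zero to all rays, two nonnegative expansions of a common point differ by a
  constant \<open>k\<close>. A ray missing from \<open>S\<close> gives \<open>k \<le> 0\<close>, a
  ray missing from \<open>T\<close> gives \<open>k \<ge> 0\<close>; so the expansions agree and live
  on \<open>S \<inter> T\<close>.\<close>

lemma fan_cone_Int:
  assumes "S \<subset> rays" "T \<subset> rays"
  shows "fan_cone S \<inter> fan_cone T = fan_cone (S \<inter> T)"
proof
  have fin: "finite S" "finite T" "finite (S \<inter> T)"
    using assms by (auto intro: finite_subset[OF _ finite_rays])
  show "fan_cone (S \<inter> T) \<subseteq> fan_cone S \<inter> fan_cone T"
    unfolding fan_cone_def by (intro Int_greatest hull_mono) auto
  show "fan_cone S \<inter> fan_cone T \<subseteq> fan_cone (S \<inter> T)"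
  proof
    fix x assume "x \<in> fan_cone S \<inter> fan_cone T"
    then have "x \<in> fan_cone S" "x \<in> fan_cone T" by auto
    then obtain c d where c: "x = (\<Sum>v\<in>S. c v *\<^sub>R real_vec v)" "\<forall>v\<in>S. 0 \<le> c v"
      and d: "x = (\<Sum>v\<in>T. d v *\<^sub>R real_vec v)" "\<forall>v\<in>T. 0 \<le> d v"
      using fin by (elim fan_coneE)
    define c' d' where "c' v = (if v \<in> S then c v else 0)" and
      "d' v = (if v \<in> T then d v else 0)" for v
    have "(\<Sum>v\<in>rays. c' v *\<^sub>R real_vec v) = (\<Sum>v\<in>rays. d' v *\<^sub>R real_vec v)"
      using trans[OF c(1)[symmetric] d(1)]
      unfolding c'_def d'_def
        ray_combination_subset[OF psubset_imp_subset[OF assms(1)]]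
        ray_combination_subset[OF psubset_imp_subset[OF assms(2)]] .
    then obtain k where k: "\<forall>v\<in>rays. c' v = d' v + k"
      unfolding ray_combination_eq_iff by blast
    obtain s t where s: "s \<in> rays" "s \<notin> S" and t: "t \<in> rays" "t \<notin> T"
      using assms by blast
    have "d' s \<ge> 0" "c' t \<ge> 0" "c' s = 0" "d' t = 0"
      using c(2) d(2) s t by (auto simp: c'_def d'_def)
    moreover have "c' s = d' s + k" "c' t = d' t + k" using k s(1) t(1) by blast+
    ultimately have "k = 0" by linarith
    have "c v = 0" if "v \<in> S - T" for v
    proof -
      have "c' v = d' v" using k \<open>k = 0\<close> that assms by auto
      then show ?thesis using that by (simp add: c'_def d'_def)
    qed
    then have "x = (\<Sum>v\<in>S \<inter> T. c v *\<^sub>R real_vec v)"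
      unfolding c(1) by (intro sum.mono_neutral_right) (use fin in auto)
    then show "x \<in> fan_cone (S \<inter> T)"
      using fin c(2) by (auto simp: fan_cone_eq)
  qed
qed

text \<open>Subtracting the least coefficient from an expansion over all four rays does not change
  the vector, makes all coefficients nonnegative and one of them zero.\<close>

lemma fan_cones_cover: "\<exists>S\<subset>rays. x \<in> fan_cone S"
proof -
  define c where "c v = (if v = r1 then x $ 3 else if v = r2 then x $ 2 / 4
    else if v = r3 then x $ 1 - x $ 2 / 4 else 0)" for v
  have x: "x = (\<Sum>v\<in>rays. c v *\<^sub>R real_vec v)"
    by (simp add: vec_eq_iff forall_3 sum_rays real_vec_def c_def)
  define m where "m = Min (c ` rays)"
  have m: "m \<le> c v" if "v \<in> rays" for v
    using that by (simp add: m_def)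
  have "m \<in> c ` rays" unfolding m_def by (rule Min_in) (auto simp: rays_def)
  then obtain s where s: "s \<in> rays" "c s = m" by blast
  have "x = (\<Sum>v\<in>rays. (c v - m) *\<^sub>R real_vec v)"
    unfolding x ray_combination_eq_iff by (intro exI[of _ m]) simp
  also have "\<dots> = (\<Sum>v\<in>rays - {s}. (c v - m) *\<^sub>R real_vec v)"
    using s by (intro sum.mono_neutral_right) auto
  finally have "x \<in> fan_cone (rays - {s})"
    using m by (auto simp: fan_cone_eq)
  then show ?thesis using s(1) by blast
qed

lemma complete_simplicial_quotient_fan: "complete_simplicial_fan quotient_fan"
  unfolding complete_simplicial_fan_def
proof (intro conjI ballI allI impI)
  show "finite quotient_fan"
    by (rule finite_subset[of _ "Pow rays"]) (auto simp: quotient_fan_def)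
next
  fix S assume "S \<in> quotient_fan"
  then have S: "S \<subset> rays" "finite S"
    by (auto simp: quotient_fan_def intro: finite_subset[OF _ finite_rays])
  obtain s where s: "s \<in> rays" "s \<notin> S" using S by blast
  show "independent (real_vec ` S)"
    unfolding independent_explicit
  proof (intro conjI allI impI ballI)
    show "finite (real_vec ` S)" using S by simp
    fix u x assume "(\<Sum>x\<in>real_vec ` S. u x *\<^sub>R x) = 0" "x \<in> real_vec ` S"
    then obtain v where v: "v \<in> S" "x = real_vec v" by blast
    have "0 = (\<Sum>v\<in>S. u (real_vec v) *\<^sub>R real_vec v)"
      using \<open>_ = 0\<close> by (simp add: sum.reindex inj_on_subset[OF inj_real_vec])
    also have "\<dots> = (\<Sum>v\<in>rays. (if v \<in> S then u (real_vec v) else 0) *\<^sub>R real_vec v)"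
      using S by (intro ray_combination_subset) auto
    finally have "(\<Sum>v\<in>rays. (if v \<in> S then u (real_vec v) else 0) *\<^sub>R real_vec v)
        = (\<Sum>v\<in>rays. 0 *\<^sub>R real_vec v)" by simp
    then obtain k where k: "\<forall>v\<in>rays. (if v \<in> S then u (real_vec v) else 0) = 0 + k"
      unfolding ray_combination_eq_iff by blast
    have "k = 0" using k s by (metis add_0)
    then show "u x = 0" using k v S by (auto split: if_splits)
  qed
  fix v assume "v \<in> S"
  then have "v \<in> rays" using S by blast
  then show "Gcd (range (($) v)) = 1"
    by (auto simp: rays_def UNIV_3)
next
  fix S T assume "S \<in> quotient_fan" "T \<subseteq> S"
  then show "T \<in> quotient_fan" by (auto simp: quotient_fan_def)
next
  fix S T assume "S \<in> quotient_fan" "T \<in> quotient_fan"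
  then show "fan_cone S \<inter> fan_cone T = fan_cone (S \<inter> T)"
    by (simp add: quotient_fan_def fan_cone_Int)
next
  show "(\<Union>S\<in>quotient_fan. fan_cone S) = UNIV"
    using fan_cones_cover by (auto simp: quotient_fan_def)
qed

section \<open>Points and charts\<close>

text \<open>\<open>twist \<zeta>\<close> with \<open>\<zeta> ^ 4 = 1\<close> runs over \<open>\<mu>\<^sub>4\<close>, so the toric variety is \<open>\<complex>P\<^sup>3 / \<mu>\<^sub>4\<close>.\<close>

definition twist :: "complex \<Rightarrow> int ^ 3 \<Rightarrow> complex" where
  "twist \<zeta> v = (if v = r2 then \<zeta> else if v = r3 then inverse \<zeta> else 1)"

lemma twist_simps [simp]:
  "twist \<zeta> r0 = 1" "twist \<zeta> r1 = 1" "twist \<zeta> r2 = \<zeta>" "twist \<zeta> r3 = inverse \<zeta>"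
  by (simp_all add: twist_def)

lemma twist_power4:
  assumes "\<zeta> ^ 4 = 1"
  shows "twist \<zeta> v ^ 4 = 1"
  using assms by (simp add: twist_def power_inverse)

lemma twist_nonzero [simp]:
  assumes "\<zeta> ^ 4 = 1"
  shows "twist \<zeta> v \<noteq> 0"
  using twist_power4[OF assms, of v] by (metis power_0_left zero_neq_one zero_neq_numeral)

lemma norm_twist:
  assumes "\<zeta> ^ 4 = 1"
  shows "norm (twist \<zeta> v) = 1"
proof -
  have "norm (twist \<zeta> v) ^ 4 = 1"
    by (metis norm_power norm_one twist_power4[OF assms])
  then show ?thesis
    using power_eq_imp_eq_base[of "norm (twist \<zeta> v)" 4 1] by simp
qed

text \<open>The three coordinates of the relation defining Cox's group read
  \<open>g r2 * g r3 = g r0 ^ 2\<close>, \<open>g r2 ^ 4 = g r0 ^ 4\<close> and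
  \<open>g r1 = g r0\<close>. So the group is parametrized by \<open>l = g r0\<close> and
  \<open>\<zeta> = g r2 / g r0\<close>.\<close>

lemma same_point_iff:
  "same_point quotient_fan x y \<longleftrightarrow>
    (\<exists>l \<zeta>. l \<noteq> 0 \<and> \<zeta> ^ 4 = 1 \<and> (\<forall>v\<in>rays. y v = l * twist \<zeta> v * x v))" (is "?L \<longleftrightarrow> ?R")
proof
  assume ?L
  then obtain g where g: "\<forall>v\<in>rays. g v \<noteq> 0" "\<forall>i. (\<Prod>v\<in>rays. g v powi (v $ i)) = 1"
    "\<forall>v\<in>rays. y v = g v * x v"
    unfolding same_point_def Union_quotient_fan by blast
  have nz: "g r0 \<noteq> 0" "g r1 \<noteq> 0" "g r2 \<noteq> 0" "g r3 \<noteq> 0"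
    using g(1) by (auto simp: rays_def)
  have eqs: "g r2 * g r3 = g r0 ^ 2" "g r2 ^ 4 = g r0 ^ 4" "g r1 = g r0"
    using g(2) nz by (simp_all add: prod_rays forall_3 power_int_minus field_simps)
  have "\<forall>v\<in>rays. g v = g r0 * twist (g r2 / g r0) v"
    using eqs nz by (simp add: rays_def field_simps power2_eq_square)
  moreover have "(g r2 / g r0) ^ 4 = 1"
    using eqs nz by (simp add: power_divide)
  ultimately show ?R using g(3) nz by metis
next
  assume ?R
  then obtain l \<zeta> where *: "l \<noteq> 0" "\<zeta> ^ 4 = 1" "\<forall>v\<in>rays. y v = l * twist \<zeta> v * x v"
    by blast
  have "\<zeta> \<noteq> 0" using *(2) by auto
  then have "(\<Prod>v\<in>rays. (l * twist \<zeta> v) powi (v $ i)) = 1" for i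
    using *(1,2) exhaust_3[of i]
    by (auto simp: prod_rays power_int_minus field_simps power_mult_distrib power2_eq_square power4_eq_xxxx)
  then show ?L
    unfolding same_point_def Union_quotient_fan using *
    by (intro exI[of _ "\<lambda>v. l * twist \<zeta> v"]) auto
qed

lemma chart_point_range [simp]: "inj b \<Longrightarrow> chart_point b z (b l) = z $ l"
  by (simp add: chart_point_def)

lemma charts_iff: "b \<in> charts quotient_fan \<longleftrightarrow> inj b \<and> range b \<subseteq> rays"
proof -
  have "range b \<noteq> rays" if "inj b"
    using card_image[OF that] card_rays by auto
  then show ?thesis by (auto simp: charts_def quotient_fan_def)
qed

text \<open>The ray whose Cox coordinate is 1 on the chart.\<close>

definition missing :: "(3 \<Rightarrow> int ^ 3) \<Rightarrow> int ^ 3" where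
  "missing b = (THE v. v \<in> rays \<and> v \<notin> range b)"

lemma missing_unique:
  assumes "b \<in> charts quotient_fan"
  shows "\<exists>!v. v \<in> rays \<and> v \<notin> range b"
proof -
  have "card (rays - range b) = 1"
    using assms card_image[of b UNIV] card_rays
    by (subst card_Diff_subset) (auto simp: charts_iff)
  then obtain v where "rays - range b = {v}" by (auto simp: card_1_singleton_iff)
  then show ?thesis by (metis Diff_iff singleton_iff)
qed

lemma missing_in_rays_Diff: "b \<in> charts quotient_fan \<Longrightarrow> missing b \<in> rays \<and> missing b \<notin> range b"
  unfolding missing_def by (rule theI'[OF missing_unique])

lemma missing_rays: "b \<in> charts quotient_fan \<Longrightarrow> missing b \<in> rays"
  by (simp only: missing_in_rays_Diff)

lemma missing_notin: "b \<in> charts quotient_fan \<Longrightarrow> missing b \<notin> range b"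
  by (simp only: missing_in_rays_Diff not_False_eq_True)

lemma rays_insert_missing:
  assumes "b \<in> charts quotient_fan"
  shows "rays = insert (missing b) (range b)"
proof
  show "rays \<subseteq> insert (missing b) (range b)"
    using missing_unique[OF assms] missing_in_rays_Diff[OF assms] by blast
  show "insert (missing b) (range b) \<subseteq> rays"
    using missing_rays[OF assms] assms by (simp add: charts_iff)
qed

lemma chart_inj: "b \<in> charts quotient_fan \<Longrightarrow> inj b"
  by (simp add: charts_iff)

lemma chart_in_rays: "b \<in> charts quotient_fan \<Longrightarrow> b l \<in> rays"
  by (auto simp: charts_iff)

lemma chart_neq_missing: "b \<in> charts quotient_fan \<Longrightarrow> b l \<noteq> missing b"
  using missing_notin[of b] by (metis rangeI)

lemma chart_point_missing [simp]:
  "b \<in> charts quotient_fan \<Longrightarrow> chart_point b z (missing b) = 1"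
  by (simp add: chart_point_def missing_notin)

lemma sum_rays_chart:
  assumes "b \<in> charts quotient_fan"
  shows "(\<Sum>v\<in>rays. f v) = f (missing b) + (\<Sum>l\<in>UNIV. f (b l) :: 'a::comm_monoid_add)"
  unfolding rays_insert_missing[OF assms]
  by (simp add: missing_notin[OF assms] sum.reindex[OF chart_inj[OF assms]])

lemma prod_rays_chart:
  assumes "b \<in> charts quotient_fan"
  shows "(\<Prod>v\<in>rays. f v) = f (missing b) * (\<Prod>l\<in>UNIV. f (b l) :: 'a::comm_monoid_mult)"
  unfolding rays_insert_missing[OF assms]
  by (simp add: missing_notin[OF assms] prod.reindex[OF chart_inj[OF assms]])

lemma chart_missing_exists:
  assumes "v \<in> rays"
  shows "\<exists>b\<in>charts quotient_fan. missing b = v"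
proof -
  have "card (rays - {v}) = card (UNIV :: 3 set)"
    by (simp add: card_Diff_singleton[OF assms] card_rays)
  then obtain b :: "3 \<Rightarrow> int ^ 3" where b: "bij_betw b UNIV (rays - {v})"
    by (metis finite finite_Diff finite_rays finite_same_card_bij)
  then have c: "b \<in> charts quotient_fan"
    by (auto simp: charts_iff bij_betw_def)
  have "range b = rays - {v}" using b by (simp add: bij_betw_def)
  then have "missing b = v"
    using missing_rays[OF c] missing_notin[OF c] by blast
  then show ?thesis using c by blast
qed

section \<open>Holomorphic maps\<close>

lemma has_derivative_vec:
  fixes f :: "'a::real_normed_vector \<Rightarrow> complex ^ 'm::finite"
  assumes "\<And>i. ((\<lambda>x. f x $ i) has_derivative (\<lambda>h. D i h)) (at x)"
  shows "(f has_derivative (\<lambda>h. \<chi> i. D i h)) (at x)"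
proof -
  have lin: "bounded_linear (axis i :: complex \<Rightarrow> complex ^ 'm)" for i
    by (intro linear_conv_bounded_linear[THEN iffD1] linearI)
      (simp_all add: axis_def vec_eq_iff)
  have "((\<lambda>x. \<Sum>i\<in>UNIV. axis i (f x $ i)) has_derivative
      (\<lambda>h. \<Sum>i\<in>UNIV. axis i (D i h))) (at x)"
    by (intro has_derivative_sum bounded_linear.has_derivative[OF lin] assms)
  moreover have "(\<Sum>i\<in>UNIV. axis i (v i)) = (\<chi> i. v i)" for v :: "'m \<Rightarrow> complex"
    by (simp add: vec_eq_iff axis_def if_distrib sum.delta cong: if_cong)
  ultimately show ?thesis by simp
qed

lemma holomorphic_map_on_has_derivative:
  assumes "holomorphic_map_on f U" "z \<in> U"
  shows "(f has_derivative frechet_derivative f (at z)) (at z)"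
    and "frechet_derivative f (at z) (c *s v) = c *s frechet_derivative f (at z) v"
proof -
  obtain D where D: "(f has_derivative D) (at z)" "\<forall>c v. D (c *s v) = c *s D v"
    using assms unfolding holomorphic_map_on_def by blast
  then have "D = frechet_derivative f (at z)" by (simp add: frechet_derivative_at)
  with D show "(f has_derivative frechet_derivative f (at z)) (at z)"
    "frechet_derivative f (at z) (c *s v) = c *s frechet_derivative f (at z) v" by auto
qed

lemma holomorphic_map_on_continuous:
  assumes "holomorphic_map_on f U"
  shows "continuous_on U f"
  using holomorphic_map_on_has_derivative(1)[OF assms]
  by (meson continuous_at_imp_continuous_on has_derivative_continuous)

lemma norm_axis_complex: "norm (axis j \<zeta> :: complex ^ 'n::finite) = norm (\<zeta> :: complex)"
proof -
  have "(\<Sum>i\<in>UNIV. (norm (axis j \<zeta> $ i :: complex))\<^sup>2) = (\<Sum>i\<in>UNIV. if i = j then (norm \<zeta>)\<^sup>2 else 0)"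
    by (intro sum.cong) (auto simp: axis_def)
  then show ?thesis by (simp add: norm_vec_def L2_set_def)
qed

lemma jacobian_nth: "jacobian f z $ i $ j = frechet_derivative f (at z) (axis j 1) $ i"
  by (simp add: jacobian_def matrix_def)

text \<open>Complex linearity turns the Frechet derivative along a coordinate disc into
  multiplication by a Jacobian entry, so that the theory of one complex variable applies.\<close>

lemma partial_derivative_holomorphic:
  fixes f :: "complex ^ 'n::finite \<Rightarrow> complex ^ 'm::finite"
  assumes "holomorphic_map_on f U" "z + \<zeta> *s axis j 1 \<in> U"
  shows "((\<lambda>\<zeta>. f (z + \<zeta> *s axis j 1) $ i) has_field_derivative
    jacobian f (z + \<zeta> *s axis j 1) $ i $ j) (at \<zeta>)"
proof -
  let ?D = "frechet_derivative f (at (z + \<zeta> *s axis j 1))"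
  have lin: "((\<lambda>\<zeta>. z + \<zeta> *s axis j 1) has_derivative (\<lambda>h. h *s axis j 1)) (at \<zeta>)"
  proof -
    have "((\<lambda>\<zeta>. z + \<zeta> *s axis j 1) has_derivative (\<lambda>h. \<chi> i. h * axis j 1 $ i)) (at \<zeta>)"
      by (rule has_derivative_vec) (auto intro!: derivative_eq_intros)
    moreover have "(\<chi> i. h * axis j 1 $ i) = h *s axis j 1" for h :: complex
      by (simp add: vec_eq_iff)
    ultimately show ?thesis by simp
  qed
  have "((\<lambda>\<zeta>. f (z + \<zeta> *s axis j 1)) has_derivative (\<lambda>h. ?D (h *s axis j 1))) (at \<zeta>)"
    using has_derivative_compose[OF lin holomorphic_map_on_has_derivative(1)[OF assms]] .
  then have "((\<lambda>\<zeta>. f (z + \<zeta> *s axis j 1) $ i) has_derivative (\<lambda>h. ?D (h *s axis j 1) $ i)) (at \<zeta>)"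
    by (rule bounded_linear.has_derivative[OF bounded_linear_vec_nth])
  moreover have "?D (h *s axis j 1) $ i = jacobian f (z + \<zeta> *s axis j 1) $ i $ j * h" for h
    unfolding holomorphic_map_on_has_derivative(2)[OF assms] by (simp add: jacobian_nth)
  ultimately show ?thesis by (simp add: has_field_derivative_def)
qed

text \<open>The restrictions of \<open>f\<close> to parallel coordinate discs converge uniformly, hence so do
  their derivatives.\<close>

lemma isCont_jacobian:
  fixes f :: "complex ^ 'n::finite \<Rightarrow> complex ^ 'm::finite"
  assumes hol: "holomorphic_map_on f U" and "open U" "z \<in> U"
  shows "isCont (\<lambda>w. jacobian f w $ i $ j) z"
proof -
  obtain e where e: "e > 0" "cball z e \<subseteq> U"
    using assms(2,3) open_contains_cball by blast
  \<comment> \<open>With half the radius, the discs of radius \<open>r\<close> around points of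
    \<open>cball z r\<close> stay in \<open>cball z e\<close>, where \<open>f\<close> is uniformly
    continuous.\<close>
  define r where "r = e / 2"
  have r: "r > 0" "r + r = e" using e by (auto simp: r_def)
  have norm_ax: "norm (\<zeta> *s axis j 1 :: complex ^ 'n) = norm \<zeta>" for \<zeta> :: complex
  proof -
    have "\<zeta> *s axis j 1 = (axis j \<zeta> :: complex ^ 'n)"
      by (simp add: vec_eq_iff axis_def)
    then show ?thesis by (simp add: norm_axis_complex)
  qed
  have sub: "w + \<zeta> *s axis j 1 \<in> cball z e" if "w \<in> cball z r" "\<zeta> \<in> cball 0 r" for w \<zeta>
  proof -
    have "dist z (w + \<zeta> *s axis j 1) \<le> dist z w + dist w (w + \<zeta> *s axis j 1)"
      by (rule dist_triangle)
    also have "\<dots> \<le> r + r"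
      using that norm_ax[of \<zeta>] by (intro add_mono) (simp_all add: dist_norm)
    finally show ?thesis by (simp add: r)
  qed
  have cont: "continuous_on (cball z e) f"
    using holomorphic_map_on_continuous[OF hol] e(2) continuous_on_subset by blast
  have uc: "uniformly_continuous_on (cball z e) f"
    by (intro compact_uniformly_continuous cont compact_cball)
  have near: "\<forall>\<^sub>F w in at z. w \<in> cball z r"
    using r(1) unfolding eventually_at by (auto intro!: exI[of _ r] simp: dist_commute)
  define g where "g w \<zeta> = f (w + \<zeta> *s axis j 1) $ i" for w \<zeta>
  have ulim: "uniform_limit (cball 0 r) g (g z) (at z)"
  proof (rule uniform_limitI)
    fix \<epsilon> :: real assume "\<epsilon> > 0"
    then obtain d where d: "d > 0"
      "\<And>x y. x \<in> cball z e \<Longrightarrow> y \<in> cball z e \<Longrightarrow> dist y x < d \<Longrightarrow> dist (f y) (f x) < \<epsilon>"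
      using uc unfolding uniformly_continuous_on_def by metis
    have "\<forall>\<^sub>F w in at z. dist w z < d"
      using d(1) by (auto simp: eventually_at)
    with near show "\<forall>\<^sub>F w in at z. \<forall>\<zeta>\<in>cball 0 r. dist (g w \<zeta>) (g z \<zeta>) < \<epsilon>"
    proof eventually_elim
      case (elim w)
      show ?case
      proof
        fix \<zeta> :: complex assume \<zeta>: "\<zeta> \<in> cball 0 r"
        have "dist (f (w + \<zeta> *s axis j 1)) (f (z + \<zeta> *s axis j 1)) < \<epsilon>"
          using elim r(1) \<zeta> by (intro d(2) sub) auto
        then show "dist (g w \<zeta>) (g z \<zeta>) < \<epsilon>"
          unfolding g_def using dist_vec_nth_le le_less_trans by blast
      qed
    qed
  qed
  have der: "(g w has_field_derivative jacobian f (w + \<zeta> *s axis j 1) $ i $ j) (at \<zeta>)"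
    if "w \<in> cball z r" "\<zeta> \<in> cball 0 r" for w \<zeta>
    unfolding g_def using sub[OF that] e(2) by (intro partial_derivative_holomorphic[OF hol]) auto
  have "\<forall>\<^sub>F w in at z. continuous_on (cball 0 r) (g w) \<and>
      (\<forall>\<zeta>\<in>ball 0 r. (g w has_field_derivative jacobian f (w + \<zeta> *s axis j 1) $ i $ j) (at \<zeta>))"
    using near
  proof eventually_elim
    case (elim w)
    show ?case
    proof
      show "continuous_on (cball 0 r) (g w)"
        using der[OF elim] by (meson DERIV_isCont continuous_at_imp_continuous_on)
    qed (use der[OF elim] in auto)
  qed
  then obtain g' where
    "\<And>\<zeta>. \<zeta> \<in> ball 0 r \<Longrightarrow> (g z has_field_derivative g' \<zeta>) (at \<zeta>) \<and>
      ((\<lambda>w. jacobian f (w + \<zeta> *s axis j 1) $ i $ j) \<longlongrightarrow> g' \<zeta>) (at z)"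
    by (rule has_complex_derivative_uniform_limit[OF _ ulim _ r(1)]) auto
  from this[of 0] have g': "(g z has_field_derivative g' 0) (at 0)"
    "((\<lambda>w. jacobian f w $ i $ j) \<longlongrightarrow> g' 0) (at z)"
    using r(1) by auto
  have "(g z has_field_derivative jacobian f z $ i $ j) (at 0)"
    using der[of z 0] r(1) by simp
  then have "g' 0 = jacobian f z $ i $ j"
    using g'(1) DERIV_unique by blast
  then show ?thesis using g'(2) by (simp add: isCont_def)
qed

section \<open>Density of the torus\<close>

definition torus :: "(complex ^ 'n) set" where
  "torus = {z. \<forall>i. z $ i \<noteq> 0}"

lemma open_torus: "open (torus :: (complex ^ 'n::finite) set)"
proof -
  have "torus = (\<Inter>i. (\<lambda>z. z $ i) -` (- {0 :: complex}) :: (complex ^ 'n) set)"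
    by (auto simp: torus_def)
  also have "open \<dots>"
    by (intro open_INT ballI open_vimage continuous_intros) auto
  finally show ?thesis .
qed

text \<open>The points \<open>z + t *s 1\<close> lie in the torus for all small
  \<open>t \<noteq> 0\<close>: a zero coordinate of \<open>z\<close> becomes \<open>t\<close>, a
  nonzero one stays nonzero.\<close>

lemma eq_by_density:
  fixes f g :: "complex ^ 'n::finite \<Rightarrow> 'b::t2_space"
  assumes "open U" "z \<in> U" "isCont f z" "isCont g z"
    and eq: "\<And>w. w \<in> U \<Longrightarrow> w \<in> torus \<Longrightarrow> f w = g w"
  shows "f z = g z"
proof -
  define p :: "complex \<Rightarrow> complex ^ 'n" where "p t = z + t *s 1" for t
  have "((\<lambda>t. \<chi> i. z $ i + t) \<longlongrightarrow> (\<chi> i. z $ i + 0)) (at 0)"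
    by (intro tendsto_vec_lambda tendsto_intros)
  moreover have "(\<chi> i. z $ i + t) = p t" for t by (simp add: p_def vec_eq_iff)
  moreover have "(\<chi> i. z $ i + 0) = z" by (simp add: vec_eq_iff)
  ultimately have p: "(p \<longlongrightarrow> z) (at 0)" by simp
  have "\<forall>\<^sub>F t in at 0. p t $ i \<noteq> 0" for i
  proof (cases "z $ i = 0")
    case True
    then show ?thesis by (simp add: p_def eventually_at_filter)
  next
    case False
    then show ?thesis
      using tendsto_imp_eventually_ne[OF tendsto_vec_nth[OF p]] by blast
  qed
  then have "\<forall>\<^sub>F t in at 0. p t \<in> torus"
    by (simp add: torus_def eventually_all_finite)
  moreover have "\<forall>\<^sub>F t in at 0. p t \<in> U"
    using p assms(1,2) by (rule topological_tendstoD)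
  ultimately have "\<forall>\<^sub>F t in at 0. f (p t) = g (p t)"
    by eventually_elim (rule eq)
  moreover have "((\<lambda>t. f (p t)) \<longlongrightarrow> f z) (at 0)" "((\<lambda>t. g (p t)) \<longlongrightarrow> g z) (at 0)"
    using assms(3,4) p by (auto intro: isCont_tendsto_compose)
  ultimately show ?thesis
    using tendsto_cong[of "\<lambda>t. f (p t)" "\<lambda>t. g (p t)"] tendsto_unique[OF trivial_limit_at] by blast
qed

section \<open>Chart changes\<close>

lemma chart_point_nonzero:
  assumes "b \<in> charts quotient_fan" "z \<in> torus"
  shows "chart_point b z v \<noteq> 0"
  using assms by (auto simp: chart_point_def torus_def)

lemma chart_point_has_derivative:
  "((\<lambda>z. chart_point b z v) has_derivative
    (\<lambda>h. if v \<in> range b then h $ (inv b v) else 0)) (at z)"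
proof (cases "v \<in> range b")
  case True
  have "((\<lambda>z. z $ inv b v) has_derivative (\<lambda>h. h $ inv b v)) (at z)"
    by (rule bounded_linear.has_derivative[OF bounded_linear_vec_nth has_derivative_ident])
  then show ?thesis using True by (simp add: chart_point_def)
qed (simp add: chart_point_def)

lemma isCont_chart_point: "isCont (\<lambda>z. chart_point b z v) z"
  using chart_point_has_derivative has_derivative_continuous by blast

lemma chart_point_partial_derivative:
  assumes "inj b"
  shows "((\<lambda>\<zeta>. chart_point b (z + \<zeta> *s axis l 1) v) has_field_derivative
    of_bool (v = b l)) (at \<zeta>)"
proof (cases "v \<in> range b")
  case True
  then obtain k where k: "v = b k" by blast
  show ?thesis
    using assms by (cases "k = l") (auto simp: k axis_def inj_eq intro!: derivative_eq_intros)
next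
  case False
  then show ?thesis by (auto simp: chart_point_def)
qed

lemma chart_changeE:
  assumes "chart_change quotient_fan b c U \<phi>" "z \<in> U"
  obtains l \<zeta> where "l \<noteq> 0" "\<zeta> ^ 4 = 1"
    "\<And>v. v \<in> rays \<Longrightarrow> chart_point c (\<phi> z) v = l * twist \<zeta> v * chart_point b z v"
    "l * twist \<zeta> (missing c) * chart_point b z (missing c) = 1"
proof -
  have c: "c \<in> charts quotient_fan" using assms by (simp add: chart_change_def)
  obtain l \<zeta> where *: "l \<noteq> 0" "\<zeta> ^ 4 = 1"
    "\<And>v. v \<in> rays \<Longrightarrow> chart_point c (\<phi> z) v = l * twist \<zeta> v * chart_point b z v"
    using assms unfolding chart_change_def same_point_iff by blast
  then show thesis
    using that[of l \<zeta>] *(3)[OF missing_rays[OF c]] c by simp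
qed

text \<open>The scalar and the root of unity in \<open>same_point\<close> depend on \<open>z\<close>
  in an uncontrolled way. Fourth powers kill the root of unity, the coordinate of the missing ray
  eliminates the scalar, and an identity between differentiable functions remains.\<close>

lemma chart_change_power4:
  assumes "chart_change quotient_fan b c U \<phi>" "z \<in> U"
  shows "\<phi> z $ i ^ 4 * chart_point b z (missing c) ^ 4 = chart_point b z (c i) ^ 4"
proof -
  have c: "c \<in> charts quotient_fan" using assms by (simp add: chart_change_def)
  obtain l \<zeta> where *: "l \<noteq> 0" "\<zeta> ^ 4 = 1"
    "\<And>v. v \<in> rays \<Longrightarrow> chart_point c (\<phi> z) v = l * twist \<zeta> v * chart_point b z v"
    "l * twist \<zeta> (missing c) * chart_point b z (missing c) = 1"
    using chart_changeE[OF assms] by blast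
  have "\<phi> z $ i = l * twist \<zeta> (c i) * chart_point b z (c i)"
    using *(3)[OF chart_in_rays[OF c], of i] chart_inj[OF c] by simp
  then have "\<phi> z $ i ^ 4 = l ^ 4 * chart_point b z (c i) ^ 4"
    by (simp add: power_mult_distrib twist_power4[OF *(2)])
  moreover have "l ^ 4 * chart_point b z (missing c) ^ 4 = 1"
    using arg_cong[OF *(4), of "\<lambda>x. x ^ 4"] by (simp add: power_mult_distrib twist_power4[OF *(2)])
  ultimately show ?thesis by (simp add: algebra_simps)
qed

text \<open>Logarithmic differentiation of the preceding identity along a coordinate line: with
  \<open>f\<close>, \<open>x\<close>, \<open>y\<close> as below,
  \<open>f' / f = y' / y - x' / x\<close>, and each of \<open>x\<close> and \<open>y\<close> is
  either constant or the moving coordinate.\<close>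

lemma jacobian_chart_change:
  assumes ch: "chart_change quotient_fan b c U \<phi>" and z: "z \<in> U" "z \<in> torus"
  shows "jacobian \<phi> z $ i $ l =
    \<phi> z $ i * (of_bool (c i = b l) - of_bool (missing c = b l)) / z $ l"
proof -
  have b: "b \<in> charts quotient_fan" and "open U" and hol: "holomorphic_map_on \<phi> U"
    using ch by (auto simp: chart_change_def)
  define p where "p \<zeta> = z + \<zeta> *s axis l 1" for \<zeta> :: complex
  have p0: "p 0 = z" by (simp add: p_def)
  define f where "f \<zeta> = \<phi> (p \<zeta>) $ i" for \<zeta>
  define x where "x \<zeta> = chart_point b (p \<zeta>) (missing c)" for \<zeta>
  define y where "y \<zeta> = chart_point b (p \<zeta>) (c i)" for \<zeta>
  have df: "(f has_field_derivative jacobian \<phi> z $ i $ l) (at 0)"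
    using partial_derivative_holomorphic[OF hol, of z 0 l i] z(1) by (simp add: f_def[abs_def] p_def)
  have dx: "(x has_field_derivative of_bool (missing c = b l)) (at 0)"
    and dy: "(y has_field_derivative of_bool (c i = b l)) (at 0)"
    unfolding x_def y_def p_def
    by (rule chart_point_partial_derivative[OF chart_inj[OF b]])+
  have "(p \<longlongrightarrow> z) (at 0)"
  proof -
    have "((\<lambda>\<zeta>. \<chi> i. z $ i + \<zeta> * axis l 1 $ i) \<longlongrightarrow> (\<chi> i. z $ i + 0 * axis l 1 $ i)) (at 0)"
      by (intro tendsto_vec_lambda tendsto_intros)
    moreover have "(\<chi> i. z $ i + \<zeta> * axis l 1 $ i) = p \<zeta>" for \<zeta>
      by (simp add: p_def vec_eq_iff)
    moreover have "(\<chi> i. z $ i + 0 * axis l 1 $ i) = z" by (simp add: vec_eq_iff)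
    ultimately show ?thesis by simp
  qed
  then have "\<forall>\<^sub>F \<zeta> in at 0. p \<zeta> \<in> U"
    using \<open>open U\<close> z(1) by (rule topological_tendstoD)
  then have "\<forall>\<^sub>F \<zeta> in nhds 0. p \<zeta> \<in> U"
    using z(1) p0 by (auto simp: eventually_at_filter elim: eventually_mono)
  then have ev: "\<forall>\<^sub>F \<zeta> in nhds 0. f \<zeta> ^ 4 * x \<zeta> ^ 4 = y \<zeta> ^ 4"
    by eventually_elim (auto simp: f_def x_def y_def intro: chart_change_power4[OF ch])
  have "((\<lambda>\<zeta>. f \<zeta> ^ 4 * x \<zeta> ^ 4) has_field_derivative
      4 * f 0 ^ 3 * jacobian \<phi> z $ i $ l * x 0 ^ 4 + 4 * x 0 ^ 3 * of_bool (missing c = b l) * f 0 ^ 4) (at 0)"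
    by (rule derivative_eq_intros df dx refl | simp)+
  moreover have "((\<lambda>\<zeta>. y \<zeta> ^ 4) has_field_derivative 4 * y 0 ^ 3 * of_bool (c i = b l)) (at 0)"
    by (rule derivative_eq_intros dy refl | simp)+
  ultimately have der: "4 * f 0 ^ 3 * jacobian \<phi> z $ i $ l * x 0 ^ 4
      + 4 * x 0 ^ 3 * of_bool (missing c = b l) * f 0 ^ 4 = 4 * y 0 ^ 3 * of_bool (c i = b l)"
    using DERIV_cong_ev[OF refl ev refl] DERIV_unique by blast
  have nz: "x 0 \<noteq> 0" "y 0 \<noteq> 0"
    using chart_point_nonzero[OF b z(2)] by (auto simp: x_def y_def p0)
  have val: "f 0 ^ 4 * x 0 ^ 4 = y 0 ^ 4"
    using chart_change_power4[OF ch z(1)] by (simp add: f_def x_def y_def p0)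
  then have nf: "f 0 \<noteq> 0" using nz by auto
  have "jacobian \<phi> z $ i $ l = f 0 * (of_bool (c i = b l) / y 0 - of_bool (missing c = b l) / x 0)"
  proof -
    \<comment> \<open>\<open>val\<close> trades \<open>y 0 ^ 4\<close> for
      \<open>f 0 ^ 4 * x 0 ^ 4\<close>, which exposes a common nonzero factor.\<close>
    have "(4 * f 0 ^ 3 * x 0 ^ 4 * y 0) * jacobian \<phi> z $ i $ l
        = 4 * (y 0 ^ 4) * of_bool (c i = b l) - 4 * x 0 ^ 3 * of_bool (missing c = b l) * f 0 ^ 4 * y 0"
      using arg_cong[OF der, of "\<lambda>t. t * y 0"]
      by (simp add: algebra_simps power_numeral_reduce)
    also have "\<dots> = (4 * f 0 ^ 3 * x 0 ^ 4 * y 0) *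
        (f 0 * (of_bool (c i = b l) / y 0 - of_bool (missing c = b l) / x 0))"
      unfolding val[symmetric] using nz by (simp add: field_simps power_numeral_reduce)
    finally show ?thesis using nz nf by simp
  qed
  moreover have "of_bool (v = b l) / chart_point b z v = of_bool (v = b l) / z $ l" for v
    using chart_inj[OF b] by auto
  ultimately show ?thesis by (simp add: f_def x_def y_def p0 diff_divide_distrib)
qed

definition ray_matrix :: "(3 \<Rightarrow> int ^ 3) \<Rightarrow> complex ^ 3 ^ 3" where
  "ray_matrix b = (\<chi> k l. of_int (b l $ k))"

text \<open>Up to sign the determinant is the lattice index of the cone, the order of the
  uniformizing group. It is 4 for every chart and cancels when two charts are compared.\<close>

lemma det_ray_matrix:
  assumes "b \<in> charts quotient_fan"
  shows "det (ray_matrix b) ^ 2 = 16"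
proof -
  have "b 1 \<in> rays" "b 2 \<in> rays" "b 3 \<in> rays"
    using chart_in_rays[OF assms] by auto
  moreover have "b 1 \<noteq> b 2" "b 1 \<noteq> b 3" "b 2 \<noteq> b 3"
    using chart_inj[OF assms] by (simp_all add: inj_eq)
  ultimately show ?thesis
    unfolding det_3 ray_matrix_def rays_def by auto
qed

text \<open>The summand vanishes at \<open>missing c\<close>, so the sum may run over all rays, and
  there the second term drops out because the rays sum to zero.\<close>

lemma ray_matrix_change:
  assumes b: "b \<in> charts quotient_fan" and c: "c \<in> charts quotient_fan"
  shows "(\<Sum>i\<in>UNIV. of_int (c i $ k) * (of_bool (c i = b l) - of_bool (missing c = b l)))
    = (of_int (b l $ k) :: complex)"
proof -
  let ?f = "\<lambda>v. of_int (v $ k) * (of_bool (v = b l) - of_bool (missing c = b l)) :: complex"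
  have "(\<Sum>v\<in>rays. of_int (v $ k)) = (0 :: complex)"
    using exhaust_3[of k] by (auto simp: sum_rays)
  moreover have "(\<Sum>v\<in>rays. of_int (v $ k) * of_bool (v = b l)) = (of_int (b l $ k) :: complex)"
    using chart_in_rays[OF b] by (simp add: of_bool_def if_distrib cong: if_cong)
  ultimately have "(\<Sum>v\<in>rays. ?f v) = of_int (b l $ k)"
    by (simp add: algebra_simps sum_subtractf flip: sum_distrib_left)
  then show ?thesis
    using sum_rays_chart[OF c, of ?f] by (auto split: if_splits)
qed

text \<open>In logarithmic coordinates the Jacobian relates two ray matrices, whose determinants are
  4 or -4. So up to a sign, which squaring removes, its determinant is the quotient of the products
  of the coordinates. This quotient is \<open>l ^ 4\<close>, and \<open>l\<close> is inverse to
  \<open>chart_point b z (missing c)\<close> up to a fourth root of unity.\<close>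

lemma det_jacobian_chart_change_torus:
  assumes ch: "chart_change quotient_fan b c U \<phi>" and z: "z \<in> U" "z \<in> torus"
  shows "det (jacobian \<phi> z) ^ 2 * chart_point b z (missing c) ^ 8 = 1"
proof -
  have b: "b \<in> charts quotient_fan" and c: "c \<in> charts quotient_fan"
    using ch by (auto simp: chart_change_def)
  obtain l \<zeta> where *: "l \<noteq> 0" "\<zeta> ^ 4 = 1"
    "\<And>v. v \<in> rays \<Longrightarrow> chart_point c (\<phi> z) v = l * twist \<zeta> v * chart_point b z v"
    "l * twist \<zeta> (missing c) * chart_point b z (missing c) = 1"
    using chart_changeE[OF ch z(1)] by blast
  have \<phi>nz: "\<phi> z $ i \<noteq> 0" for i
    using *(3)[OF chart_in_rays[OF c], of i] chart_point_nonzero[OF b z(2)] *(1) *(2) chart_inj[OF c]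
    by simp
  have znz: "z $ i \<noteq> 0" for i using z(2) by (simp add: torus_def)
  define S :: "complex ^ 3 ^ 3" where "S = (\<chi> i j. if i = j then inverse (\<phi> z $ i) else 0)"
  define T :: "complex ^ 3 ^ 3" where "T = (\<chi> i j. if i = j then inverse (z $ i) else 0)"
  have "(ray_matrix c ** S ** jacobian \<phi> z) $ k $ m = (ray_matrix b ** T) $ k $ m" for k m
  proof -
    have "(ray_matrix c ** S ** jacobian \<phi> z) $ k $ m
        = (\<Sum>i\<in>UNIV. of_int (c i $ k) * inverse (\<phi> z $ i) * jacobian \<phi> z $ i $ m)"
      by (simp add: matrix_matrix_mult_def ray_matrix_def S_def if_distrib cong: if_cong)
    also have "\<dots> = (\<Sum>i\<in>UNIV. of_int (c i $ k) * (of_bool (c i = b m) - of_bool (missing c = b m)) / z $ m)"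
      using \<phi>nz by (intro sum.cong) (simp_all add: jacobian_chart_change[OF ch z])
    also have "\<dots> = of_int (b m $ k) / z $ m"
      by (simp add: ray_matrix_change[OF b c] flip: sum_divide_distrib)
    also have "\<dots> = (ray_matrix b ** T) $ k $ m"
      by (simp add: matrix_matrix_mult_def ray_matrix_def T_def if_distrib divide_inverse cong: if_cong)
    finally show ?thesis .
  qed
  then have "ray_matrix c ** S ** jacobian \<phi> z = ray_matrix b ** T"
    by (simp add: vec_eq_iff)
  then have "det (ray_matrix c) * det S * det (jacobian \<phi> z) = det (ray_matrix b) * det T"
    by (metis det_mul)
  then have "det (ray_matrix c) ^ 2 * det S ^ 2 * det (jacobian \<phi> z) ^ 2
      = det (ray_matrix b) ^ 2 * det T ^ 2"
    by (metis power_mult_distrib)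
  then have "det S ^ 2 * det (jacobian \<phi> z) ^ 2 = det T ^ 2"
    by (simp add: det_ray_matrix b c)
  moreover have "det S = inverse (\<Prod>i\<in>UNIV. \<phi> z $ i)" "det T = inverse (\<Prod>i\<in>UNIV. z $ i)"
    unfolding S_def T_def by (simp_all add: det_diagonal flip: prod_inversef)
  \<comment> \<open>The missing Cox coordinate is 1 in either chart, and the four values of
    \<open>twist \<zeta>\<close> have product 1.\<close>
  moreover have "(\<Prod>i\<in>UNIV. \<phi> z $ i) = l ^ 4 * (\<Prod>i\<in>UNIV. z $ i)"
  proof -
    have "(\<Prod>i\<in>UNIV. \<phi> z $ i) = (\<Prod>v\<in>rays. chart_point c (\<phi> z) v)"
      by (simp add: prod_rays_chart[OF c] c chart_inj[OF c])
    also have "\<dots> = (\<Prod>v\<in>rays. l * twist \<zeta> v) * (\<Prod>v\<in>rays. chart_point b z v)"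
      by (simp add: *(3) prod.distrib)
    also have "(\<Prod>v\<in>rays. l * twist \<zeta> v) = l ^ 4"
      using *(2) by (auto simp: prod_rays power4_eq_xxxx field_simps)
    also have "(\<Prod>v\<in>rays. chart_point b z v) = (\<Prod>i\<in>UNIV. z $ i)"
      by (simp add: prod_rays_chart[OF b] b chart_inj[OF b])
    finally show ?thesis .
  qed
  moreover have "(\<Prod>i\<in>UNIV. z $ i) \<noteq> 0" using znz by simp
  ultimately have "det (jacobian \<phi> z) ^ 2 = (l ^ 4) ^ 2"
    using *(1) by (simp add: field_simps)
  moreover have "l ^ 8 * chart_point b z (missing c) ^ 8 = 1"
  proof -
    have "twist \<zeta> (missing c) ^ 8 = (twist \<zeta> (missing c) ^ 4) ^ 2" by simp
    then have "twist \<zeta> (missing c) ^ 8 = 1" by (simp only: twist_power4[OF *(2)] power_one)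
    then show ?thesis
      using arg_cong[OF *(4), of "\<lambda>x. x ^ 8"] by (simp add: power_mult_distrib)
  qed
  ultimately show ?thesis by simp
qed

lemma det_jacobian_chart_change:
  assumes ch: "chart_change quotient_fan b c U \<phi>" and z: "z \<in> U"
  shows "det (jacobian \<phi> z) ^ 2 * chart_point b z (missing c) ^ 8 = 1"
proof -
  have "open U" and hol: "holomorphic_map_on \<phi> U"
    using ch by (auto simp: chart_change_def)
  have "isCont (\<lambda>w. det (jacobian \<phi> w) ^ 2 * chart_point b w (missing c) ^ 8) z"
    unfolding det_3
    by (intro continuous_add continuous_diff continuous_mult continuous_power
        isCont_jacobian[OF hol \<open>open U\<close> z] isCont_chart_point)
  from eq_by_density[OF \<open>open U\<close> z this continuous_const det_jacobian_chart_change_torus[OF ch]]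
  show ?thesis .
qed

text \<open>Supplies the chart changes against which a given section is tested: one explicit lift
  for every pair of charts and every element of the group, defined on the torus.\<close>

lemma standard_chart_change:
  assumes b: "b \<in> charts quotient_fan" and c: "c \<in> charts quotient_fan" and \<zeta>: "\<zeta> ^ 4 = 1"
  shows "chart_change quotient_fan b c torus (\<lambda>z. \<chi> i. twist \<zeta> (c i) * chart_point b z (c i) /
    (twist \<zeta> (missing c) * chart_point b z (missing c)))" (is "chart_change _ _ _ _ ?\<phi>")
  unfolding chart_change_def
proof (intro conjI b c open_torus ballI)
  fix z :: "complex ^ 3" assume z: "z \<in> torus"
  let ?g = "\<lambda>v. twist \<zeta> v * chart_point b z v"
  have nz: "?g (missing c) \<noteq> 0"
    using chart_point_nonzero[OF b z] \<zeta> by simp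
  have "\<forall>v\<in>rays. chart_point c (?\<phi> z) v = inverse (?g (missing c)) * twist \<zeta> v * chart_point b z v"
    unfolding rays_insert_missing[OF c]
    using nz by (auto simp: c chart_inj[OF c] field_simps)
  then show "same_point quotient_fan (chart_point b z) (chart_point c (?\<phi> z))"
    unfolding same_point_iff using nz \<zeta> nonzero_imp_inverse_nonzero by blast
next
  show "holomorphic_map_on ?\<phi> torus" unfolding holomorphic_map_on_def
  proof
    fix z :: "complex ^ 3" assume z: "z \<in> torus"
    define X where "X v = chart_point b z v" for v
    define dX where "dX v h = (if v \<in> range b then h $ (inv b v) else 0)" for v and h :: "complex ^ 3"
    define j where "j = missing c"
    have nz: "X j \<noteq> 0" using chart_point_nonzero[OF b z] by (simp add: X_def)
    define D where "D i h = twist \<zeta> (c i) / twist \<zeta> j *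
      ((dX (c i) h * X j - X (c i) * dX j h) / (X j * X j))" for i h
    have "((\<lambda>w. ?\<phi> w $ i) has_derivative D i) (at z)" for i
    proof -
      have "((\<lambda>w. chart_point b w (c i) / chart_point b w j) has_derivative
          (\<lambda>h. (dX (c i) h * X j - X (c i) * dX j h) / (X j * X j))) (at z)"
        unfolding X_def dX_def
        by (rule has_derivative_divide'[OF chart_point_has_derivative chart_point_has_derivative])
          (use nz in \<open>simp add: X_def\<close>)
      then have "((\<lambda>w. twist \<zeta> (c i) / twist \<zeta> j * (chart_point b w (c i) / chart_point b w j))
          has_derivative D i) (at z)"
        unfolding D_def by (rule has_derivative_mult_right)
      then show ?thesis by (simp add: j_def)
    qed
    then have "(?\<phi> has_derivative (\<lambda>h. \<chi> i. D i h)) (at z)"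
      by (rule has_derivative_vec)
    moreover have "(\<chi> i. D i (t *s h)) = t *s (\<chi> i. D i h)" for t h
      by (simp add: vec_eq_iff D_def dX_def algebra_simps diff_divide_distrib)
    ultimately show "\<exists>D. (?\<phi> has_derivative D) (at z) \<and> (\<forall>t h. D (t *s h) = t *s D h)"
      by blast
  qed
qed

section \<open>Forms and polynomials\<close>

lemma forms_const: "(\<lambda>x. c) \<in> forms X 0"
  by (simp add: forms_def forms_graded.const)

lemma forms_add: "f \<in> forms X d \<Longrightarrow> g \<in> forms X d \<Longrightarrow> (\<lambda>x. f x + g x) \<in> forms X d"
  by (simp add: forms_def forms_graded.add)

lemma forms_generator_mult: "f \<in> X \<Longrightarrow> g \<in> forms X d \<Longrightarrow> (\<lambda>x. f x * g x) \<in> forms X (Suc d)"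
  by (simp add: forms_def forms_graded.mult)

lemma forms_generator:
  assumes "f \<in> X"
  shows "f \<in> forms X 1"
  using forms_generator_mult[OF assms forms_const[of 1]] by simp

lemma forms_cmult:
  assumes "f \<in> forms X d"
  shows "(\<lambda>x. c * f x) \<in> forms X d"
proof -
  have "(d, f) \<in> forms_graded X \<Longrightarrow> (\<lambda>x. c * f x) \<in> forms X d"
  proof (induction rule: forms_graded.induct)
    case (mult f d g)
    then show ?case using forms_generator_mult[of f X "\<lambda>x. c * g x" d]
      by (simp add: mult.left_commute)
  qed (auto simp: forms_const distrib_left intro: forms_add)
  with assms show ?thesis by (simp add: forms_def)
qed

lemma forms_mult:
  assumes "f \<in> forms X d" "g \<in> forms X e"
  shows "(\<lambda>x. f x * g x) \<in> forms X (d + e)"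
proof -
  have "(d, f) \<in> forms_graded X \<Longrightarrow> (\<lambda>x. f x * g x) \<in> forms X (d + e)"
  proof (induction rule: forms_graded.induct)
    case (const c)
    then show ?case using forms_cmult[OF assms(2), of c] by simp
  next
    case (mult f d h)
    then show ?case using forms_generator_mult[of f X "\<lambda>x. h x * g x" "d + e"]
      by (simp add: mult.assoc)
  qed (auto simp: distrib_right intro: forms_add)
  with assms(1) show ?thesis by (simp add: forms_def)
qed

lemma forms_power:
  assumes "f \<in> X"
  shows "(\<lambda>x. f x ^ n) \<in> forms X n"
proof (induction n)
  case (Suc n)
  then show ?case using forms_generator_mult[OF assms] by simp
qed (simp add: forms_const)

lemma forms_prod:
  assumes "finite I" "\<And>i. i \<in> I \<Longrightarrow> f i \<in> forms X (d i)"
  shows "(\<lambda>x. \<Prod>i\<in>I. f i x) \<in> forms X (\<Sum>i\<in>I. d i)"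
  using assms
proof (induction I rule: finite_induct)
  case (insert i I)
  then show ?case using forms_mult[of "f i" X "d i" "\<lambda>x. \<Prod>i\<in>I. f i x"] by simp
qed (simp add: forms_const)

lemma forms_zero:
  assumes "X \<noteq> {}"
  shows "(\<lambda>x. 0) \<in> forms X d"
proof -
  obtain f where "f \<in> X" using assms by blast
  from forms_cmult[OF forms_power[OF this, of d], of 0] show ?thesis by simp
qed

text \<open>If 1 is a generator, its powers raise the degree, so forms of different degrees can be
  added. On each chart one of the sections of -2K is the constant 1.\<close>

lemma forms_degree_mono:
  assumes "(\<lambda>x. 1) \<in> X" "f \<in> forms X d" "d \<le> e"
  shows "f \<in> forms X e"
  using forms_mult[OF forms_power[OF assms(1), of "e - d"] assms(2)] assms(3) by simp

lemma forms_sum_some_degree: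
  assumes one: "(\<lambda>x. 1) \<in> X" and "finite I" "\<And>i. i \<in> I \<Longrightarrow> \<exists>d. f i \<in> forms X d"
  shows "\<exists>d. (\<lambda>x. \<Sum>i\<in>I. f i x) \<in> forms X d"
  using assms(2,3)
proof (induction I rule: finite_induct)
  case empty
  have "(\<lambda>x. \<Sum>i\<in>{}. f i x) \<in> forms X 0" using forms_const[of 0] by simp
  then show ?case by blast
next
  case (insert i I)
  obtain d where d: "f i \<in> forms X d" using insert.prems by blast
  obtain e where e: "(\<lambda>x. \<Sum>i\<in>I. f i x) \<in> forms X e" using insert by blast
  have "(\<lambda>x. f i x + (\<Sum>i\<in>I. f i x)) \<in> forms X (max d e)"
    by (intro forms_add forms_degree_mono[OF one d] forms_degree_mono[OF one e]) auto
  then show ?case using insert(1,2) by auto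
qed

lemma polynomial_map_monomial: "polynomial_map (\<lambda>z :: complex ^ 'n::finite. \<Prod>l\<in>UNIV. z $ l ^ \<beta> l)"
proof -
  let ?X = "range (\<lambda>i z. z $ i) :: (complex ^ 'n \<Rightarrow> complex) set"
  let ?d = "\<Sum>l\<in>UNIV. \<beta> l"
  let ?m = "\<lambda>z :: complex ^ 'n. \<Prod>l\<in>UNIV. z $ l ^ \<beta> l"
  have m: "?m \<in> forms ?X ?d"
    by (intro forms_prod forms_power) auto
  define g where "g e = (if e = ?d then ?m else (\<lambda>_. 0))" for e
  have "\<forall>e\<le>?d. g e \<in> forms ?X e" using m forms_zero[of ?X] by (auto simp: g_def)
  moreover have "?m = (\<lambda>z. \<Sum>e\<le>?d. g e z)"
    by (auto simp: g_def if_distrib[of "\<lambda>f. f _"] cong: if_cong)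
  ultimately show ?thesis unfolding polynomial_map_def by blast
qed

section \<open>Expansion of polynomial maps into monomials\<close>

definition coefficient_expansion :: "(complex ^ 'n::finite \<Rightarrow> complex) \<Rightarrow> bool" where
  "coefficient_expansion f \<longleftrightarrow>
    (\<exists>F a. finite F \<and> f = (\<lambda>z. \<Sum>\<beta>\<in>F. a \<beta> * (\<Prod>l\<in>UNIV. z $ l ^ \<beta> l)))"

lemma coefficient_expansionI:
  assumes "finite F" "\<And>z. f z = (\<Sum>\<beta>\<in>F. a \<beta> * (\<Prod>l\<in>UNIV. z $ l ^ \<beta> l))"
  shows "coefficient_expansion f"
  unfolding coefficient_expansion_def using assms by (intro exI[of _ F] exI[of _ a]) auto

lemma coefficient_expansionE:
  assumes "coefficient_expansion f"
  obtains F a where "finite F" "f = (\<lambda>z. \<Sum>\<beta>\<in>F. a \<beta> * (\<Prod>l\<in>UNIV. z $ l ^ \<beta> l))"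
  using assms unfolding coefficient_expansion_def by (elim exE conjE)

lemma coefficient_expansion_add:
  assumes "coefficient_expansion f" "coefficient_expansion g"
  shows "coefficient_expansion (\<lambda>z. f z + g z)"
proof -
  obtain F a where F: "finite F" "f = (\<lambda>z. \<Sum>\<beta>\<in>F. a \<beta> * (\<Prod>l\<in>UNIV. z $ l ^ \<beta> l))"
    by (rule coefficient_expansionE[OF assms(1)])
  obtain G b where G: "finite G" "g = (\<lambda>z. \<Sum>\<beta>\<in>G. b \<beta> * (\<Prod>l\<in>UNIV. z $ l ^ \<beta> l))"
    by (rule coefficient_expansionE[OF assms(2)])
  define c where "c \<beta> = (if \<beta> \<in> F then a \<beta> else 0) + (if \<beta> \<in> G then b \<beta> else 0)" for \<beta>
  have "f z = (\<Sum>\<beta>\<in>F \<union> G. (if \<beta> \<in> F then a \<beta> else 0) * (\<Prod>l\<in>UNIV. z $ l ^ \<beta> l))" for z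
    unfolding F(2) using F(1) G(1) by (intro sum.mono_neutral_cong_left) auto
  moreover have "g z = (\<Sum>\<beta>\<in>F \<union> G. (if \<beta> \<in> G then b \<beta> else 0) * (\<Prod>l\<in>UNIV. z $ l ^ \<beta> l))" for z
    unfolding G(2) using F(1) G(1) by (intro sum.mono_neutral_cong_left) auto
  ultimately show ?thesis
    using F(1) G(1) by (intro coefficient_expansionI[of "F \<union> G" _ c])
      (simp_all add: c_def sum.distrib distrib_right)
qed

lemma coefficient_expansion_mult:
  assumes "coefficient_expansion f"
  shows "coefficient_expansion (\<lambda>z. z $ i * f z)"
proof -
  obtain F a where F: "finite F" "f = (\<lambda>z. \<Sum>\<beta>\<in>F. a \<beta> * (\<Prod>l\<in>UNIV. z $ l ^ \<beta> l))"
    by (rule coefficient_expansionE[OF assms])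
  define up where "up \<beta> = (\<lambda>l. \<beta> l + (if l = i then 1 else 0) :: nat)" for \<beta>
  have inj: "inj_on up F"
    by (auto simp: inj_on_def up_def fun_eq_iff)
  have up: "z $ i * (\<Prod>l\<in>UNIV. z $ l ^ \<beta> l) = (\<Prod>l\<in>UNIV. z $ l ^ up \<beta> l)"
    for z :: "complex ^ 'a" and \<beta>
  proof -
    have "(\<Prod>l\<in>UNIV. z $ l ^ (if l = i then 1 else 0 :: nat)) = (\<Prod>l\<in>UNIV. if l = i then z $ i else 1)"
      by (intro prod.cong) auto
    then show ?thesis by (simp add: up_def power_add prod.distrib)
  qed
  have "z $ i * f z = (\<Sum>\<beta>\<in>up ` F. a (inv_into F up \<beta>) * (\<Prod>l\<in>UNIV. z $ l ^ \<beta> l))" for z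
  proof -
    have "z $ i * f z = (\<Sum>\<beta>\<in>F. a \<beta> * (z $ i * (\<Prod>l\<in>UNIV. z $ l ^ \<beta> l)))"
      unfolding F(2) sum_distrib_left by (simp only: mult.left_commute)
    then show ?thesis by (simp add: up sum.reindex[OF inj] inv_into_f_f[OF inj])
  qed
  then show ?thesis using F(1) by (intro coefficient_expansionI[of "up ` F"]) auto
qed

lemma coefficient_expansion_const: "coefficient_expansion (\<lambda>z :: complex ^ 'n::finite. c)"
  by (rule coefficient_expansionI[of "{\<lambda>_. 0}" _ "\<lambda>_. c"]) simp_all

lemma polynomial_map_expansion:
  assumes "polynomial_map f"
  shows "coefficient_expansion f"
proof -
  have *: "(d, g) \<in> forms_graded (range (\<lambda>i z. z $ i)) \<Longrightarrow> coefficient_expansion g"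
    for d and g :: "complex ^ 'a \<Rightarrow> complex"
    by (induction rule: forms_graded.induct)
      (auto intro: coefficient_expansion_const coefficient_expansion_mult coefficient_expansion_add)
  obtain D g where g: "\<forall>d\<le>D. g d \<in> forms (range (\<lambda>i z. z $ i)) d" "f = (\<lambda>z. \<Sum>d\<le>D. g d z)"
    using assms unfolding polynomial_map_def by blast
  have "coefficient_expansion (\<lambda>z. \<Sum>d\<in>I. g d z)" if "finite I" "I \<subseteq> {..D}" for I
    using that
  proof (induction I rule: finite_induct)
    case empty
    then show ?case using coefficient_expansion_const[of 0] by simp
  next
    case (insert d I)
    then have "coefficient_expansion (g d)" using g(1) * by (auto simp: forms_def)
    then show ?case using insert by (auto intro: coefficient_expansion_add)
  qed
  then show ?thesis using g(2) by blast
qed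

lemma polynomial_map_isCont:
  assumes "polynomial_map f"
  shows "isCont f z"
proof -
  obtain F a where F: "finite F" "f = (\<lambda>z. \<Sum>\<beta>\<in>F. a \<beta> * (\<Prod>l\<in>UNIV. z $ l ^ \<beta> l))"
    by (rule coefficient_expansionE[OF polynomial_map_expansion[OF assms]])
  show ?thesis unfolding F(2) by (intro continuous_intros)
qed

section \<open>Characters of the torus\<close>

text \<open>The classical argument for independence of characters: replace \<open>X\<close> by the
  product of \<open>X\<close> and \<open>Y\<close> in a relation and subtract
  \<open>?\<chi> \<omega> Y\<close> times the original one. This removes \<open>\<omega>\<close>,
  and the induction hypothesis applies. Exponents vanish off \<open>R\<close>, so distinct ones
  differ at some element of \<open>R\<close>.\<close>

lemma laurent_monomials_independent:
  fixes a :: "('v \<Rightarrow> int) \<Rightarrow> complex"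
  assumes "finite R" "finite F" "\<And>\<alpha> v. \<alpha> \<in> F \<Longrightarrow> v \<notin> R \<Longrightarrow> \<alpha> v = 0"
    and "\<And>X. (\<And>v. X v \<noteq> 0) \<Longrightarrow> (\<Sum>\<alpha>\<in>F. a \<alpha> * (\<Prod>v\<in>R. X v powi \<alpha> v)) = 0"
    and "\<alpha> \<in> F"
  shows "a \<alpha> = 0"
  using assms(2-5)
proof (induction F arbitrary: a \<alpha> rule: finite_induct)
  case empty
  then show ?case by simp
next
  case (insert \<omega> F)
  let ?\<chi> = "\<lambda>\<alpha> X. \<Prod>v\<in>R. X v powi \<alpha> v :: complex"
  have mult: "?\<chi> \<alpha> (\<lambda>v. X v * Y v) = ?\<chi> \<alpha> X * ?\<chi> \<alpha> Y" for \<alpha> X Y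
    by (simp add: power_int_mult_distrib prod.distrib)
  have zero: "a \<alpha> * (?\<chi> \<alpha> Y - ?\<chi> \<omega> Y) = 0" if "\<alpha> \<in> F" "\<And>v. Y v \<noteq> 0" for \<alpha> Y
  proof (rule insert.IH[where a = "\<lambda>\<alpha>. a \<alpha> * (?\<chi> \<alpha> Y - ?\<chi> \<omega> Y)"])
    fix X :: "'v \<Rightarrow> complex" assume X: "\<And>v. X v \<noteq> 0"
    have 1: "a \<omega> * (?\<chi> \<omega> X * ?\<chi> \<omega> Y) + (\<Sum>\<alpha>\<in>F. a \<alpha> * (?\<chi> \<alpha> X * ?\<chi> \<alpha> Y)) = 0"
      using insert.prems(2)[of "\<lambda>v. X v * Y v"] X that(2) insert.hyps by (simp add: mult)
    have 2: "a \<omega> * ?\<chi> \<omega> X + (\<Sum>\<alpha>\<in>F. a \<alpha> * ?\<chi> \<alpha> X) = 0"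
      using insert.prems(2)[of X] X insert.hyps by simp
    have "(\<Sum>\<alpha>\<in>F. a \<alpha> * (?\<chi> \<alpha> Y - ?\<chi> \<omega> Y) * ?\<chi> \<alpha> X)
        = (\<Sum>\<alpha>\<in>F. a \<alpha> * (?\<chi> \<alpha> X * ?\<chi> \<alpha> Y)) - (\<Sum>\<alpha>\<in>F. a \<alpha> * ?\<chi> \<alpha> X) * ?\<chi> \<omega> Y"
      by (simp add: sum_distrib_left sum_distrib_right sum_subtractf algebra_simps)
    also have "\<dots> = 0"
    proof -
      have "(\<Sum>\<alpha>\<in>F. a \<alpha> * (?\<chi> \<alpha> X * ?\<chi> \<alpha> Y)) = - (a \<omega> * (?\<chi> \<omega> X * ?\<chi> \<omega> Y))"
        using 1 by (simp add: add_eq_0_iff)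
      moreover have "(\<Sum>\<alpha>\<in>F. a \<alpha> * ?\<chi> \<alpha> X) = - (a \<omega> * ?\<chi> \<omega> X)"
        using 2 by (simp add: add_eq_0_iff)
      ultimately show ?thesis by simp
    qed
    finally show "(\<Sum>\<alpha>\<in>F. a \<alpha> * (?\<chi> \<alpha> Y - ?\<chi> \<omega> Y) * ?\<chi> \<alpha> X) = 0" .
  qed (use insert.prems that in auto)
  have F0: "a \<alpha> = 0" if \<alpha>: "\<alpha> \<in> F" for \<alpha>
  proof -
    have "\<alpha> \<noteq> \<omega>" using \<alpha> insert.hyps by blast
    then obtain u where u: "\<alpha> u \<noteq> \<omega> u" by (auto simp: fun_eq_iff)
    then have "u \<in> R" using insert.prems(1)[of \<alpha> u] insert.prems(1)[of \<omega> u] \<alpha> by fastforce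
    \<comment> \<open>A torus element at which the characters \<open>\<alpha>\<close> and
      \<open>\<omega>\<close> differ: the character of \<open>\<gamma>\<close> takes the value
      \<open>2 powi \<gamma> u\<close> there.\<close>
    define Y :: "'v \<Rightarrow> complex" where "Y v = (if v = u then 2 else 1)" for v
    have "?\<chi> \<gamma> Y = 2 powi \<gamma> u" for \<gamma>
    proof -
      have "?\<chi> \<gamma> Y = (\<Prod>v\<in>R. if v = u then 2 powi \<gamma> u else 1)"
        by (intro prod.cong) (auto simp: Y_def)
      then show ?thesis using \<open>u \<in> R\<close> assms(1) by simp
    qed
    moreover have "(2 :: complex) powi \<alpha> u \<noteq> 2 powi \<omega> u"
    proof
      assume "(2 :: complex) powi \<alpha> u = 2 powi \<omega> u"
      then have "norm ((2 :: complex) powi \<alpha> u) = norm ((2 :: complex) powi \<omega> u)" by simp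
      then have "(2 :: real) powi \<alpha> u = 2 powi \<omega> u" by (simp add: norm_power_int)
      then show False
        using u power_int_strict_increasing[of "\<alpha> u" "\<omega> u" "2 :: real"]
          power_int_strict_increasing[of "\<omega> u" "\<alpha> u" "2 :: real"]
        by (cases "\<alpha> u < \<omega> u") auto
    qed
    ultimately show ?thesis using zero[OF \<alpha>, of Y] by (auto simp: Y_def)
  qed
  moreover have "a \<omega> = 0"
    using insert.prems(2)[of "\<lambda>_. 1"] insert.hyps F0 by simp
  ultimately show ?case using insert.prems(3) by blast
qed

section \<open>Sections of \<open>-2K\<close>\<close>

text \<open>The congruence is invariance of the monomial under \<open>twist \<i>\<close>, whose
  character is \<open>\<i>\<close> to the power \<open>\<alpha> r2 - \<alpha> r3\<close>. Values off
  the rays are fixed to 0, so that distinct exponents give distinct monomials.\<close>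

definition exponents :: "(int ^ 3 \<Rightarrow> nat) set" where
  "exponents = {\<alpha>. (\<forall>v. v \<notin> rays \<longrightarrow> \<alpha> v = 0) \<and> (\<Sum>v\<in>rays. \<alpha> v) = 8 \<and> \<alpha> r2 mod 4 = \<alpha> r3 mod 4}"

definition monomial :: "(int ^ 3 \<Rightarrow> nat) \<Rightarrow> (int ^ 3 \<Rightarrow> complex) \<Rightarrow> complex" where
  "monomial \<alpha> X = (\<Prod>v\<in>rays. X v ^ \<alpha> v)"

definition monomial_section ::
    "(int ^ 3 \<Rightarrow> nat) \<Rightarrow> (3 \<Rightarrow> int ^ 3) \<Rightarrow> complex ^ 3 \<Rightarrow> complex" where
  "monomial_section \<alpha> b z = (if b \<in> charts quotient_fan then monomial \<alpha> (chart_point b z) else 0)"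

lemma finite_exponents: "finite exponents"
proof (rule finite_subset)
  show "exponents \<subseteq> {f. \<forall>v. (v \<in> rays \<longrightarrow> f v \<in> {..8}) \<and> (v \<notin> rays \<longrightarrow> f v = 0)}"
  proof
    fix \<alpha> assume \<alpha>: "\<alpha> \<in> exponents"
    then have "\<alpha> v \<le> 8" if "v \<in> rays" for v
      using member_le_sum[of v rays \<alpha>] that by (simp add: exponents_def)
    with \<alpha> show "\<alpha> \<in> {f. \<forall>v. (v \<in> rays \<longrightarrow> f v \<in> {..8}) \<and> (v \<notin> rays \<longrightarrow> f v = 0)}"
      by (simp add: exponents_def)
  qed
qed (rule finite_set_of_finite_funs, auto)

lemma i_power_eq_iff: "\<i> ^ m = \<i> ^ n \<longleftrightarrow> m mod 4 = n mod 4"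
proof -
  have red: "\<i> ^ k = \<i> ^ (k mod 4)" for k
  proof -
    have "\<i> ^ k = \<i> ^ (4 * (k div 4) + k mod 4)" by simp
    also have "\<dots> = \<i> ^ (k mod 4)" unfolding power_add power_mult by simp
    finally show ?thesis .
  qed
  have inj: "\<i> ^ k = \<i> ^ l \<Longrightarrow> k = l" if "k < 4" "l < 4" for k l
  proof -
    have "k \<in> {0,1,2,3}" "l \<in> {0,1,2,3}" using that by auto
    then show "\<i> ^ k = \<i> ^ l \<Longrightarrow> k = l" by (auto simp: power3_eq_cube complex_eq_iff)
  qed
  show ?thesis using red[of m] red[of n] inj[of "m mod 4" "n mod 4"] by auto
qed

lemma monomial_twist_i_eq_1_iff: "monomial \<alpha> (twist \<i>) = 1 \<longleftrightarrow> \<alpha> r2 mod 4 = \<alpha> r3 mod 4"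
proof -
  have "monomial \<alpha> (twist \<i>) = \<i> ^ \<alpha> r2 / \<i> ^ \<alpha> r3"
    unfolding monomial_def prod_rays
    by (simp only: twist_simps power_one mult_1 power_inverse divide_inverse)
  then show ?thesis using i_power_eq_iff[of "\<alpha> r2" "\<alpha> r3"] by simp
qed

lemma monomial_twist:
  assumes "\<alpha> r2 mod 4 = \<alpha> r3 mod 4" "\<zeta> ^ 4 = 1"
  shows "monomial \<alpha> (twist \<zeta>) = 1"
proof -
  have red: "\<zeta> ^ k = \<zeta> ^ (k mod 4)" for k
  proof -
    have "\<zeta> ^ k = \<zeta> ^ (4 * (k div 4) + k mod 4)" by simp
    also have "\<dots> = \<zeta> ^ (k mod 4)" unfolding power_add power_mult assms(2) by simp
    finally show ?thesis .
  qed
  have "\<zeta> \<noteq> 0" using assms(2) by auto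
  moreover have "\<zeta> ^ \<alpha> r2 = \<zeta> ^ \<alpha> r3" using red assms(1) by metis
  ultimately show ?thesis by (simp add: monomial_def prod_rays power_inverse)
qed

lemma monomial_mult: "monomial \<alpha> (\<lambda>v. X v * Y v) = monomial \<alpha> X * monomial \<alpha> Y"
  by (simp add: monomial_def power_mult_distrib prod.distrib)

lemma monomial_const:
  assumes "\<alpha> \<in> exponents"
  shows "monomial \<alpha> (\<lambda>v. l) = l ^ 8"
  using assms by (simp add: monomial_def exponents_def flip: power_sum)

lemma monomial_cong: "(\<And>v. v \<in> rays \<Longrightarrow> X v = Y v) \<Longrightarrow> monomial \<alpha> X = monomial \<alpha> Y"
  by (simp add: monomial_def)

text \<open>The factor is common to all \<open>\<alpha>\<close>: the monomials are invariant under
  the twist and homogeneous of the same degree.\<close>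

lemma monomial_same_point:
  assumes "\<alpha> \<in> exponents" "\<zeta> ^ 4 = 1" "\<And>v. v \<in> rays \<Longrightarrow> Y v = l * twist \<zeta> v * X v"
  shows "monomial \<alpha> Y = l ^ 8 * monomial \<alpha> X"
proof -
  have "monomial \<alpha> Y = monomial \<alpha> (\<lambda>v. l * twist \<zeta> v * X v)"
    using assms(3) by (rule monomial_cong)
  also have "\<dots> = l ^ 8 * monomial \<alpha> X"
    using monomial_twist[of \<alpha> \<zeta>] assms(1,2)
    by (simp add: monomial_mult monomial_const) (simp add: exponents_def)
  finally show ?thesis .
qed

lemma monomial_chart:
  assumes "b \<in> charts quotient_fan"
  shows "monomial \<alpha> (chart_point b z) = (\<Prod>l\<in>UNIV. z $ l ^ \<alpha> (b l))"
  using assms by (simp add: monomial_def prod_rays_chart[OF assms] chart_inj[OF assms])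

text \<open>Under a chart change the monomial is multiplied by \<open>l ^ 8\<close>, the section has
  to be multiplied by the squared Jacobian determinant, and both numbers are inverse to
  \<open>chart_point b z (missing c) ^ 8\<close>. This matches degree 8 with -2K.\<close>

lemma monomial_section_in_sections:
  assumes "\<alpha> \<in> exponents"
  shows "monomial_section \<alpha> \<in> anticanonical_sections quotient_fan 2"
  unfolding anticanonical_sections_def
proof (intro CollectI conjI ballI allI impI)
  fix b assume "b \<in> charts quotient_fan"
  then have "monomial_section \<alpha> b = (\<lambda>z. \<Prod>l\<in>UNIV. z $ l ^ \<alpha> (b l))"
    by (simp add: monomial_section_def[abs_def] monomial_chart)
  then show "polynomial_map (monomial_section \<alpha> b)"
    by (simp add: polynomial_map_monomial)
next
  fix b :: "3 \<Rightarrow> int ^ 3" assume "b \<notin> charts quotient_fan"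
  then show "monomial_section \<alpha> b = (\<lambda>z. 0)" by (simp add: monomial_section_def[abs_def])
next
  fix b c U \<phi> z assume ch: "chart_change quotient_fan b c U \<phi>" and z: "z \<in> U"
  obtain l \<zeta> where *: "l \<noteq> 0" "\<zeta> ^ 4 = 1"
    "\<And>v. v \<in> rays \<Longrightarrow> chart_point c (\<phi> z) v = l * twist \<zeta> v * chart_point b z v"
    "l * twist \<zeta> (missing c) * chart_point b z (missing c) = 1"
    using chart_changeE[OF ch z] by blast
  have t8: "twist \<zeta> (missing c) ^ 8 = 1"
    using arg_cong[OF twist_power4[OF *(2)], of "\<lambda>x. x ^ 2" "missing c"] by simp
  have l8: "l ^ 8 * chart_point b z (missing c) ^ 8 = 1"
    using arg_cong[OF *(4), of "\<lambda>x. x ^ 8"] t8 by (simp add: power_mult_distrib)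
  then have "l ^ 8 = det (jacobian \<phi> z) ^ 2"
    using det_jacobian_chart_change[OF ch z]
    by (metis mult_right_cancel mult_zero_right zero_neq_one)
  then show "monomial_section \<alpha> c (\<phi> z) = det (jacobian \<phi> z) ^ 2 * monomial_section \<alpha> b z"
    using monomial_same_point[OF assms *(2,3)] ch
    by (simp add: monomial_section_def chart_change_def)
qed

text \<open>On the torus a section becomes a homogeneous function of degree 8 in the Cox coordinates,
  the same one for all charts.\<close>

definition affine_point :: "(3 \<Rightarrow> int ^ 3) \<Rightarrow> (int ^ 3 \<Rightarrow> complex) \<Rightarrow> complex ^ 3" where
  "affine_point b X = (\<chi> l. X (b l) / X (missing b))"

definition homogenize ::
    "((3 \<Rightarrow> int ^ 3) \<Rightarrow> complex ^ 3 \<Rightarrow> complex) \<Rightarrow> (3 \<Rightarrow> int ^ 3) \<Rightarrow> (int ^ 3 \<Rightarrow> complex) \<Rightarrow> complex"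
  where "homogenize t b X = X (missing b) ^ 8 * t b (affine_point b X)"

lemma chart_point_affine_point:
  assumes "b \<in> charts quotient_fan" "v \<in> rays" "X (missing b) \<noteq> 0"
  shows "chart_point b (affine_point b X) v = X v / X (missing b)"
  using assms unfolding rays_insert_missing[OF assms(1)]
  by (auto simp: affine_point_def chart_inj)

lemma affine_point_chart_point:
  assumes "b \<in> charts quotient_fan"
  shows "affine_point b (chart_point b z) = z"
  using assms by (simp add: affine_point_def vec_eq_iff chart_inj)

text \<open>With \<open>\<zeta> = 1\<close> this makes the homogeneous function independent of the
  chart; with \<open>b = c\<close> and \<open>\<zeta> = \<i>\<close> it makes it invariant under the
  group of order 4.\<close>

lemma homogenize_change:
  assumes t: "t \<in> anticanonical_sections quotient_fan 2"
    and b: "b \<in> charts quotient_fan" and c: "c \<in> charts quotient_fan"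
    and \<zeta>: "\<zeta> ^ 4 = 1" and X: "\<And>v. X v \<noteq> 0"
  shows "homogenize t c (\<lambda>v. twist \<zeta> v * X v) = homogenize t b X"
proof -
  define \<phi> where "\<phi> z = (\<chi> i. twist \<zeta> (c i) * chart_point b z (c i) /
    (twist \<zeta> (missing c) * chart_point b z (missing c)))" for z
  have ch: "chart_change quotient_fan b c torus \<phi>"
    unfolding \<phi>_def[abs_def] by (rule standard_chart_change[OF b c \<zeta>])
  define z where "z = affine_point b X"
  have z: "z \<in> torus" using X by (simp add: z_def affine_point_def torus_def)
  have X': "chart_point b z v = X v / X (missing b)" if "v \<in> rays" for v
    unfolding z_def using chart_point_affine_point[OF b that] X by simp
  have \<phi>z: "\<phi> z = affine_point c (\<lambda>v. twist \<zeta> v * X v)"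
    using X by (simp add: \<phi>_def affine_point_def vec_eq_iff X' chart_in_rays[OF c] missing_rays[OF c])
  have "t c (\<phi> z) = det (jacobian \<phi> z) ^ 2 * t b z"
    using t ch z unfolding anticanonical_sections_def by blast
  moreover have "det (jacobian \<phi> z) ^ 2 * (X (missing c) / X (missing b)) ^ 8 = 1"
    using det_jacobian_chart_change[OF ch z] by (simp add: X' missing_rays[OF c])
  then have "det (jacobian \<phi> z) ^ 2 * X (missing c) ^ 8 = X (missing b) ^ 8"
    using X[of "missing b"] by (simp add: power_divide field_simps)
  moreover have "twist \<zeta> (missing c) ^ 8 = 1"
    using arg_cong[OF twist_power4[OF \<zeta>], of "\<lambda>x. x ^ 2" "missing c"] by simp
  ultimately show ?thesis
    by (simp add: homogenize_def \<phi>z[symmetric] z_def[symmetric] power_mult_distrib mult.assoc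
        mult.left_commute)
qed

text \<open>The missing ray receives the exponent 8 minus the degree of the monomial, which may be
  negative. Hence Laurent monomials, with nonnegative exponents known only on the rays of the
  chart.\<close>

lemma homogenize_expansion:
  assumes b: "b \<in> charts quotient_fan" and t: "polynomial_map (t b)"
  obtains A a where "finite A"
    "\<And>\<alpha>. \<alpha> \<in> A \<Longrightarrow> (\<forall>v. v \<notin> rays \<longrightarrow> \<alpha> v = 0) \<and> (\<Sum>v\<in>rays. \<alpha> v) = 8 \<and> (\<forall>l. 0 \<le> \<alpha> (b l))"
    "\<And>X. (\<And>v. X v \<noteq> 0) \<Longrightarrow> homogenize t b X = (\<Sum>\<alpha>\<in>A. a \<alpha> * (\<Prod>v\<in>rays. X v powi \<alpha> v))"
proof -
  obtain F a where F: "finite F" "t b = (\<lambda>z. \<Sum>\<beta>\<in>F. a \<beta> * (\<Prod>l\<in>UNIV. z $ l ^ \<beta> l))"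
    by (rule coefficient_expansionE[OF polynomial_map_expansion[OF t]])
  define up where "up \<beta> = (\<lambda>v. if v \<in> range b then int (\<beta> (inv b v))
    else if v = missing b then 8 - int (\<Sum>l\<in>UNIV. \<beta> l) else 0)" for \<beta>
  have up_b: "up \<beta> (b l) = int (\<beta> l)" for \<beta> l
    by (simp add: up_def chart_inj[OF b])
  have up_m: "up \<beta> (missing b) = 8 - int (\<Sum>l\<in>UNIV. \<beta> l)" for \<beta>
    using missing_notin[OF b] by (simp add: up_def)
  have inj: "inj_on up F"
  proof (rule inj_onI)
    fix \<beta> \<gamma> assume "up \<beta> = up \<gamma>"
    then have "up \<beta> (b l) = up \<gamma> (b l)" for l by simp
    then show "\<beta> = \<gamma>" by (simp add: up_b fun_eq_iff)
  qed
  show thesis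
  proof (rule that[of "up ` F" "\<lambda>\<alpha>. a (inv_into F up \<alpha>)"])
    show "finite (up ` F)" using F(1) by simp
  next
    fix \<alpha> assume "\<alpha> \<in> up ` F"
    then obtain \<beta> where \<beta>: "\<alpha> = up \<beta>" by blast
    have "\<alpha> v = 0" if "v \<notin> rays" for v
      using that unfolding \<beta> up_def rays_insert_missing[OF b] by auto
    moreover have "(\<Sum>v\<in>rays. \<alpha> v) = 8"
      by (simp add: sum_rays_chart[OF b] \<beta> up_b up_m)
    moreover have "0 \<le> \<alpha> (b l)" for l by (simp add: \<beta> up_b)
    ultimately show "(\<forall>v. v \<notin> rays \<longrightarrow> \<alpha> v = 0) \<and> (\<Sum>v\<in>rays. \<alpha> v) = 8 \<and> (\<forall>l. 0 \<le> \<alpha> (b l))"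
      by blast
  next
    fix X :: "int ^ 3 \<Rightarrow> complex" assume X: "\<And>v. X v \<noteq> 0"
    have "X (missing b) ^ 8 * (\<Prod>l\<in>UNIV. affine_point b X $ l ^ \<beta> l) = (\<Prod>v\<in>rays. X v powi up \<beta> v)" for \<beta>
    proof -
      have "(\<Prod>l\<in>UNIV. affine_point b X $ l ^ \<beta> l)
          = (\<Prod>l\<in>UNIV. X (b l) ^ \<beta> l) / X (missing b) ^ (\<Sum>l\<in>UNIV. \<beta> l)"
        by (simp add: affine_point_def power_divide prod_dividef power_sum)
      moreover have "X (missing b) powi (8 - int (\<Sum>l\<in>UNIV. \<beta> l))
          = X (missing b) ^ 8 / X (missing b) ^ (\<Sum>l\<in>UNIV. \<beta> l)"
        using X by (simp add: power_int_diff del: of_nat_sum)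
      ultimately show ?thesis
        by (simp add: prod_rays_chart[OF b] up_b up_m del: of_nat_sum)
    qed
    then show "homogenize t b X
        = (\<Sum>\<alpha>\<in>up ` F. a (inv_into F up \<alpha>) * (\<Prod>v\<in>rays. X v powi \<alpha> v))"
      by (simp add: homogenize_def F(2) sum_distrib_left sum.reindex[OF inj]
          inv_into_f_f[OF inj] mult.left_commute[of "X (missing b) ^ 8"])
  qed
qed

text \<open>In the expansion from the chart that misses \<open>r0\<close>, only the exponent of
  \<open>r0\<close> can be negative. The chart that misses \<open>r1\<close> contains
  \<open>r0\<close> and yields the same function, hence the same Laurent monomials, so no exponent
  is negative. Invariance under \<open>twist \<i>\<close> then forces the congruence, character by
  character.\<close>

lemma sections_monomial_expansion:
  assumes t: "t \<in> anticanonical_sections quotient_fan 2"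
  obtains c where "\<And>b X. b \<in> charts quotient_fan \<Longrightarrow> (\<And>v. X v \<noteq> 0) \<Longrightarrow>
    homogenize t b X = (\<Sum>\<alpha>\<in>exponents. c \<alpha> * monomial \<alpha> X)"
proof -
  obtain b where b: "b \<in> charts quotient_fan" "missing b = r0"
    using chart_missing_exists[of r0] by auto
  obtain c where c: "c \<in> charts quotient_fan" "missing c = r1"
    using chart_missing_exists[of r1] by auto
  have poly: "polynomial_map (t b)" "polynomial_map (t c)"
    using t b c by (auto simp: anticanonical_sections_def)
  obtain A a where A: "finite A"
    "\<And>\<alpha>. \<alpha> \<in> A \<Longrightarrow> (\<forall>v. v \<notin> rays \<longrightarrow> \<alpha> v = 0) \<and> (\<Sum>v\<in>rays. \<alpha> v) = 8 \<and> (\<forall>l. 0 \<le> \<alpha> (b l))"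
    "\<And>X. (\<And>v. X v \<noteq> 0) \<Longrightarrow> homogenize t b X = (\<Sum>\<alpha>\<in>A. a \<alpha> * (\<Prod>v\<in>rays. X v powi \<alpha> v))"
    using homogenize_expansion[where t = t, OF b(1) poly(1)] by blast
  obtain A' a' where A': "finite A'"
    "\<And>\<alpha>. \<alpha> \<in> A' \<Longrightarrow> (\<forall>v. v \<notin> rays \<longrightarrow> \<alpha> v = 0) \<and> (\<Sum>v\<in>rays. \<alpha> v) = 8 \<and> (\<forall>l. 0 \<le> \<alpha> (c l))"
    "\<And>X. (\<And>v. X v \<noteq> 0) \<Longrightarrow> homogenize t c X = (\<Sum>\<alpha>\<in>A'. a' \<alpha> * (\<Prod>v\<in>rays. X v powi \<alpha> v))"
    using homogenize_expansion[where t = t, OF c(1) poly(2)] by blast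
  have tw1: "twist 1 = (\<lambda>v. 1)" by (auto simp: twist_def)
  have same: "homogenize t d X = homogenize t b X"
    if "d \<in> charts quotient_fan" "\<And>v. X v \<noteq> 0" for d X
    using homogenize_change[where t = t, OF t b(1) that(1), of 1 X] that(2) by (simp add: tw1)
  have nonneg: "\<forall>v. 0 \<le> \<alpha> v" if \<alpha>: "\<alpha> \<in> A" "a \<alpha> \<noteq> 0" for \<alpha>
  proof -
    have "\<alpha> \<in> A'"
    proof (rule ccontr)
      assume "\<alpha> \<notin> A'"
      have "(if \<alpha> \<in> A then a \<alpha> else 0) - (if \<alpha> \<in> A' then a' \<alpha> else 0) = 0"
      proof (rule laurent_monomials_independent[where R = rays and F = "A \<union> A'"
            and a = "\<lambda>\<alpha>. (if \<alpha> \<in> A then a \<alpha> else 0) - (if \<alpha> \<in> A' then a' \<alpha> else 0)"])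
        fix X :: "int ^ 3 \<Rightarrow> complex" assume X: "\<And>v. X v \<noteq> 0"
        let ?\<chi> = "\<lambda>\<alpha>. \<Prod>v\<in>rays. X v powi \<alpha> v"
        have "(\<Sum>\<alpha>\<in>A \<union> A'. (if \<alpha> \<in> A then a \<alpha> else 0) * ?\<chi> \<alpha>) = (\<Sum>\<alpha>\<in>A. a \<alpha> * ?\<chi> \<alpha>)"
          using A(1) A'(1) by (intro sum.mono_neutral_cong_right) auto
        moreover have "(\<Sum>\<alpha>\<in>A \<union> A'. (if \<alpha> \<in> A' then a' \<alpha> else 0) * ?\<chi> \<alpha>) = (\<Sum>\<alpha>\<in>A'. a' \<alpha> * ?\<chi> \<alpha>)"
          using A(1) A'(1) by (intro sum.mono_neutral_cong_right) auto
        ultimately show "(\<Sum>\<alpha>\<in>A \<union> A'. ((if \<alpha> \<in> A then a \<alpha> else 0) - (if \<alpha> \<in> A' then a' \<alpha> else 0)) * ?\<chi> \<alpha>) = 0"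
          unfolding left_diff_distrib sum_subtractf
          using A(3)[OF X] A'(3)[OF X] same[OF c(1) X] by simp
      qed (use A(1,2) A'(1,2) \<alpha> in auto)
      then show False using \<alpha> \<open>\<alpha> \<notin> A'\<close> by simp
    qed
    show ?thesis
    proof
      fix v
      consider "v \<notin> rays" | "v \<in> range b" | "v = r0"
        using rays_insert_missing[OF b(1)] b(2) by auto
      then show "0 \<le> \<alpha> v"
      proof cases
        case 3
        then have "v \<in> range c"
          using rays_insert_missing[OF c(1)] c(2) in_rays(1) by (metis insertE rays_distinct(1))
        then show ?thesis using A'(2)[OF \<open>\<alpha> \<in> A'\<close>] by auto
      qed (use A(2)[OF \<alpha>(1)] in auto)
    qed
  qed
  have inv: "(\<Prod>v\<in>rays. twist \<i> v powi \<alpha> v) = 1" if \<alpha>: "\<alpha> \<in> A" "a \<alpha> \<noteq> 0" for \<alpha>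
  proof -
    have i4: "\<i> ^ 4 = 1" by simp
    have "a \<alpha> * ((\<Prod>v\<in>rays. twist \<i> v powi \<alpha> v) - 1) = 0"
    proof (rule laurent_monomials_independent[where R = rays and F = A
          and a = "\<lambda>\<alpha>. a \<alpha> * ((\<Prod>v\<in>rays. twist \<i> v powi \<alpha> v) - 1)"])
      fix X :: "int ^ 3 \<Rightarrow> complex" assume X: "\<And>v. X v \<noteq> 0"
      have X': "twist \<i> v * X v \<noteq> 0" for v using X twist_nonzero[OF i4] by simp
      have "homogenize t b (\<lambda>v. twist \<i> v * X v) = homogenize t b X"
        by (rule homogenize_change[OF t b(1) b(1) i4 X])
      then have "(\<Sum>\<alpha>\<in>A. a \<alpha> * ((\<Prod>v\<in>rays. twist \<i> v powi \<alpha> v) * (\<Prod>v\<in>rays. X v powi \<alpha> v)))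
          = (\<Sum>\<alpha>\<in>A. a \<alpha> * (\<Prod>v\<in>rays. X v powi \<alpha> v))"
        using A(3)[OF X'] A(3)[OF X] by (simp add: power_int_mult_distrib prod.distrib)
      then show "(\<Sum>\<alpha>\<in>A. a \<alpha> * ((\<Prod>v\<in>rays. twist \<i> v powi \<alpha> v) - 1) * (\<Prod>v\<in>rays. X v powi \<alpha> v)) = 0"
        by (simp add: algebra_simps sum_subtractf)
    qed (use A(1,2) \<alpha> in auto)
    then show ?thesis using \<alpha> by simp
  qed
  \<comment> \<open>From here on \<open>c\<close> is the coefficient function and no longer the
    second chart.\<close>
  define c where "c \<alpha> = (if (\<lambda>v. int (\<alpha> v)) \<in> A then a (\<lambda>v. int (\<alpha> v)) else 0)" for \<alpha>
  have "homogenize t b X = (\<Sum>\<alpha>\<in>exponents. c \<alpha> * monomial \<alpha> X)" if X: "\<And>v. X v \<noteq> 0" for X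
  proof -
    let ?up = "\<lambda>\<alpha> v. int (\<alpha> v) :: int"
    have inj: "inj_on ?up exponents"
      by (auto simp: inj_on_def fun_eq_iff)
    have "\<alpha> \<in> ?up ` exponents" if \<alpha>: "\<alpha> \<in> A" "a \<alpha> \<noteq> 0" for \<alpha>
    proof
      have nn: "int (nat (\<alpha> v)) = \<alpha> v" for v using nonneg[OF \<alpha>] by simp
      show "\<alpha> = ?up (\<lambda>v. nat (\<alpha> v))" by (simp only: nn)
      have "int (\<Sum>v\<in>rays. nat (\<alpha> v)) = 8"
        unfolding of_nat_sum nn using A(2)[OF \<alpha>(1)] by simp
      then have "(\<Sum>v\<in>rays. nat (\<alpha> v)) = 8" by linarith
      moreover have "monomial (\<lambda>v. nat (\<alpha> v)) (twist \<i>) = 1"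
        unfolding monomial_def using inv[OF \<alpha>] nonneg[OF \<alpha>] by (simp add: power_int_def)
      then have "nat (\<alpha> r2) mod 4 = nat (\<alpha> r3) mod 4"
        by (simp only: monomial_twist_i_eq_1_iff)
      ultimately show "(\<lambda>v. nat (\<alpha> v)) \<in> exponents"
        using A(2)[OF \<alpha>(1)] by (simp add: exponents_def)
    qed
    then have "homogenize t b X = (\<Sum>\<alpha>\<in>?up ` exponents. (if \<alpha> \<in> A then a \<alpha> else 0) * (\<Prod>v\<in>rays. X v powi \<alpha> v))"
      unfolding A(3)[OF X]
      by (intro sum.mono_neutral_cong) (use A(1) finite_exponents in auto)
    then show ?thesis by (simp add: sum.reindex[OF inj] c_def monomial_def)
  qed
  then show thesis using that[of c] same by simp
qed

lemma sections_eq_combination: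
  assumes "t \<in> anticanonical_sections quotient_fan 2"
  obtains c where "t = (\<lambda>b z. \<Sum>\<alpha>\<in>exponents. c \<alpha> * monomial_section \<alpha> b z)"
proof -
  obtain c where c: "\<And>b X. b \<in> charts quotient_fan \<Longrightarrow> (\<And>v. X v \<noteq> 0) \<Longrightarrow>
    homogenize t b X = (\<Sum>\<alpha>\<in>exponents. c \<alpha> * monomial \<alpha> X)"
    using sections_monomial_expansion[OF assms] by metis
  have "t b z = (\<Sum>\<alpha>\<in>exponents. c \<alpha> * monomial_section \<alpha> b z)" for b z
  proof (cases "b \<in> charts quotient_fan")
    case b: True
    show ?thesis
    proof (rule eq_by_density[of UNIV])
      show "isCont (t b) z"
        using assms b by (intro polynomial_map_isCont) (simp add: anticanonical_sections_def)
      have "isCont (monomial_section \<alpha> b) z" if "\<alpha> \<in> exponents" for \<alpha>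
        using monomial_section_in_sections[OF that] b
        by (intro polynomial_map_isCont) (simp add: anticanonical_sections_def)
      then show "isCont (\<lambda>z. \<Sum>\<alpha>\<in>exponents. c \<alpha> * monomial_section \<alpha> b z) z"
        by (intro continuous_sum continuous_mult continuous_const) auto
    next
      fix w :: "complex ^ 3" assume "w \<in> torus"
      then show "t b w = (\<Sum>\<alpha>\<in>exponents. c \<alpha> * monomial_section \<alpha> b w)"
        using c[OF b, of "chart_point b w"] chart_point_nonzero[OF b \<open>w \<in> torus\<close>] b
        by (simp add: homogenize_def affine_point_chart_point monomial_section_def)
    qed auto
  next
    case False
    then show ?thesis using assms by (simp add: anticanonical_sections_def monomial_section_def)
  qed
  then show thesis using that by blast
qed

text \<open>Multiplied by \<open>X (missing b) ^ 8\<close>, a relation on a single chart becomes a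
  relation between distinct characters of the torus.\<close>

lemma monomial_sections_independent:
  assumes "(\<lambda>b z. \<Sum>\<alpha>\<in>exponents. c \<alpha> * monomial_section \<alpha> b z) = (\<lambda>b z. 0)" "\<alpha> \<in> exponents"
  shows "c \<alpha> = 0"
proof -
  let ?up = "\<lambda>\<alpha> v. int (\<alpha> v) :: int"
  have inj: "inj_on ?up exponents"
    by (auto simp: inj_on_def fun_eq_iff)
  obtain b where b: "b \<in> charts quotient_fan" using chart_missing_exists[of r0] by auto
  have "c (inv_into exponents ?up (?up \<alpha>)) = 0"
  proof (rule laurent_monomials_independent[where R = rays and F = "?up ` exponents"
        and a = "\<lambda>\<gamma>. c (inv_into exponents ?up \<gamma>)"])
    fix X :: "int ^ 3 \<Rightarrow> complex" assume X: "\<And>v. X v \<noteq> 0"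
    have "monomial \<alpha> X = X (missing b) ^ 8 * monomial_section \<alpha> b (affine_point b X)"
      if "\<alpha> \<in> exponents" for \<alpha>
    proof -
      have "monomial \<alpha> X = monomial \<alpha> (\<lambda>v. X (missing b) * chart_point b (affine_point b X) v)"
        using X by (intro monomial_cong) (simp add: chart_point_affine_point[OF b])
      then show ?thesis
        by (simp add: monomial_mult monomial_const[OF that] monomial_section_def b)
    qed
    then have "(\<Sum>\<alpha>\<in>exponents. c \<alpha> * monomial \<alpha> X)
        = X (missing b) ^ 8 * (\<Sum>\<alpha>\<in>exponents. c \<alpha> * monomial_section \<alpha> b (affine_point b X))"
      by (simp add: sum_distrib_left mult.left_commute)
    also have "\<dots> = 0" using fun_cong[OF fun_cong[OF assms(1)]] by simp
    finally show "(\<Sum>\<gamma>\<in>?up ` exponents. c (inv_into exponents ?up \<gamma>) * (\<Prod>v\<in>rays. X v powi \<gamma> v)) = 0"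
      by (simp add: sum.reindex[OF inj] inv_into_f_f[OF inj] monomial_def)
  qed (use assms(2) finite_exponents in \<open>auto simp: exponents_def\<close>)
  then show ?thesis by (simp add: inv_into_f_f[OF inj assms(2)])
qed

lemma monomial_basis:
  assumes e: "bij_betw e {..N} exponents"
  shows "anticanonical_basis quotient_fan 2 N (\<lambda>i. monomial_section (e i))"
  unfolding anticanonical_basis_def
proof (intro conjI allI impI ballI)
  have inj: "inj_on e {..N}" and im: "e ` {..N} = exponents"
    using e by (auto simp: bij_betw_def)
  have reindex: "(\<Sum>\<alpha>\<in>exponents. f \<alpha>) = (\<Sum>i\<le>N. f (e i))" for f :: "_ \<Rightarrow> complex"
    by (simp add: sum.reindex[OF inj] flip: im)
  {
    fix i assume "i \<le> N"
    then show "monomial_section (e i) \<in> anticanonical_sections quotient_fan 2"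
      using im by (intro monomial_section_in_sections) auto
  next
    fix t assume "t \<in> anticanonical_sections quotient_fan 2"
    then obtain c where c: "t = (\<lambda>b z. \<Sum>\<alpha>\<in>exponents. c \<alpha> * monomial_section \<alpha> b z)"
      by (rule sections_eq_combination)
    show "\<exists>!c. (\<forall>i>N. c i = 0) \<and> t = (\<lambda>b z. \<Sum>i\<le>N. c i * monomial_section (e i) b z)"
    proof (rule ex1I)
      show "(\<forall>i>N. (if i \<le> N then c (e i) else 0) = 0) \<and>
          t = (\<lambda>b z. \<Sum>i\<le>N. (if i \<le> N then c (e i) else 0) * monomial_section (e i) b z)"
        by (simp add: c reindex)
    next
      fix d assume d: "(\<forall>i>N. d i = 0) \<and> t = (\<lambda>b z. \<Sum>i\<le>N. d i * monomial_section (e i) b z)"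
      define d' where "d' \<alpha> = d (inv_into {..N} e \<alpha>)" for \<alpha>
      have d'e: "d' (e i) = d i" if "i \<le> N" for i
        using that by (simp add: d'_def inv_into_f_f[OF inj])
      have "(\<Sum>\<alpha>\<in>exponents. (c \<alpha> - d' \<alpha>) * monomial_section \<alpha> b z) = 0" for b z
      proof -
        have "(\<Sum>\<alpha>\<in>exponents. c \<alpha> * monomial_section \<alpha> b z) = t b z" by (simp add: c)
        moreover have "(\<Sum>\<alpha>\<in>exponents. d' \<alpha> * monomial_section \<alpha> b z) = t b z"
          using d by (simp add: reindex d'e)
        ultimately show ?thesis by (simp add: left_diff_distrib sum_subtractf)
      qed
      then have "c \<alpha> - d' \<alpha> = 0" if "\<alpha> \<in> exponents" for \<alpha>
        using monomial_sections_independent[where c = "\<lambda>\<alpha>. c \<alpha> - d' \<alpha>", OF _ that] by simp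
      then have "c (e i) = d i" if "i \<le> N" for i
        using that d'e im by fastforce
      then show "d = (\<lambda>i. if i \<le> N then c (e i) else 0)"
        using d by (auto simp: fun_eq_iff)
    qed
  }
qed

section \<open>Very ampleness\<close>

definition expo :: "nat \<Rightarrow> nat \<Rightarrow> nat \<Rightarrow> nat \<Rightarrow> int ^ 3 \<Rightarrow> nat" where
  "expo m0 m1 m2 m3 v =
    (if v = r0 then m0 else if v = r1 then m1 else if v = r2 then m2 else if v = r3 then m3 else 0)"

lemma expo_simps [simp]:
  "expo m0 m1 m2 m3 r0 = m0" "expo m0 m1 m2 m3 r1 = m1"
  "expo m0 m1 m2 m3 r2 = m2" "expo m0 m1 m2 m3 r3 = m3"
  by (simp_all add: expo_def)

lemma expo_in_exponents:
  "expo m0 m1 m2 m3 \<in> exponents \<longleftrightarrow> m0 + m1 + m2 + m3 = 8 \<and> m2 mod 4 = m3 mod 4"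
  by (auto simp: exponents_def sum_rays expo_def)

lemma monomial_expo: "monomial (expo m0 m1 m2 m3) X = X r0 ^ m0 * X r1 ^ m1 * X r2 ^ m2 * X r3 ^ m3"
  by (simp add: monomial_def prod_rays)

text \<open>The eighth power of the missing Cox coordinate. It excludes base points and serves as
  denominator for regular functions.\<close>

lemma vertex_section:
  assumes "b \<in> charts quotient_fan"
  obtains \<alpha> where "\<alpha> \<in> exponents" "monomial_section \<alpha> b = (\<lambda>z. 1)"
proof -
  define \<alpha> where "\<alpha> v = (if v = missing b then 8 else 0 :: nat)" for v
  have "\<alpha> \<in> exponents"
    using missing_rays[OF assms] by (auto simp: \<alpha>_def exponents_def rays_def sum_rays)
  moreover have "monomial_section \<alpha> b = (\<lambda>z. 1)"
    using assms by (simp add: monomial_section_def[abs_def] monomial_chart \<alpha>_def chart_neq_missing)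
  ultimately show thesis by (rule that)
qed

text \<open>If the coordinate at \<open>r0\<close> or \<open>r1\<close> is nonzero, its ratio
  \<open>l\<close> satisfies \<open>\<mu> = l ^ 8\<close>, and monomials divisible by a power of
  this coordinate recover the other coordinate, the product of the last two, and their fourth
  powers. On the line where both vanish, a separate argument is needed.\<close>

lemma monomials_separate_points:
  assumes eq: "\<And>\<alpha>. \<alpha> \<in> exponents \<Longrightarrow> monomial \<alpha> Y = \<mu> * monomial \<alpha> X"
    and X: "u \<in> rays" "X u \<noteq> 0" and Y: "w \<in> rays" "Y w \<noteq> 0"
  shows "same_point quotient_fan X Y"
proof -
  have mono: "Y r0 ^ m0 * Y r1 ^ m1 * Y r2 ^ m2 * Y r3 ^ m3
      = \<mu> * (X r0 ^ m0 * X r1 ^ m1 * X r2 ^ m2 * X r3 ^ m3)"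
    if "m0 + m1 + m2 + m3 = 8" "m2 mod 4 = m3 mod 4" for m0 m1 m2 m3
    using eq[of "expo m0 m1 m2 m3"] that by (simp add: expo_in_exponents monomial_expo)
  have vertex: "Y r0 ^ 8 = \<mu> * X r0 ^ 8" "Y r1 ^ 8 = \<mu> * X r1 ^ 8"
    "Y r2 ^ 8 = \<mu> * X r2 ^ 8" "Y r3 ^ 8 = \<mu> * X r3 ^ 8"
    using mono[of 8 0 0 0] mono[of 0 8 0 0] mono[of 0 0 8 0] mono[of 0 0 0 8] by simp_all
  have "\<mu> \<noteq> 0"
  proof
    assume "\<mu> = 0"
    with vertex Y show False by (auto simp: rays_def)
  qed
  have supp: "Y v = 0 \<longleftrightarrow> X v = 0" if "v \<in> rays" for v
  proof -
    have "Y v ^ 8 = \<mu> * X v ^ 8" using vertex that by (auto simp: rays_def)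
    then show ?thesis using \<open>\<mu> \<noteq> 0\<close> by (metis mult_eq_0_iff power_eq_0_iff zero_less_numeral)
  qed
  have finish: "same_point quotient_fan X Y"
    if "l \<noteq> 0" "\<zeta> ^ 4 = 1" "Y r0 = l * X r0" "Y r1 = l * X r1" "Y r2 = l * \<zeta> * X r2" "\<zeta> * Y r3 = l * X r3"
    for l \<zeta>
  proof -
    have "\<zeta> \<noteq> 0" using that(2) by auto
    then have "Y r3 = l * inverse \<zeta> * X r3" using that(6) by (simp add: field_simps)
    then have "\<forall>v\<in>rays. Y v = l * twist \<zeta> v * X v"
      using that by (simp add: rays_def)
    then show ?thesis unfolding same_point_iff using that(1,2) by blast
  qed
  \<comment> \<open>Once \<open>l\<close> is known, \<open>\<zeta>\<close> is read off from a
    nonzero coordinate among the last two; the product \<open>X r2 * X r3\<close> settles the other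
    one.\<close>
  have scaled: "same_point quotient_fan X Y"
    if l: "l \<noteq> 0" "Y r0 = l * X r0" "Y r1 = l * X r1"
      and e23: "Y r2 * Y r3 = l ^ 2 * (X r2 * X r3)" and e2: "Y r2 ^ 4 = l ^ 4 * X r2 ^ 4"
      and e3: "Y r3 ^ 4 = l ^ 4 * X r3 ^ 4" for l
  proof -
    consider "X r2 \<noteq> 0" | "X r2 = 0" "X r3 \<noteq> 0" | "X r2 = 0" "X r3 = 0" by blast
    then show ?thesis
    proof cases
      case 1
      define \<zeta> where "\<zeta> = Y r2 / (l * X r2)"
      show ?thesis
      proof (rule finish[of l \<zeta>])
        show "\<zeta> ^ 4 = 1" using e2 1 l(1) by (simp add: \<zeta>_def power_divide power_mult_distrib)
        show "Y r2 = l * \<zeta> * X r2" using 1 l(1) by (simp add: \<zeta>_def)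
        show "\<zeta> * Y r3 = l * X r3" using e23 1 l(1)
          by (simp add: \<zeta>_def field_simps power2_eq_square)
      qed (use l in auto)
    next
      case 2
      define \<zeta> where "\<zeta> = l * X r3 / Y r3"
      have "Y r3 \<noteq> 0" "Y r2 = 0" using 2 supp by auto
      show ?thesis
      proof (rule finish[of l \<zeta>])
        show "\<zeta> ^ 4 = 1" using e3 \<open>Y r3 \<noteq> 0\<close> 2 l(1)
          by (simp add: \<zeta>_def power_divide power_mult_distrib)
      qed (use l 2 \<open>Y r3 \<noteq> 0\<close> \<open>Y r2 = 0\<close> in \<open>auto simp: \<zeta>_def\<close>)
    next
      case 3
      then have "Y r2 = 0" "Y r3 = 0" using supp by auto
      then show ?thesis using 3 l by (intro finish[of l 1]) auto
    qed
  qed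
  have Xnz: "X r0 \<noteq> 0 \<or> X r1 \<noteq> 0 \<or> X r2 \<noteq> 0 \<or> X r3 \<noteq> 0"
    using X by (auto simp: rays_def)
  consider "X r0 \<noteq> 0" | "X r0 = 0" "X r1 \<noteq> 0" | "X r0 = 0" "X r1 = 0" "X r2 \<noteq> 0" "X r3 = 0"
    | "X r0 = 0" "X r1 = 0" "X r2 = 0" "X r3 \<noteq> 0" | "X r0 = 0" "X r1 = 0" "X r2 \<noteq> 0" "X r3 \<noteq> 0"
    using Xnz by blast
  then show ?thesis
  proof cases
    case 1
    define l where "l = Y r0 / X r0"
    have Y0: "Y r0 = l * X r0" using 1 by (simp add: l_def)
    have l: "l \<noteq> 0" using 1 supp by (simp add: l_def)
    have \<mu>: "\<mu> = l ^ 8" using vertex(1) 1 by (simp add: Y0 power_mult_distrib)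
    show ?thesis
    proof (rule scaled[of l])
      show "Y r1 = l * X r1"
        using mono[of 7 1 0 0] l 1 by (simp add: Y0 \<mu> power_mult_distrib power_numeral_reduce)
      show "Y r2 * Y r3 = l ^ 2 * (X r2 * X r3)"
        using mono[of 6 0 1 1] l 1 by (simp add: Y0 \<mu> power_mult_distrib power_numeral_reduce)
      show "Y r2 ^ 4 = l ^ 4 * X r2 ^ 4"
        using mono[of 4 0 4 0] l 1 by (simp add: Y0 \<mu> power_mult_distrib power_numeral_reduce)
      show "Y r3 ^ 4 = l ^ 4 * X r3 ^ 4"
        using mono[of 4 0 0 4] l 1 by (simp add: Y0 \<mu> power_mult_distrib power_numeral_reduce)
    qed (use l Y0 in auto)
  next
    case 2
    define l where "l = Y r1 / X r1"
    have Y1: "Y r1 = l * X r1" using 2 by (simp add: l_def)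
    have l: "l \<noteq> 0" using 2 supp by (simp add: l_def)
    have \<mu>: "\<mu> = l ^ 8" using vertex(2) 2 by (simp add: Y1 power_mult_distrib)
    show ?thesis
    proof (rule scaled[of l])
      show "Y r2 * Y r3 = l ^ 2 * (X r2 * X r3)"
        using mono[of 0 6 1 1] l 2 by (simp add: Y1 \<mu> power_mult_distrib power_numeral_reduce)
      show "Y r2 ^ 4 = l ^ 4 * X r2 ^ 4"
        using mono[of 0 4 4 0] l 2 by (simp add: Y1 \<mu> power_mult_distrib power_numeral_reduce)
      show "Y r3 ^ 4 = l ^ 4 * X r3 ^ 4"
        using mono[of 0 4 0 4] l 2 by (simp add: Y1 \<mu> power_mult_distrib power_numeral_reduce)
    qed (use l Y1 2 supp in auto)
  next
    case 3
    then show ?thesis using supp by (intro finish[of "Y r2 / X r2" 1]) auto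
  next
    case 4
    then show ?thesis using supp by (intro finish[of "Y r3 / X r3" 1]) auto
  next
    case 5
    \<comment> \<open>The monomial with exponents 6 and 2 only yields \<open>q = p\<close> or
      \<open>q = - p\<close>. The second case is a twist by \<open>\<i>\<close> with scalar
      \<open>- \<i> * p\<close>: multiplying this scalar by \<open>\<i>\<close> gives
      \<open>p\<close>, dividing it by \<open>\<i>\<close> gives \<open>- p\<close>.\<close>
    define p q where "p = Y r2 / X r2" and "q = Y r3 / X r3"
    have pq: "Y r2 = p * X r2" "Y r3 = q * X r3" "p \<noteq> 0" "q \<noteq> 0"
      using 5 supp by (auto simp: p_def q_def)
    have "\<mu> = p ^ 8" using vertex(3) 5 by (simp add: pq(1) power_mult_distrib)
    then have "q ^ 2 = p ^ 2"
      using mono[of 0 0 6 2] 5 pq(3) by (simp add: pq(1,2) power_mult_distrib power_numeral_reduce)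
    then consider "q = p" | "q = - p" by (auto simp: power2_eq_iff)
    then show ?thesis
    proof cases
      case 1
      then show ?thesis using 5 pq supp by (intro finish[of p 1]) auto
    next
      case 2
      have "\<i> * p * \<i> = (\<i> * \<i>) * p" by (simp only: mult_ac)
      then show ?thesis using 2 5 pq supp by (intro finish[of "- \<i> * p" \<i>]) auto
    qed
  qed
qed

text \<open>\<open>local_invariant b \<beta>\<close>: the monomial with exponents \<open>\<beta>\<close> is invariant under the
  uniformizing group of the chart.\<close>

definition local_invariant :: "(3 \<Rightarrow> int ^ 3) \<Rightarrow> (3 \<Rightarrow> nat) \<Rightarrow> bool" where
  "local_invariant b \<beta> \<longleftrightarrow> (\<Prod>l\<in>UNIV. (twist \<i> (b l) / twist \<i> (missing b)) ^ \<beta> l) = 1"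

lemma twist_i_nonzero [simp]: "twist \<i> v \<noteq> 0"
  by (rule twist_nonzero) simp

lemma twist_i_power8 [simp]: "twist \<i> v ^ 8 = 1"
  using arg_cong[OF twist_power4[of \<i> v], of "\<lambda>x. x ^ 2"] by simp

lemma local_invariant_add:
  assumes "local_invariant b \<beta>" "\<And>l. \<beta> l = \<gamma> l + \<delta> l" "local_invariant b \<gamma>"
  shows "local_invariant b \<delta>"
  using assms by (simp add: local_invariant_def power_add prod.distrib)

text \<open>Invariant monomials of degree at most 8 are sections. One of larger degree is divisible
  by an invariant monomial, either the fourth power of a coordinate or the product of the three.\<close>

lemma local_invariant_form:
  assumes b: "b \<in> charts quotient_fan" and "local_invariant b \<beta>"
  shows "\<exists>d. (\<lambda>w. \<Prod>l\<in>UNIV. w $ l ^ \<beta> l) \<in> forms ((\<lambda>\<alpha>. monomial_section \<alpha> b) ` exponents) d"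
  using assms(2)
proof (induction "\<Sum>l\<in>UNIV. \<beta> l" arbitrary: \<beta> rule: less_induct)
  case less
  let ?S = "(\<lambda>\<alpha>. monomial_section \<alpha> b) ` exponents"
  have split: ?case
    if "\<And>l. \<beta> l = \<gamma> l + \<delta> l" "local_invariant b \<gamma>" "(\<Sum>l\<in>UNIV. \<gamma> l) > 0" "(\<Sum>l\<in>UNIV. \<delta> l) > 0" for \<gamma> \<delta>
  proof -
    note \<gamma> = that(2) and pos = that(3,4)
    have \<delta>: "local_invariant b \<delta>" by (rule local_invariant_add[OF less.prems that(1,2)])
    have sum: "(\<Sum>l\<in>UNIV. \<beta> l) = (\<Sum>l\<in>UNIV. \<gamma> l) + (\<Sum>l\<in>UNIV. \<delta> l)"
      by (simp add: that(1) sum.distrib)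
    obtain d e where "(\<lambda>w. \<Prod>l\<in>UNIV. w $ l ^ \<gamma> l) \<in> forms ?S d" "(\<lambda>w. \<Prod>l\<in>UNIV. w $ l ^ \<delta> l) \<in> forms ?S e"
      using less.hyps[OF _ \<gamma>] less.hyps[OF _ \<delta>] sum pos by auto
    from forms_mult[OF this]
    have "(\<lambda>w. \<Prod>l\<in>UNIV. w $ l ^ \<beta> l) \<in> forms ?S (d + e)"
      by (simp add: that(1) power_add prod.distrib)
    then show ?thesis by blast
  qed
  let ?\<chi> = "\<lambda>l. twist \<i> (b l) / twist \<i> (missing b)"
  have \<chi>4: "?\<chi> l ^ 4 = 1" for l by (simp add: power_divide twist_power4)
  consider "(\<Sum>l\<in>UNIV. \<beta> l) \<le> 8" | k where "(\<Sum>l\<in>UNIV. \<beta> l) > 8" "\<beta> k \<ge> 4"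
    | "(\<Sum>l\<in>UNIV. \<beta> l) > 8" "\<And>l. \<beta> l \<ge> 1"
  proof -
    \<comment> \<open>If one exponent is 0 and the other two are at most 3, the sum is at most
      6.\<close>
    have "(\<Sum>l\<in>UNIV. \<beta> l) \<le> 8 \<or> (\<exists>k. \<beta> k \<ge> 4) \<or> (\<forall>l. \<beta> l \<ge> 1)" (is ?P)
    proof (rule ccontr)
      assume *: "\<not> ?P"
      then have "\<beta> 1 < 4" "\<beta> 2 < 4" "\<beta> 3 < 4" by (simp_all add: not_le)
      moreover have "\<beta> 1 = 0 \<or> \<beta> 2 = 0 \<or> \<beta> 3 = 0" "\<beta> 1 + \<beta> 2 + \<beta> 3 > 8"
        using * by (auto simp: sum_3 forall_3 not_le)
      ultimately show False by linarith
    qed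
    then show thesis using that by (meson not_le)
  qed
  then show ?case
  proof cases
    case 1
    \<comment> \<open>The missing ray takes the remaining degree. Its twist then enters with total
      power 8, which is trivial, so local invariance becomes invariance.\<close>
    define \<alpha> where "\<alpha> v = (if v \<in> range b then \<beta> (inv b v)
      else if v = missing b then 8 - (\<Sum>l\<in>UNIV. \<beta> l) else 0)" for v
    have \<alpha>b: "\<alpha> (b l) = \<beta> l" for l by (simp add: \<alpha>_def chart_inj[OF b])
    have \<alpha>m: "\<alpha> (missing b) = 8 - (\<Sum>l\<in>UNIV. \<beta> l)"
      using missing_notin[OF b] by (simp add: \<alpha>_def)
    have "(\<Sum>v\<in>rays. \<alpha> v) = 8" using 1 by (simp add: sum_rays_chart[OF b] \<alpha>b \<alpha>m)
    moreover have "\<alpha> v = 0" if "v \<notin> rays" for v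
      using that unfolding \<alpha>_def rays_insert_missing[OF b] by auto
    moreover have "monomial \<alpha> (twist \<i>) = 1"
    proof -
      have "(\<Prod>l\<in>UNIV. twist \<i> (b l) ^ \<beta> l) = twist \<i> (missing b) ^ (\<Sum>l\<in>UNIV. \<beta> l)"
        using less.prems by (simp add: local_invariant_def power_divide prod_dividef power_sum)
      then have "monomial \<alpha> (twist \<i>) = twist \<i> (missing b) ^ (8 - (\<Sum>l\<in>UNIV. \<beta> l) + (\<Sum>l\<in>UNIV. \<beta> l))"
        by (simp add: monomial_def prod_rays_chart[OF b] \<alpha>b \<alpha>m power_add)
      then show ?thesis using 1 by simp
    qed
    ultimately have "\<alpha> \<in> exponents"
      by (simp add: exponents_def monomial_twist_i_eq_1_iff)
    moreover have "monomial_section \<alpha> b = (\<lambda>w. \<Prod>l\<in>UNIV. w $ l ^ \<beta> l)"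
      using b by (simp add: monomial_section_def[abs_def] monomial_chart \<alpha>b)
    ultimately have "(\<lambda>w. \<Prod>l\<in>UNIV. w $ l ^ \<beta> l) \<in> ?S" by (metis imageI)
    then show ?thesis by (blast intro: forms_generator)
  next
    case (2 k)
    let ?\<gamma> = "\<lambda>l. if l = k then 4 else 0 :: nat" and ?\<delta> = "\<lambda>l. if l = k then \<beta> l - 4 else \<beta> l"
    have eq: "\<beta> l = ?\<gamma> l + ?\<delta> l" for l using 2 by simp
    have "(\<Sum>l\<in>UNIV. \<beta> l) = (\<Sum>l\<in>UNIV. ?\<gamma> l) + (\<Sum>l\<in>UNIV. ?\<delta> l)"
      unfolding sum.distrib[symmetric] by (rule sum.cong) (use eq in auto)
    then have "(\<Sum>l\<in>UNIV. ?\<delta> l) > 0" using 2 by simp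
    moreover have "local_invariant b ?\<gamma>"
    proof -
      have "(\<Prod>l\<in>UNIV. ?\<chi> l ^ ?\<gamma> l) = 1"
        by (rule prod.neutral) (simp add: \<chi>4)
      then show ?thesis by (simp add: local_invariant_def)
    qed
    ultimately show ?thesis using eq by (intro split[of ?\<gamma> ?\<delta>]) auto
  next
    case 3
    \<comment> \<open>The four twists have product 1, so the three ratios multiply to the inverse
      fourth power of \<open>twist \<i> (missing b)\<close>, which is 1.\<close>
    have "local_invariant b (\<lambda>_. 1)"
    proof -
      have "(\<Prod>v\<in>rays. twist \<i> v) = 1" by (simp add: prod_rays)
      then have "twist \<i> (missing b) * (\<Prod>l\<in>UNIV. twist \<i> (b l)) = twist \<i> (missing b) ^ 4"
        by (simp add: prod_rays_chart[OF b] twist_power4)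
      then have "(\<Prod>l\<in>UNIV. twist \<i> (b l)) = twist \<i> (missing b) ^ 3"
        by (simp add: power_numeral_reduce)
      then show ?thesis by (simp add: local_invariant_def prod_dividef)
    qed
    moreover have "\<beta> l = 1 + (\<beta> l - 1)" for l using 3(2)[of l] by simp
    moreover have "(\<Sum>l\<in>UNIV. \<beta> l) = 3 + (\<Sum>l\<in>UNIV. \<beta> l - 1)"
      using 3(2)[of 1] 3(2)[of 2] 3(2)[of 3] by (simp add: sum_3)
    ultimately show ?thesis using 3(1) by (intro split[of "\<lambda>_. 1" "\<lambda>l. \<beta> l - 1"]) auto
  qed
qed

text \<open>A regular function is invariant under the generator of the local group, so it equals its
  average over the four powers of that generator. The average kills each monomial with a nontrivial
  character, because a geometric sum over fourth roots of unity vanishes.\<close>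

lemma chart_regular_form:
  assumes b: "b \<in> charts quotient_fan" and f: "chart_regular quotient_fan b f"
  shows "\<exists>d. f \<in> forms ((\<lambda>\<alpha>. monomial_section \<alpha> b) ` exponents) d"
proof -
  let ?S = "(\<lambda>\<alpha>. monomial_section \<alpha> b) ` exponents"
  let ?\<chi> = "\<lambda>l. twist \<i> (b l) / twist \<i> (missing b)"
  have \<chi>4: "?\<chi> l ^ 4 = 1" for l by (simp add: power_divide twist_power4)
  have "polynomial_map f" using f by (simp add: chart_regular_def)
  then obtain F a where F: "finite F" "f = (\<lambda>z. \<Sum>\<beta>\<in>F. a \<beta> * (\<Prod>l\<in>UNIV. z $ l ^ \<beta> l))"
    by (rule coefficient_expansionE[OF polynomial_map_expansion])
  define \<psi> where "\<psi> \<beta> = (\<Prod>l\<in>UNIV. ?\<chi> l ^ \<beta> l)" for \<beta> :: "3 \<Rightarrow> nat"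
  have \<psi>4: "\<psi> \<beta> ^ 4 = 1" for \<beta>
  proof -
    have "(?\<chi> l ^ \<beta> l) ^ 4 = 1" for l
      by (metis \<chi>4 mult.commute power_mult power_one)
    then show ?thesis by (simp add: \<psi>_def prod_power_distrib)
  qed
  have inv: "f (\<chi> l. ?\<chi> l * z $ l) = f z" for z
  proof -
    have "same_point quotient_fan (chart_point b z) (chart_point b (\<chi> l. ?\<chi> l * z $ l))"
      unfolding same_point_iff
    proof (intro exI conjI ballI)
      fix v assume "v \<in> rays"
      then show "chart_point b (\<chi> l. ?\<chi> l * z $ l) v
          = inverse (twist \<i> (missing b)) * twist \<i> v * chart_point b z v"
        unfolding rays_insert_missing[OF b] by (auto simp: b chart_inj[OF b] field_simps)
    qed auto
    then show ?thesis using f unfolding chart_regular_def by metis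
  qed
  have iter: "f z = (\<Sum>\<beta>\<in>F. \<psi> \<beta> ^ k * (a \<beta> * (\<Prod>l\<in>UNIV. z $ l ^ \<beta> l)))" for k z
  proof (induction k arbitrary: z)
    case 0
    then show ?case by (simp add: F(2))
  next
    case (Suc k)
    have "f z = (\<Sum>\<beta>\<in>F. \<psi> \<beta> ^ k * (a \<beta> * (\<Prod>l\<in>UNIV. (\<chi> l. ?\<chi> l * z $ l) $ l ^ \<beta> l)))"
      using inv[of z] Suc.IH[of "\<chi> l. ?\<chi> l * z $ l"] by simp
    also have "\<dots> = (\<Sum>\<beta>\<in>F. \<psi> \<beta> ^ Suc k * (a \<beta> * (\<Prod>l\<in>UNIV. z $ l ^ \<beta> l)))"
    proof (intro sum.cong refl)
      fix \<beta>
      have "(\<Prod>l\<in>UNIV. (\<chi> l. ?\<chi> l * z $ l) $ l ^ \<beta> l) = \<psi> \<beta> * (\<Prod>l\<in>UNIV. z $ l ^ \<beta> l)"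
        unfolding \<psi>_def by (simp only: vec_lambda_beta power_mult_distrib prod.distrib)
      then show "\<psi> \<beta> ^ k * (a \<beta> * (\<Prod>l\<in>UNIV. (\<chi> l. ?\<chi> l * z $ l) $ l ^ \<beta> l))
          = \<psi> \<beta> ^ Suc k * (a \<beta> * (\<Prod>l\<in>UNIV. z $ l ^ \<beta> l))"
        by (simp only: power_Suc mult_ac)
    qed
    finally show ?case .
  qed
  have avg: "(\<Sum>k<4. \<psi> \<beta> ^ k) = (if \<psi> \<beta> = 1 then 4 else 0)" for \<beta>
  proof (cases "\<psi> \<beta> = 1")
    case False
    have "(\<psi> \<beta> - 1) * (\<Sum>k<4. \<psi> \<beta> ^ k) = \<psi> \<beta> ^ 4 - 1"
      by (rule power_diff_1_eq[symmetric])
    then show ?thesis using False \<psi>4 by simp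
  qed simp
  have "f z = (\<Sum>\<beta>\<in>{\<beta> \<in> F. local_invariant b \<beta>}. a \<beta> * (\<Prod>l\<in>UNIV. z $ l ^ \<beta> l))" for z
  proof -
    have "4 * f z = (\<Sum>k<4::nat. f z)" by simp
    also have "\<dots> = (\<Sum>k<4. \<Sum>\<beta>\<in>F. \<psi> \<beta> ^ k * (a \<beta> * (\<Prod>l\<in>UNIV. z $ l ^ \<beta> l)))"
      by (intro sum.cong refl iter)
    also have "\<dots> = (\<Sum>\<beta>\<in>F. (\<Sum>k<4. \<psi> \<beta> ^ k) * (a \<beta> * (\<Prod>l\<in>UNIV. z $ l ^ \<beta> l)))"
      unfolding sum_distrib_right by (rule sum.swap)
    also have "\<dots> = (\<Sum>\<beta>\<in>{\<beta> \<in> F. local_invariant b \<beta>}. 4 * (a \<beta> * (\<Prod>l\<in>UNIV. z $ l ^ \<beta> l)))"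
      unfolding avg using F(1)
      by (intro sum.mono_neutral_cong_right) (auto simp: local_invariant_def \<psi>_def)
    finally show ?thesis by (simp flip: sum_distrib_left)
  qed
  then have "f = (\<lambda>z. \<Sum>\<beta>\<in>{\<beta> \<in> F. local_invariant b \<beta>}. a \<beta> * (\<Prod>l\<in>UNIV. z $ l ^ \<beta> l))"
    by blast
  moreover have "\<exists>d. (\<lambda>z. \<Sum>\<beta>\<in>{\<beta> \<in> F. local_invariant b \<beta>}. a \<beta> * (\<Prod>l\<in>UNIV. z $ l ^ \<beta> l)) \<in> forms ?S d"
  proof (rule forms_sum_some_degree)
    show "(\<lambda>z. 1) \<in> ?S" using vertex_section[OF b] by (metis imageI)
    show "finite {\<beta> \<in> F. local_invariant b \<beta>}" using F(1) by simp
    fix \<beta> assume "\<beta> \<in> {\<beta> \<in> F. local_invariant b \<beta>}"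
    then show "\<exists>d. (\<lambda>z. a \<beta> * (\<Prod>l\<in>UNIV. z $ l ^ \<beta> l)) \<in> forms ?S d"
      using local_invariant_form[OF b, of \<beta>] forms_cmult by blast
  qed
  ultimately show ?thesis by simp
qed

lemma exponents_enumeration: "\<exists>N e. bij_betw e {..N} exponents \<and> card exponents = Suc N"
proof -
  have "expo 8 0 0 0 \<in> exponents" by (simp add: expo_in_exponents)
  then have "card exponents \<noteq> 0" using finite_exponents by auto
  then obtain N where N: "card exponents = Suc N" by (cases "card exponents") auto
  then have "\<exists>e. bij_betw e {..N} exponents"
    using finite_same_card_bij[OF finite_atMost[of N] finite_exponents] by simp
  then show ?thesis using N by blast
qed

lemma very_ample_quotient_fan: "very_ample_anticanonical quotient_fan 2"
proof -
  obtain N :: nat and e where e: "bij_betw e {..N} exponents"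
    using exponents_enumeration by metis
  have im: "e ` {..N} = exponents" using e by (simp add: bij_betw_def)
  let ?s = "\<lambda>i. monomial_section (e i)"
  have im': "(\<lambda>i. ?s i b) ` {..N} = (\<lambda>\<alpha>. monomial_section \<alpha> b) ` exponents" for b
    by (simp add: image_image flip: im)
  have all: "(\<forall>i\<le>N. P (e i)) \<longleftrightarrow> (\<forall>\<alpha>\<in>exponents. P \<alpha>)" for P
    by (auto simp flip: im)
  show ?thesis unfolding very_ample_anticanonical_def
  proof (rule exI[of _ N], rule exI[of _ ?s], intro conjI ballI allI impI)
    show "anticanonical_basis quotient_fan 2 N ?s" by (rule monomial_basis[OF e])
  next
    fix b z assume b: "b \<in> charts quotient_fan"
    obtain \<alpha> where "\<alpha> \<in> exponents" "monomial_section \<alpha> b = (\<lambda>z. 1)"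
      by (rule vertex_section[OF b])
    moreover then obtain i where "i \<le> N" "\<alpha> = e i" using im by auto
    ultimately show "\<exists>i\<le>N. ?s i b z \<noteq> 0" by (intro exI[of _ i]) simp
  next
    fix b c z w \<mu>
    assume b: "b \<in> charts quotient_fan" and c: "c \<in> charts quotient_fan"
      and eq: "\<forall>i\<le>N. ?s i c w = \<mu> * ?s i b z"
    have "\<forall>\<alpha>\<in>exponents. monomial_section \<alpha> c w = \<mu> * monomial_section \<alpha> b z"
      using eq all[of "\<lambda>\<alpha>. monomial_section \<alpha> c w = \<mu> * monomial_section \<alpha> b z"] by simp
    then show "same_point quotient_fan (chart_point b z) (chart_point c w)"
      using b c missing_rays
      by (intro monomials_separate_points[of _ \<mu> _ "missing b" "missing c"])
        (auto simp: monomial_section_def)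
  next
    fix b z f assume b: "b \<in> charts quotient_fan" and f: "chart_regular quotient_fan b f"
    obtain d where d: "f \<in> forms ((\<lambda>i. ?s i b) ` {..N}) d"
      using chart_regular_form[OF b f] unfolding im' by blast
    \<comment> \<open>The section that is constantly 1 on the chart gives the denominator, in the
      degree of \<open>f\<close>; the numerator is \<open>f\<close> itself.\<close>
    have "(\<lambda>z. 1) \<in> (\<lambda>i. ?s i b) ` {..N}"
      unfolding im' using vertex_section[OF b] by (metis imageI)
    from forms_power[OF this, of d]
    show "\<exists>d. \<exists>A\<in>forms ((\<lambda>i. ?s i b) ` {..N}) d. \<exists>B\<in>forms ((\<lambda>i. ?s i b) ` {..N}) d.
        B z \<noteq> 0 \<and> (\<forall>w. f w * B w = A w)"
      using d by (intro exI[of _ d] bexI[of _ f] bexI[of _ "\<lambda>z. 1"]) auto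
  qed
qed

section \<open>The Fubini--Study metric\<close>

definition fs_norm :: "complex ^ 'n::finite \<Rightarrow> complex" where
  "fs_norm z = 1 + (\<Sum>j\<in>UNIV. z $ j * cnj (z $ j))"

text \<open>The entries are the mixed Wirtinger derivatives of the Kaehler potential
  \<open>ln (1 + |z|\<^sup>2)\<close>.\<close>

definition fubini_study :: "complex ^ 'n::finite \<Rightarrow> complex ^ 'n ^ 'n" where
  "fubini_study z = (\<chi> j k. of_bool (j = k) * inverse (fs_norm z)
    - cnj (z $ j) * z $ k * inverse (fs_norm z) ^ 2)"

definition d_fs_norm :: "complex ^ 'n::finite \<Rightarrow> complex ^ 'n \<Rightarrow> complex" where
  "d_fs_norm z h = (\<Sum>j\<in>UNIV. z $ j * cnj (h $ j) + h $ j * cnj (z $ j))"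

lemma fs_norm_of_real: "fs_norm z = of_real (1 + (\<Sum>j\<in>UNIV. (norm (z $ j))\<^sup>2))"
  by (simp add: fs_norm_def flip: complex_norm_square)

lemma Re_fs_norm_pos: "Re (fs_norm z) > 0"
  unfolding fs_norm_of_real Re_complex_of_real by (rule add_pos_nonneg) (auto intro: sum_nonneg)

lemma fs_norm_nonzero [simp]: "fs_norm z \<noteq> 0"
  using Re_fs_norm_pos[of z] by auto

lemma cnj_fs_norm [simp]: "cnj (fs_norm z) = fs_norm z"
  by (simp add: fs_norm_of_real)

lemma fs_norm_eq_Re: "fs_norm z = of_real (Re (fs_norm z))"
  by (simp add: fs_norm_of_real)

lemma d_fs_norm_real: "d_fs_norm z h = of_real (Re (d_fs_norm z h))"
  by (simp add: complex_eq_iff d_fs_norm_def)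

lemma coordinate_has_derivative: "((\<lambda>z. z $ j) has_derivative (\<lambda>h. h $ j)) (at z)"
  by (rule bounded_linear.has_derivative[OF bounded_linear_vec_nth has_derivative_ident])

lemma cnj_coordinate_has_derivative: "((\<lambda>z. cnj (z $ j)) has_derivative (\<lambda>h. cnj (h $ j))) (at z)"
  by (rule bounded_linear.has_derivative[OF bounded_linear_cnj coordinate_has_derivative])

lemma fs_norm_has_derivative: "(fs_norm has_derivative d_fs_norm z) (at z)"
  unfolding fs_norm_def[abs_def] d_fs_norm_def
  using has_derivative_add[OF has_derivative_const[of 1] has_derivative_sum[OF
      has_derivative_mult[OF coordinate_has_derivative cnj_coordinate_has_derivative]]]
  by simp

lemma inverse_fs_norm_has_derivative:
  "((\<lambda>z. inverse (fs_norm z)) has_derivative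
    (\<lambda>h. - (inverse (fs_norm z) * inverse (fs_norm z) * d_fs_norm z h))) (at z)"
  using has_derivative_compose[OF fs_norm_has_derivative has_derivative_inverse'[OF fs_norm_nonzero]]
  by (simp add: mult_ac)

text \<open>An algebra of functions that contains the metric coefficients and is closed under
  directional derivatives, so that smoothness to all orders follows by one induction.\<close>

inductive_set fs_algebra :: "(complex ^ 'n::finite \<Rightarrow> complex) set" where
  const: "(\<lambda>z. c) \<in> fs_algebra"
| coord: "(\<lambda>z. z $ j) \<in> fs_algebra"
| cnj_coord: "(\<lambda>z. cnj (z $ j)) \<in> fs_algebra"
| inv_norm: "(\<lambda>z. inverse (fs_norm z)) \<in> fs_algebra"
| add: "f \<in> fs_algebra \<Longrightarrow> g \<in> fs_algebra \<Longrightarrow> (\<lambda>z. f z + g z) \<in> fs_algebra"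
| mult: "f \<in> fs_algebra \<Longrightarrow> g \<in> fs_algebra \<Longrightarrow> (\<lambda>z. f z * g z) \<in> fs_algebra"

lemma fs_algebra_uminus: "f \<in> fs_algebra \<Longrightarrow> (\<lambda>z. - f z) \<in> fs_algebra"
  using fs_algebra.mult[OF fs_algebra.const[of "-1"]] by simp

lemma fs_algebra_sum:
  assumes "finite I" "\<And>i. i \<in> I \<Longrightarrow> f i \<in> fs_algebra"
  shows "(\<lambda>z. \<Sum>i\<in>I. f i z) \<in> fs_algebra"
  using assms by (induction I rule: finite_induct) (auto intro: fs_algebra.intros)

lemma fs_algebra_derivative:
  assumes "f \<in> fs_algebra"
  shows "\<exists>D. (\<forall>z. (f has_derivative D z) (at z)) \<and> (\<forall>h. (\<lambda>z. D z h) \<in> fs_algebra)"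
  using assms
proof (induction rule: fs_algebra.induct)
  case (const c)
  show ?case by (rule exI[of _ "\<lambda>z h. 0"]) (auto intro: fs_algebra.const)
next
  case (coord j)
  show ?case
    by (rule exI[of _ "\<lambda>z h. h $ j"]) (auto intro: fs_algebra.const coordinate_has_derivative)
next
  case (cnj_coord j)
  show ?case
    by (rule exI[of _ "\<lambda>z h. cnj (h $ j)"]) (auto intro: fs_algebra.const cnj_coordinate_has_derivative)
next
  case inv_norm
  have "(\<lambda>z. - (inverse (fs_norm z) * inverse (fs_norm z) * d_fs_norm z h)) \<in> fs_algebra" for h :: "complex ^ 'a"
    unfolding d_fs_norm_def
    by (intro fs_algebra_uminus fs_algebra.mult fs_algebra_sum fs_algebra.add fs_algebra.const
        fs_algebra.coord fs_algebra.cnj_coord fs_algebra.inv_norm) simp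
  then show ?case
    by (intro exI[of _ "\<lambda>z h. - (inverse (fs_norm z) * inverse (fs_norm z) * d_fs_norm z h)"])
      (auto intro: inverse_fs_norm_has_derivative)
next
  case (add f g)
  obtain D E where D: "\<forall>z. (f has_derivative D z) (at z)" "\<forall>h. (\<lambda>z. D z h) \<in> fs_algebra"
    and E: "\<forall>z. (g has_derivative E z) (at z)" "\<forall>h. (\<lambda>z. E z h) \<in> fs_algebra"
    using add.IH by (elim exE conjE)
  show ?case
  proof (intro exI[of _ "\<lambda>z h. D z h + E z h"] conjI allI)
    fix z
    show "((\<lambda>z. f z + g z) has_derivative (\<lambda>h. D z h + E z h)) (at z)"
      using D(1) E(1) by (intro has_derivative_add) auto
  next
    fix h
    show "(\<lambda>z. D z h + E z h) \<in> fs_algebra"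
      using D(2) E(2) by (intro fs_algebra.add) auto
  qed
next
  case (mult f g)
  obtain D E where D: "\<forall>z. (f has_derivative D z) (at z)" "\<forall>h. (\<lambda>z. D z h) \<in> fs_algebra"
    and E: "\<forall>z. (g has_derivative E z) (at z)" "\<forall>h. (\<lambda>z. E z h) \<in> fs_algebra"
    using mult.IH by (elim exE conjE)
  show ?case
  proof (intro exI[of _ "\<lambda>z h. f z * E z h + D z h * g z"] conjI allI)
    fix z
    show "((\<lambda>z. f z * g z) has_derivative (\<lambda>h. f z * E z h + D z h * g z)) (at z)"
      using D(1) E(1) by (intro has_derivative_mult) auto
  next
    fix h
    show "(\<lambda>z. f z * E z h + D z h * g z) \<in> fs_algebra"
      using D(2) E(2) mult.hyps by (intro fs_algebra.add fs_algebra.mult) auto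
  qed
qed

lemma fs_algebra_smooth:
  assumes "f \<in> fs_algebra"
  shows "smooth f"
proof -
  have "times_differentiable k f" for k
    using assms
  proof (induction k arbitrary: f)
    case 0
    then obtain D where "\<forall>z. (f has_derivative D z) (at z)"
      using fs_algebra_derivative by metis
    then show ?case
      by (metis has_derivative_continuous continuous_at_imp_continuous_on times_differentiable.simps(1))
  next
    case (Suc k)
    obtain D where D: "\<forall>z. (f has_derivative D z) (at z)" "\<forall>h. (\<lambda>z. D z h) \<in> fs_algebra"
      using fs_algebra_derivative[OF Suc.prems] by (elim exE conjE)
    have "frechet_derivative f (at z) = D z" for z
      using D(1) frechet_derivative_at by metis
    then show ?case using D Suc.IH by (auto simp: differentiable_def)
  qed
  then show ?thesis by (simp add: smooth_def)
qed

lemma fubini_study_nth: "fubini_study z $ j $ k =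
    of_bool (j = k) * inverse (fs_norm z) - cnj (z $ j) * z $ k * inverse (fs_norm z) ^ 2"
  by (simp add: fubini_study_def)

lemma fubini_study_in_algebra: "(\<lambda>z. fubini_study z $ j $ k) \<in> fs_algebra"
proof -
  have "(\<lambda>z. of_bool (j = k) * inverse (fs_norm z)
      + - (cnj (z $ j) * z $ k * (inverse (fs_norm z) * inverse (fs_norm z)))) \<in> fs_algebra"
    by (intro fs_algebra_uminus fs_algebra.intros)
  then show ?thesis by (simp add: fubini_study_nth power2_eq_square)
qed

text \<open>\<open>D\<close> is only real linear, so the real and the imaginary direction enter
  separately; \<open>e\<close> is the value in the imaginary direction divided by
  \<open>\<i>\<close>.\<close>

lemma d_z_eq:
  assumes "(f has_derivative D) (at z)" "D (axis j \<i>) = \<i> * e"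
  shows "d_z j f z = (D (axis j 1) + e) / 2"
  using frechet_derivative_at[OF assms(1)] assms(2) by (simp add: d_z_def flip: mult.assoc)

lemma d_zbar_eq:
  assumes "(f has_derivative D) (at z)" "D (axis j \<i>) = \<i> * e"
  shows "d_zbar j f z = (D (axis j 1) - e) / 2"
  using frechet_derivative_at[OF assms(1)] assms(2) by (simp add: d_zbar_def flip: mult.assoc)

lemma cnj_of_bool [simp]: "cnj (of_bool P) = of_bool P"
  by simp

lemma axis_nth_of_bool: "axis i c $ k = of_bool (i = k) * (c :: complex)"
  by (simp add: axis_def)

lemma d_fs_norm_axis: "d_fs_norm z (axis j c) = z $ j * cnj c + c * cnj (z $ j)"
proof -
  have "d_fs_norm z (axis j c) = (\<Sum>i\<in>UNIV. if i = j then z $ j * cnj c + c * cnj (z $ j) else 0)"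
    unfolding d_fs_norm_def by (intro sum.cong) (auto simp: axis_def)
  then show ?thesis by simp
qed

text \<open>Written out because the right-hand side is visibly symmetric in \<open>i\<close> and
  \<open>j\<close>, which is closedness of the Kaehler form.\<close>

lemma d_z_fubini_study:
  "d_z i (\<lambda>w. fubini_study w $ j $ k) z =
    2 * cnj (z $ i) * cnj (z $ j) * z $ k * inverse (fs_norm z) ^ 3
    - (of_bool (j = k) * cnj (z $ i) + of_bool (i = k) * cnj (z $ j)) * inverse (fs_norm z) ^ 2"
proof -
  let ?q = "inverse (fs_norm z)"
  let ?dq = "\<lambda>h. - (?q * ?q * d_fs_norm z h)"
  let ?f = "\<lambda>w. of_bool (j = k) * inverse (fs_norm w)
    - cnj (w $ j) * w $ k * (inverse (fs_norm w) * inverse (fs_norm w))"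
  let ?D = "\<lambda>h. of_bool (j = k) * ?dq h - ((cnj (z $ j) * z $ k) * (?q * ?dq h + ?dq h * ?q)
    + (cnj (z $ j) * h $ k + cnj (h $ j) * z $ k) * (?q * ?q))"
  let ?e = "of_bool (j = k) * (?q * ?q * (z $ i - cnj (z $ i)))
    - (cnj (z $ j) * z $ k * (2 * ?q * (?q * ?q * (z $ i - cnj (z $ i))))
      + (cnj (z $ j) * of_bool (i = k) - of_bool (i = j) * z $ k) * (?q * ?q))"
  have D: "(?f has_derivative ?D) (at z)"
    by (intro has_derivative_diff has_derivative_mult has_derivative_mult_right
        coordinate_has_derivative cnj_coordinate_has_derivative inverse_fs_norm_has_derivative)
  have e: "?D (axis i \<i>) = \<i> * ?e"
    by (simp add: d_fs_norm_axis axis_nth_of_bool algebra_simps)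
  have "d_z i ?f z = 2 * cnj (z $ i) * cnj (z $ j) * z $ k * (?q * ?q * ?q)
    - (of_bool (j = k) * cnj (z $ i) + of_bool (i = k) * cnj (z $ j)) * (?q * ?q)"
    unfolding d_z_eq[OF D e]
    by (simp add: d_fs_norm_axis axis_nth_of_bool algebra_simps add_divide_distrib diff_divide_distrib)
  then show ?thesis
    by (simp only: fubini_study_nth power2_eq_square power3_eq_cube)
qed

lemma fubini_study_sum:
  "(\<Sum>j\<in>UNIV. \<Sum>k\<in>UNIV. fubini_study z $ j $ k * v $ j * w $ k) =
    (\<Sum>j\<in>UNIV. v $ j * w $ j) * inverse (fs_norm z)
    - (\<Sum>j\<in>UNIV. cnj (z $ j) * v $ j) * (\<Sum>k\<in>UNIV. z $ k * w $ k) * inverse (fs_norm z) ^ 2"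
proof -
  have "(\<Sum>k\<in>UNIV. fubini_study z $ j $ k * v $ j * w $ k) = v $ j * w $ j * inverse (fs_norm z)
      - cnj (z $ j) * v $ j * (\<Sum>k\<in>UNIV. z $ k * w $ k) * inverse (fs_norm z) ^ 2" for j
  proof -
    have "(\<Sum>k\<in>UNIV. fubini_study z $ j $ k * v $ j * w $ k)
        = (\<Sum>k\<in>UNIV. (if k = j then v $ j * w $ j * inverse (fs_norm z) else 0)
          - cnj (z $ j) * v $ j * (z $ k * w $ k) * inverse (fs_norm z) ^ 2)"
      by (intro sum.cong) (auto simp: fubini_study_nth algebra_simps)
    then show ?thesis
      by (simp add: sum_subtractf sum_distrib_left sum_distrib_right)
  qed
  then show ?thesis
    by (simp add: sum_subtractf sum_distrib_right)
qed

text \<open>Multiplied by the square of \<open>fs_norm z\<close>, the form is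
  \<open>(1 + |z|\<^sup>2) |v|\<^sup>2 - |p|\<^sup>2\<close>, where \<open>p\<close> is the inner
  product of \<open>v\<close> and \<open>z\<close>; Cauchy-Schwarz bounds the last term by
  \<open>|z|\<^sup>2 |v|\<^sup>2\<close>.\<close>

lemma fubini_study_positive:
  assumes "v \<noteq> 0"
  shows "0 < Re (\<Sum>j\<in>UNIV. \<Sum>k\<in>UNIV. fubini_study z $ j $ k * v $ j * cnj (v $ k))"
proof -
  define V where "V = (\<Sum>j\<in>UNIV. (norm (v $ j))\<^sup>2)"
  define S where "S = (\<Sum>j\<in>UNIV. (norm (z $ j))\<^sup>2)"
  define p where "p = (\<Sum>j\<in>UNIV. cnj (z $ j) * v $ j)"
  have N: "fs_norm z = of_real (1 + S)" by (simp add: fs_norm_of_real S_def)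
  obtain i where "v $ i \<noteq> 0" using assms by (auto simp: vec_eq_iff)
  then have "V > 0" unfolding V_def by (intro sum_pos2[of _ i]) auto
  have "S \<ge> 0" by (simp add: S_def sum_nonneg)
  have "norm p \<le> (\<Sum>j\<in>UNIV. norm (z $ j) * norm (v $ j))"
    unfolding p_def by (rule order_trans[OF norm_sum]) (simp add: norm_mult)
  then have "(norm p)\<^sup>2 \<le> (\<Sum>j\<in>UNIV. norm (z $ j) * norm (v $ j))\<^sup>2"
    by (intro power_mono) auto
  also have "\<dots> \<le> S * V" unfolding S_def V_def by (rule Cauchy_Schwarz_ineq_sum)
  finally have cs: "(norm p)\<^sup>2 \<le> S * V" .
  have cnj_p: "(\<Sum>k\<in>UNIV. z $ k * cnj (v $ k)) = cnj p" by (simp add: p_def)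
  have "(\<Sum>j\<in>UNIV. v $ j * cnj (v $ j)) = of_real V"
    by (simp add: V_def flip: complex_norm_square)
  then have "(\<Sum>j\<in>UNIV. \<Sum>k\<in>UNIV. fubini_study z $ j $ k * v $ j * cnj (v $ k))
      = of_real V * inverse (fs_norm z) - p * cnj p * inverse (fs_norm z) ^ 2"
    using fubini_study_sum[of z v "\<chi> k. cnj (v $ k)"] by (simp add: cnj_p p_def[symmetric])
  also have "\<dots> = of_real (V * inverse (1 + S) - (norm p)\<^sup>2 * inverse (1 + S) ^ 2)"
    unfolding N complex_norm_square[symmetric] by simp
  finally have "Re (\<Sum>j\<in>UNIV. \<Sum>k\<in>UNIV. fubini_study z $ j $ k * v $ j * cnj (v $ k))
      = V * inverse (1 + S) - (norm p)\<^sup>2 * inverse (1 + S) ^ 2"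
    by (simp only: Re_complex_of_real)
  also have "\<dots> = (V * (1 + S) - (norm p)\<^sup>2) * inverse (1 + S) ^ 2"
  proof -
    have "x * inverse t - y * inverse t ^ 2 = (x * t - y) * inverse t ^ 2" if "t \<noteq> 0" for x y t :: real
      using that by (simp add: field_simps power2_eq_square)
    then show ?thesis using \<open>S \<ge> 0\<close> by simp
  qed
  also have "\<dots> > 0"
    using cs \<open>V > 0\<close> \<open>S \<ge> 0\<close> by (intro mult_pos_pos) (auto simp: algebra_simps)
  finally show ?thesis .
qed

lemma kahler_fubini_study: "kahler_metric fubini_study"
  unfolding kahler_metric_def
proof (intro conjI allI impI)
  show "smooth (\<lambda>z. fubini_study z $ j $ k)" for j k
    by (rule fs_algebra_smooth[OF fubini_study_in_algebra])
  show "fubini_study z $ k $ j = cnj (fubini_study z $ j $ k)" for z j k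
    by (simp add: fubini_study_nth of_bool_def mult_ac)
  show "0 < Re (\<Sum>j\<in>UNIV. \<Sum>k\<in>UNIV. fubini_study z $ j $ k * v $ j * cnj (v $ k))"
    if "v \<noteq> 0" for z v
    using that by (rule fubini_study_positive)
  show "d_z i (\<lambda>w. fubini_study w $ j $ k) z = d_z j (\<lambda>w. fubini_study w $ i $ k) z" for z i j k
    unfolding d_z_fubini_study by (simp add: algebra_simps)
qed

text \<open>A scalar matrix minus one of rank one: with \<open>q = inverse (fs_norm z)\<close> the
  determinant is \<open>q ^ 3 - q ^ 4 * (fs_norm z - 1)\<close>.\<close>

lemma det_fubini_study: "det (fubini_study z) = inverse (fs_norm (z :: complex ^ 3)) ^ 4"
proof -
  let ?q = "inverse (fs_norm z)"
  have "det (fubini_study z) = ?q ^ 3 - ?q ^ 4 * (\<Sum>j\<in>UNIV. z $ j * cnj (z $ j))"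
    unfolding det_3 fubini_study_nth sum_3 by (simp add: power_numeral_reduce algebra_simps)
  also have "(\<Sum>j\<in>UNIV. z $ j * cnj (z $ j)) = fs_norm z - 1"
    by (simp add: fs_norm_def)
  also have "?q ^ 3 - ?q ^ 4 * (fs_norm z - 1) = ?q ^ 4"
    by (simp add: field_simps power_numeral_reduce)
  finally show ?thesis .
qed

text \<open>By the determinant formula the Ricci form is 4 times the complex Hessian of
  \<open>ln (fs_norm z)\<close>, which is the metric. The constant is the dimension plus
  one.\<close>

lemma ricci_fubini_study: "ricci fubini_study z $ j $ k = 4 * fubini_study (z :: complex ^ 3) $ j $ k"
proof -
  let ?q = "\<lambda>w. inverse (fs_norm w)"
  have ln: "ln (Re (det (fubini_study w))) = - 4 * ln (Re (fs_norm w))" for w :: "complex ^ 3"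
  proof -
    have "Re (det (fubini_study w)) = inverse (Re (fs_norm w)) ^ 4"
      unfolding det_fubini_study by (subst fs_norm_eq_Re) (simp del: of_real_inverse of_real_power
          add: of_real_inverse[symmetric] of_real_power[symmetric])
    then show ?thesis using Re_fs_norm_pos[of w] by (simp add: ln_realpow ln_inverse)
  qed
  have "d_zbar k (\<lambda>w. of_real (ln (Re (det (fubini_study w))))) w = - 4 * (?q w * w $ k)"
    for w :: "complex ^ 3"
  proof -
    have "((\<lambda>w. Re (fs_norm w)) has_derivative (\<lambda>h. Re (d_fs_norm w h))) (at w)"
      by (rule bounded_linear.has_derivative[OF bounded_linear_Re fs_norm_has_derivative])
    then have "((\<lambda>w. ln (Re (fs_norm w))) has_derivative
        (\<lambda>h. Re (d_fs_norm w h) * inverse (Re (fs_norm w)))) (at w)"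
      using has_derivative_ln[of "\<lambda>w. Re (fs_norm w)" w] Re_fs_norm_pos[of w] by simp
    then have "((\<lambda>w. - 4 * ln (Re (fs_norm w))) has_derivative
        (\<lambda>h. - 4 * (Re (d_fs_norm w h) * inverse (Re (fs_norm w))))) (at w)"
      by (rule has_derivative_mult_right)
    then have "((\<lambda>w. complex_of_real (- 4 * ln (Re (fs_norm w)))) has_derivative
        (\<lambda>h. of_real (- 4 * (Re (d_fs_norm w h) * inverse (Re (fs_norm w)))))) (at w)"
      by (rule bounded_linear.has_derivative[OF bounded_linear_of_real])
    then have "((\<lambda>w. complex_of_real (ln (Re (det (fubini_study w))))) has_derivative
        (\<lambda>h. - 4 * (d_fs_norm w h * ?q w))) (at w)"
      unfolding ln using d_fs_norm_real[of w] fs_norm_eq_Re[of w]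
      by (simp only: of_real_mult of_real_inverse of_real_minus of_real_numeral)
    from d_zbar_eq[OF this, of k "4 * ((w $ k - cnj (w $ k)) * ?q w)"] show ?thesis
      by (simp add: d_fs_norm_axis algebra_simps)
  qed
  then have "d_zbar k (\<lambda>w. of_real (ln (Re (det (fubini_study w))))) = (\<lambda>w. - 4 * (?q w * w $ k))"
    by (rule ext)
  moreover have "d_z j (\<lambda>w. - 4 * (?q w * w $ k)) z = - 4 * fubini_study z $ j $ k"
  proof -
    let ?D = "\<lambda>h. - 4 * (?q z * h $ k + - (?q z * ?q z * d_fs_norm z h) * z $ k)"
    have D: "((\<lambda>w. - 4 * (?q w * w $ k)) has_derivative ?D) (at z)"
      by (intro has_derivative_mult_right has_derivative_mult coordinate_has_derivative
          inverse_fs_norm_has_derivative)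
    have e: "?D (axis j \<i>) = \<i> * (- 4 * (?q z * of_bool (j = k)
        + ?q z * ?q z * (z $ j - cnj (z $ j)) * z $ k))"
      by (simp add: d_fs_norm_axis axis_nth_of_bool algebra_simps)
    show ?thesis
      unfolding d_z_eq[OF D e]
      by (simp add: d_fs_norm_axis fubini_study_nth axis_nth_of_bool power2_eq_square algebra_simps
          add_divide_distrib diff_divide_distrib)
  qed
  ultimately show ?thesis by (simp add: ricci_def)
qed

section \<open>Invariance of the metric under chart changes\<close>

lemma fs_norm_chart:
  assumes "b \<in> charts quotient_fan"
  shows "fs_norm z = (\<Sum>v\<in>rays. chart_point b z v * cnj (chart_point b z v))"
  using assms by (simp add: fs_norm_def sum_rays_chart[OF assms] chart_inj)

lemma fubini_study_pullback:
  "(transpose J ** fubini_study y ** (\<chi> i j. cnj (J $ i $ j))) $ l $ m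
    = (\<Sum>i\<in>UNIV. J $ i $ l * cnj (J $ i $ m)) * inverse (fs_norm y)
    - (\<Sum>i\<in>UNIV. cnj (y $ i) * J $ i $ l) * cnj (\<Sum>i\<in>UNIV. cnj (y $ i) * J $ i $ m) * inverse (fs_norm y) ^ 2"
proof -
  have "(transpose J ** fubini_study y ** (\<chi> i j. cnj (J $ i $ j))) $ l $ m
      = (\<Sum>k\<in>UNIV. \<Sum>i\<in>UNIV. fubini_study y $ i $ k * J $ i $ l * cnj (J $ k $ m))"
    by (simp add: matrix_matrix_mult_def transpose_def sum_distrib_right sum_distrib_left mult_ac)
  also have "\<dots> = (\<Sum>i\<in>UNIV. \<Sum>k\<in>UNIV. fubini_study y $ i $ k * J $ i $ l * cnj (J $ k $ m))"
    by (rule sum.swap)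
  finally show ?thesis
    using fubini_study_sum[of y "\<chi> i. J $ i $ l" "\<chi> k. cnj (J $ k $ m)"] by simp
qed

text \<open>In terms of the squared norms \<open>n v\<close> of the Cox coordinates, a chart change
  only multiplies by \<open>\<mu>\<close>, the squared norm of the scalar, since twists have norm 1.
  The logarithmic form of the Jacobian turns the pulled-back metric into sums over all rays, and
  \<open>\<mu>\<close> cancels.\<close>

lemma fubini_study_chart_change_torus:
  assumes ch: "chart_change quotient_fan b c U \<phi>" and z: "z \<in> U" "z \<in> torus"
  shows "fubini_study z $ l $ m = (transpose (jacobian \<phi> z) ** fubini_study (\<phi> z) **
    (\<chi> i j. cnj (jacobian \<phi> z $ i $ j))) $ l $ m"
proof -
  have b: "b \<in> charts quotient_fan" and c: "c \<in> charts quotient_fan"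
    using ch by (auto simp: chart_change_def)
  obtain g \<zeta> where *: "g \<noteq> 0" "\<zeta> ^ 4 = 1"
    "\<And>v. v \<in> rays \<Longrightarrow> chart_point c (\<phi> z) v = g * twist \<zeta> v * chart_point b z v"
    "g * twist \<zeta> (missing c) * chart_point b z (missing c) = 1"
    using chart_changeE[OF ch z(1)] by blast
  define \<mu> where "\<mu> = g * cnj g"
  have \<mu>: "\<mu> \<noteq> 0" using *(1) by (simp add: \<mu>_def)
  define n where "n v = chart_point b z v * cnj (chart_point b z v)" for v
  define W where "W = fs_norm z"
  have W: "W = (\<Sum>v\<in>rays. n v)" "W \<noteq> 0"
    by (simp_all add: W_def n_def fs_norm_chart[OF b, symmetric])
  have Y: "chart_point c (\<phi> z) v * cnj (chart_point c (\<phi> z) v) = \<mu> * n v" if "v \<in> rays" for v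
  proof -
    have "twist \<zeta> v * cnj (twist \<zeta> v) = 1"
      using norm_twist[OF *(2), of v] by (simp flip: complex_norm_square)
    moreover have "g * twist \<zeta> v * chart_point b z v * cnj (g * twist \<zeta> v * chart_point b z v)
        = \<mu> * (twist \<zeta> v * cnj (twist \<zeta> v)) * n v"
      unfolding \<mu>_def n_def by (simp add: mult_ac)
    ultimately show ?thesis using *(3)[OF that] by simp
  qed
  have W': "fs_norm (\<phi> z) = \<mu> * W"
    by (simp add: fs_norm_chart[OF c] Y W(1) sum_distrib_left)
  \<comment> \<open>Logarithmic derivatives of the coordinates of \<open>c\<close>, up to the factor
    \<open>1 / z $ k\<close>. They vanish at \<open>missing c\<close>, so sums over the coordinates
    of \<open>c\<close> extend to all rays.\<close>
  define e where "e v k = (of_bool (v = b k) - of_bool (missing c = b k) :: complex)" for v k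
  have J: "jacobian \<phi> z $ i $ k = chart_point c (\<phi> z) (c i) * e (c i) k / z $ k" for i k
    by (simp add: jacobian_chart_change[OF ch z] e_def chart_inj[OF c])
  have em: "e (missing c) k = 0" for k by (simp add: e_def)
  have cnj_e: "cnj (e v k) = e v k" for v k by (simp add: e_def)
  have znz: "z $ k \<noteq> 0" for k using z(2) by (simp add: torus_def)
  have nb: "n (b k) = z $ k * cnj (z $ k)" for k by (simp add: n_def chart_inj[OF b])
  let ?j = "\<lambda>k. of_bool (missing c = b k) :: complex"
  have S0: "(\<Sum>v\<in>rays. n v * of_bool (v = b k)) = n (b k)" for k
    using chart_in_rays[OF b, of k] by (simp add: of_bool_def if_distrib cong: if_cong)
  have S1: "(\<Sum>v\<in>rays. n v * e v k) = n (b k) - ?j k * W" for k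
    by (simp add: e_def right_diff_distrib sum_subtractf S0 W(1) sum_distrib_left mult.commute[of _ "?j k"])
  have S2: "(\<Sum>v\<in>rays. n v * e v l * e v m)
      = of_bool (l = m) * n (b l) - ?j m * n (b l) - ?j l * n (b m) + ?j l * ?j m * W"
  proof -
    have "(\<Sum>v\<in>rays. n v * e v l * e v m)
        = (\<Sum>v\<in>rays. of_bool (l = m) * (n v * of_bool (v = b l)) - ?j m * (n v * of_bool (v = b l))
          - ?j l * (n v * of_bool (v = b m)) + ?j l * ?j m * n v)"
      using chart_inj[OF b] by (intro sum.cong) (auto simp: e_def inj_eq)
    then show ?thesis
      by (simp only: sum.distrib sum_subtractf S0 W(1) flip: sum_distrib_left)
  qed
  have P: "(\<Sum>i\<in>UNIV. jacobian \<phi> z $ i $ l * cnj (jacobian \<phi> z $ i $ m))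
      = \<mu> * (\<Sum>v\<in>rays. n v * e v l * e v m) / (z $ l * cnj (z $ m))"
  proof -
    have "(\<Sum>i\<in>UNIV. jacobian \<phi> z $ i $ l * cnj (jacobian \<phi> z $ i $ m))
        = (\<Sum>i\<in>UNIV. \<mu> * (n (c i) * e (c i) l * e (c i) m) / (z $ l * cnj (z $ m)))"
      using Y[OF chart_in_rays[OF c]] by (intro sum.cong) (simp_all add: J cnj_e mult_ac)
    also have "\<dots> = (\<Sum>v\<in>rays. \<mu> * (n v * e v l * e v m) / (z $ l * cnj (z $ m)))"
      by (simp add: sum_rays_chart[OF c] em)
    finally show ?thesis by (simp only: sum_distrib_left sum_divide_distrib)
  qed
  have Q: "(\<Sum>i\<in>UNIV. cnj (\<phi> z $ i) * jacobian \<phi> z $ i $ k) = \<mu> * (n (b k) - ?j k * W) / z $ k" for k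
  proof -
    have "(\<Sum>i\<in>UNIV. cnj (\<phi> z $ i) * jacobian \<phi> z $ i $ k)
        = (\<Sum>i\<in>UNIV. \<mu> * (n (c i) * e (c i) k) / z $ k)"
      using Y[OF chart_in_rays[OF c]] by (intro sum.cong) (simp_all add: J chart_inj[OF c] mult_ac)
    also have "\<dots> = (\<Sum>v\<in>rays. \<mu> * (n v * e v k) / z $ k)"
      by (simp add: sum_rays_chart[OF c] em)
    also have "\<dots> = \<mu> * (\<Sum>v\<in>rays. n v * e v k) / z $ k"
      by (simp only: sum_distrib_left sum_divide_distrib)
    finally show ?thesis by (simp only: S1)
  qed
  have "cnj \<mu> = \<mu>" "cnj W = W" "\<And>k. cnj (n k) = n k"
    by (simp_all add: \<mu>_def W_def n_def mult.commute)
  then have "(transpose (jacobian \<phi> z) ** fubini_study (\<phi> z) **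
      (\<chi> i j. cnj (jacobian \<phi> z $ i $ j))) $ l $ m
    = \<mu> * (of_bool (l = m) * n (b l) - ?j m * n (b l) - ?j l * n (b m) + ?j l * ?j m * W)
        / (z $ l * cnj (z $ m)) * inverse (\<mu> * W)
      - \<mu> * (n (b l) - ?j l * W) / z $ l * (\<mu> * (n (b m) - ?j m * W) / cnj (z $ m)) * inverse (\<mu> * W) ^ 2"
    unfolding fubini_study_pullback P Q S2 W' by simp
  also have "\<dots> = (of_bool (l = m) * n (b l) / W - n (b l) * n (b m) / W\<^sup>2) / (z $ l * cnj (z $ m))"
  proof -
    have cancel: "\<mu> * A / (x * y) * inverse (\<mu> * W) - \<mu> * B / x * (\<mu> * C / y) * inverse (\<mu> * W) ^ 2
        = (A * W - B * C) / (W\<^sup>2 * (x * y))" for A B C x y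
      using \<mu> W(2) by (cases "x = 0 \<or> y = 0") (auto simp: field_simps power2_eq_square)
    \<comment> \<open>The indicators of \<open>missing c\<close> cancel, so the result no longer
      depends on \<open>c\<close>.\<close>
    have "(of_bool (l = m) * n (b l) - ?j m * n (b l) - ?j l * n (b m) + ?j l * ?j m * W) * W
        - (n (b l) - ?j l * W) * (n (b m) - ?j m * W) = of_bool (l = m) * n (b l) * W - n (b l) * n (b m)"
      by (simp only: ring_distribs) (simp add: mult_ac)
    then show ?thesis
      unfolding cancel using W(2) by (simp add: diff_divide_distrib power2_eq_square)
  qed
  also have "\<dots> = fubini_study z $ l $ m"
    using znz W(2) by (auto simp: fubini_study_nth W_def[symmetric] nb field_simps power2_eq_square)
  finally show ?thesis by simp
qed

lemma fubini_study_chart_change: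
  assumes ch: "chart_change quotient_fan b c U \<phi>" and z: "z \<in> U"
  shows "fubini_study z = transpose (jacobian \<phi> z) ** fubini_study (\<phi> z) **
    (\<chi> i j. cnj (jacobian \<phi> z $ i $ j))"
proof -
  have U: "open U" and hol: "holomorphic_map_on \<phi> U"
    using ch by (auto simp: chart_change_def)
  have FS: "isCont (\<lambda>w. fubini_study w $ i $ k) y" for i k and y :: "complex ^ 3"
    using fs_algebra_derivative[OF fubini_study_in_algebra[of i k]] has_derivative_continuous by blast
  have \<phi>: "isCont \<phi> z"
    using holomorphic_map_on_has_derivative(1)[OF hol z] has_derivative_continuous by blast
  have "fubini_study z $ l $ m = (transpose (jacobian \<phi> z) ** fubini_study (\<phi> z) **
      (\<chi> i j. cnj (jacobian \<phi> z $ i $ j))) $ l $ m" for l m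
  proof (rule eq_by_density[OF U z FS _ fubini_study_chart_change_torus[OF ch]])
    have "isCont (\<lambda>w. \<Sum>k\<in>UNIV. (\<Sum>i\<in>UNIV. jacobian \<phi> w $ i $ l * fubini_study (\<phi> w) $ i $ k)
        * cnj (jacobian \<phi> w $ k $ m)) z"
      by (intro continuous_sum continuous_mult isCont_jacobian[OF hol U z]
          isCont_o2[OF \<phi> FS] continuous_cnj)
    then show "isCont (\<lambda>w. (transpose (jacobian \<phi> w) ** fubini_study (\<phi> w) **
        (\<chi> i j. cnj (jacobian \<phi> w $ i $ j))) $ l $ m) z"
      by (simp add: matrix_matrix_mult_def transpose_def)
  qed
  then show ?thesis by (simp add: vec_eq_iff)
qed

lemma kahler_einstein_quotient_fan: "kahler_einstein quotient_fan"
  unfolding kahler_einstein_def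
proof (intro exI[of _ "\<lambda>_. fubini_study"] exI[of _ 4] conjI ballI allI impI)
  show "kahler_metric fubini_study" by (rule kahler_fubini_study)
  show "ricci fubini_study z $ j $ k = complex_of_real 4 * fubini_study z $ j $ k" for z :: "complex ^ 3" and j k
    by (simp add: ricci_fubini_study)
qed (rule fubini_study_chart_change)

section \<open>Determinants\<close>

lemma ndet_diagonal: "ndet m (\<lambda>j i. of_bool (j = i) * s i) = (\<Prod>i<m. s i)"
proof -
  have "(\<Prod>i<m. of_bool (i = p i) * s (p i)) = 0" if "p permutes {..<m}" "p \<noteq> id" for p
  proof -
    obtain i where "p i \<noteq> i" using \<open>p \<noteq> id\<close> by (auto simp: fun_eq_iff)
    moreover from this have "i < m" using permutes_not_in[OF that(1), of i] by auto
    ultimately show ?thesis by (intro prod_zero bexI[of _ i]) auto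
  qed
  then have "ndet m (\<lambda>j i. of_bool (j = i) * s i)
      = (\<Sum>p\<in>{id}. of_int (sign p) * (\<Prod>i<m. of_bool (i = p i) * s (p i)))"
    unfolding ndet_def
    by (intro sum.mono_neutral_right) (auto simp: finite_permutations permutes_id)
  then show ?thesis by (simp add: sign_id)
qed

lemma ndet_identical_rows:
  assumes "i < m" "j < m" "i \<noteq> j" and eq: "\<And>s. A i s = A j s"
  shows "ndet m A = 0"
proof -
  let ?\<tau> = "Transposition.transpose i j"
  let ?f = "\<lambda>p. of_int (sign p) * (\<Prod>r<m. A r (p r)) :: complex"
  have \<tau>: "?\<tau> permutes {..<m}" using assms by (intro permutes_swap_id) auto
  have A: "A (?\<tau> r) s = A r s" for r s
    using eq by (simp add: Transposition.transpose_def)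
  have "?f (p \<circ> ?\<tau>) = - ?f p" if p: "p \<in> {p. p permutes {..<m}}" for p
  proof -
    have "permutation p" "permutation ?\<tau>"
      using p \<tau> by (auto intro: permutation_permutes[THEN iffD2])
    then have "sign (p \<circ> ?\<tau>) = - sign p"
      using assms(3) by (simp add: sign_compose sign_swap_id)
    moreover have "(\<Prod>r<m. A r ((p \<circ> ?\<tau>) r)) = (\<Prod>r<m. A (?\<tau> r) (p (?\<tau> r)))"
      by (simp add: A)
    moreover have "\<dots> = (\<Prod>r<m. A r (p r))"
      by (rule prod.reindex_bij_betw[OF permutes_imp_bij[OF \<tau>]])
    ultimately show ?thesis by simp
  qed
  then have "ndet m A = - ndet m A"
    unfolding ndet_def sum_negf[symmetric]
    by (subst sum_permutations_compose_right[OF \<tau>]) (rule sum.cong[OF refl], simp)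
  then show ?thesis by simp
qed

lemma ndet_row_combination:
  assumes "k < m"
  shows "ndet m (A(k := \<lambda>s. \<Sum>r\<in>I. c r * B r s)) = (\<Sum>r\<in>I. c r * ndet m (A(k := B r)))"
proof -
  have split: "(\<Prod>i<m. (A(k := x)) i (p i)) = x (p k) * (\<Prod>i\<in>{..<m} - {k}. A i (p i))" for x p
  proof -
    have "(\<Prod>i<m. (A(k := x)) i (p i)) = (A(k := x)) k (p k) * (\<Prod>i\<in>{..<m} - {k}. (A(k := x)) i (p i))"
      using assms by (intro prod.remove) auto
    also have "(\<Prod>i\<in>{..<m} - {k}. (A(k := x)) i (p i)) = (\<Prod>i\<in>{..<m} - {k}. A i (p i))"
      by (intro prod.cong) auto
    finally show ?thesis by simp
  qed
  have "ndet m (A(k := \<lambda>s. \<Sum>r\<in>I. c r * B r s)) = (\<Sum>p | p permutes {..<m}. \<Sum>r\<in>I.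
      c r * (of_int (sign p) * (B r (p k) * (\<Prod>i\<in>{..<m} - {k}. A i (p i)))))"
    unfolding ndet_def split by (simp add: sum_distrib_left sum_distrib_right mult_ac)
  also have "\<dots> = (\<Sum>r\<in>I. \<Sum>p | p permutes {..<m}.
      c r * (of_int (sign p) * (B r (p k) * (\<Prod>i\<in>{..<m} - {k}. A i (p i)))))"
    by (rule sum.swap)
  finally show ?thesis unfolding ndet_def split by (simp only: sum_distrib_left)
qed

text \<open>Row \<open>k\<close> is replaced by the vanishing combination of all rows; by linearity
  in this row, every term except \<open>r = k\<close> has a repeated row.\<close>

lemma ndet_dependent_rows:
  assumes "\<And>s. (\<Sum>r<m. c r * A r s) = 0" "k < m" "c k \<noteq> 0"
  shows "ndet m A = 0"
proof -
  have "(\<Prod>i<m. (A(k := \<lambda>s. 0)) i (p i)) = 0" for p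
    using assms(2) by (intro prod_zero bexI[of _ k]) auto
  then have "0 = ndet m (A(k := \<lambda>s. 0))" by (simp only: ndet_def mult_zero_right sum.neutral_const)
  also have "\<dots> = (\<Sum>r<m. c r * ndet m (A(k := A r)))"
    using ndet_row_combination[OF assms(2), of A c A "{..<m}"] by (simp add: assms(1))
  also have "\<dots> = (\<Sum>r<m. if r = k then c k * ndet m A else 0)"
  proof (intro sum.cong refl)
    fix r assume "r \<in> {..<m}"
    then show "c r * ndet m (A(k := A r)) = (if r = k then c k * ndet m A else 0)"
      using ndet_identical_rows[of r m k "A(k := A r)"] assms(2) by auto
  qed
  also have "\<dots> = c k * ndet m A" using assms(2) by simp
  finally show ?thesis using assms(3) by simp
qed

section \<open>Sections over the Grassmannian\<close>

lemma grassmannian_sections_induct [consumes 1, case_names const mult add]: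
  assumes "R \<in> grassmannian_sections N n d"
    and "\<And>c. P 0 (\<lambda>A. c)"
    and "\<And>J d g. (\<forall>s\<le>n. J s \<le> N) \<Longrightarrow> P d g \<Longrightarrow>
      P (Suc d) (\<lambda>A. ndet (Suc n) (\<lambda>r s. A r (J s)) * g A)"
    and "\<And>d f g. P d f \<Longrightarrow> P d g \<Longrightarrow> P d (\<lambda>A. f A + g A)"
  shows "P d R"
proof -
  have "(d, f) \<in> forms_graded (plucker_coordinates N n) \<Longrightarrow> P d f" for d f
  proof (induction rule: forms_graded.induct)
    case (mult f d g)
    then obtain J where "f = (\<lambda>A. ndet (Suc n) (\<lambda>r s. A r (J s)))" "\<forall>s\<le>n. J s \<le> N"
      unfolding plucker_coordinates_def by blast
    then show ?case using assms(3)[of J d g] mult.IH by simp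
  qed (auto intro: assms)
  then show ?thesis using assms(1) by (simp add: grassmannian_sections_def forms_def)
qed

lemma section_row_scaling:
  assumes "R \<in> grassmannian_sections N n d"
  shows "R (\<lambda>r i. c r * A r i) = (\<Prod>r\<le>n. c r) ^ d * R A"
  using assms
proof (induction rule: grassmannian_sections_induct)
  case (mult J d g)
  have "ndet (Suc n) (\<lambda>r s. c r * A r (J s)) = (\<Prod>r\<le>n. c r) * ndet (Suc n) (\<lambda>r s. A r (J s))"
    by (simp add: ndet_def prod.distrib sum_distrib_left mult.left_commute lessThan_Suc_atMost)
  then show ?case using mult by simp
qed (simp_all add: distrib_left)

lemma section_cong:
  assumes "R \<in> grassmannian_sections N n d" "\<And>r i. i \<le> N \<Longrightarrow> A r i = B r i"
  shows "R A = R B"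
  using assms(1)
proof (induction rule: grassmannian_sections_induct)
  case (mult J d g)
  have "(\<Prod>i<Suc n. A i (J (p i))) = (\<Prod>i<Suc n. B i (J (p i)))" if "p permutes {..<Suc n}" for p
  proof (intro prod.cong refl)
    fix i assume "i \<in> {..<Suc n}"
    then have "p i \<le> n" using permutes_in_image[OF that, of i] by auto
    then show "A i (J (p i)) = B i (J (p i))" using mult.hyps by (intro assms(2)) auto
  qed
  then have "ndet (Suc n) (\<lambda>r s. A r (J s)) = ndet (Suc n) (\<lambda>r s. B r (J s))"
    unfolding ndet_def by (intro sum.cong) auto
  then show ?case using mult.IH by simp
qed simp_all

text \<open>A Chow form is prescribed on independent forms only, but a pencil of matrices may pass
  through dependent ones. There all Pluecker coordinates vanish, hence every section of positive
  degree.\<close>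

lemma section_dependent_forms:
  assumes "R \<in> grassmannian_sections N n d" "d > 0" "\<not> independent_forms N n A"
  shows "R A = 0"
proof -
  obtain c k where c: "\<And>i. i \<le> N \<Longrightarrow> (\<Sum>r\<le>n. c r * A r i) = 0" "k \<le> n" "c k \<noteq> 0"
    using assms(3) unfolding independent_forms_def by blast
  have "ndet (Suc n) (\<lambda>r s. A r (J s)) = 0" if "\<forall>s\<le>n. J s \<le> N" for J
  proof -
    \<comment> \<open>The determinant does not see \<open>J\<close> beyond \<open>n\<close>; these
      values are reset because the relation between the rows is known only in columns up to
      \<open>N\<close>.\<close>
    define J' where "J' s = (if s \<le> n then J s else 0)" for s
    have "(\<Prod>i<Suc n. A i (J (p i))) = (\<Prod>i<Suc n. A i (J' (p i)))" if "p permutes {..<Suc n}" for p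
      using permutes_in_image[OF that] by (intro prod.cong) (auto simp: J'_def less_Suc_eq_le)
    then have "ndet (Suc n) (\<lambda>r s. A r (J s)) = ndet (Suc n) (\<lambda>r s. A r (J' s))"
      unfolding ndet_def by (intro sum.cong) auto
    also have "\<dots> = 0"
      using c that by (intro ndet_dependent_rows[where c = c and k = k]) (auto simp: J'_def lessThan_Suc_atMost)
    finally show ?thesis .
  qed
  then have "d > 0 \<longrightarrow> R A = 0"
    by (induction rule: grassmannian_sections_induct[OF assms(1)]) auto
  then show ?thesis using assms(2) by simp
qed

lemma section_degree_0:
  assumes "R \<in> grassmannian_sections N n 0"
  shows "R A = R B"
proof -
  have "d = 0 \<longrightarrow> R A = R B" if "R \<in> grassmannian_sections N n d" for d
    using that by (induction rule: grassmannian_sections_induct) auto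
  then show ?thesis using assms by blast
qed

text \<open>Polynomial functions of two variables, represented by polynomials in the second variable
  over polynomials in the first.\<close>

definition bipolynomial :: "(complex \<Rightarrow> complex \<Rightarrow> complex) \<Rightarrow> bool" where
  "bipolynomial F \<longleftrightarrow> (\<exists>Q. \<forall>x t. F x t = poly (poly Q [:t:]) x)"

lemma bipolynomialI: "(\<And>x t. F x t = poly (poly Q [:t:]) x) \<Longrightarrow> bipolynomial F"
  unfolding bipolynomial_def by blast

lemma bipolynomial_const: "bipolynomial (\<lambda>x t. c)"
  by (rule bipolynomialI[of _ "[:[:c:]:]"]) simp

lemma bipolynomial_fst: "bipolynomial (\<lambda>x t. x)"
  by (rule bipolynomialI[of _ "[:[:0, 1:]:]"]) simp

lemma bipolynomial_snd: "bipolynomial (\<lambda>x t. t)"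
  by (rule bipolynomialI[of _ "[:0, 1:]"]) simp

lemma bipolynomial_add:
  assumes "bipolynomial F" "bipolynomial G"
  shows "bipolynomial (\<lambda>x t. F x t + G x t)"
proof -
  obtain P Q where "\<forall>x t. F x t = poly (poly P [:t:]) x" "\<forall>x t. G x t = poly (poly Q [:t:]) x"
    using assms unfolding bipolynomial_def by blast
  then show ?thesis by (intro bipolynomialI[of _ "P + Q"]) simp
qed

lemma bipolynomial_mult:
  assumes "bipolynomial F" "bipolynomial G"
  shows "bipolynomial (\<lambda>x t. F x t * G x t)"
proof -
  obtain P Q where "\<forall>x t. F x t = poly (poly P [:t:]) x" "\<forall>x t. G x t = poly (poly Q [:t:]) x"
    using assms unfolding bipolynomial_def by blast
  then show ?thesis by (intro bipolynomialI[of _ "P * Q"]) simp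
qed

lemma bipolynomial_sum:
  assumes "finite I" "\<And>i. i \<in> I \<Longrightarrow> bipolynomial (F i)"
  shows "bipolynomial (\<lambda>x t. \<Sum>i\<in>I. F i x t)"
  using assms
  by (induction I rule: finite_induct) (simp_all add: bipolynomial_const bipolynomial_add)

lemma bipolynomial_prod:
  assumes "finite I" "\<And>i. i \<in> I \<Longrightarrow> bipolynomial (F i)"
  shows "bipolynomial (\<lambda>x t. \<Prod>i\<in>I. F i x t)"
  using assms
  by (induction I rule: finite_induct) (simp_all add: bipolynomial_const bipolynomial_mult)

lemma bipolynomial_power: "bipolynomial F \<Longrightarrow> bipolynomial (\<lambda>x t. F x t ^ k)"
  by (induction k) (simp_all add: bipolynomial_const bipolynomial_mult)

lemma section_bipolynomial:
  assumes "R \<in> grassmannian_sections N n d" "\<And>r i. bipolynomial (\<lambda>x t. M x t r i)"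
  shows "bipolynomial (\<lambda>x t. R (M x t))"
  using assms(1)
proof (induction rule: grassmannian_sections_induct)
  case (mult J d g)
  have "bipolynomial (\<lambda>x t. ndet (Suc n) (\<lambda>r s. M x t r (J s)))"
    unfolding ndet_def
    by (intro bipolynomial_sum bipolynomial_mult bipolynomial_const bipolynomial_prod assms(2))
      (simp_all add: finite_permutations)
  then show ?case using mult.IH by (rule bipolynomial_mult)
qed (simp_all add: bipolynomial_const bipolynomial_add)

text \<open>Once the power of the variable is split off, no root is left, so by the fundamental
  theorem of algebra the cofactor is constant.\<close>

lemma poly_no_nonzero_root:
  fixes p :: "complex poly"
  assumes "p \<noteq> 0" "\<And>t. t \<noteq> 0 \<Longrightarrow> poly p t \<noteq> 0"
  obtains c k where "p = monom c k"
proof -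
  obtain q where q: "p = [:- 0, 1:] ^ order 0 p * q" "\<not> [:- 0, 1:] dvd q"
    using order_decomp[OF assms(1), of 0] by blast
  have "poly q t \<noteq> 0" for t
  proof (cases "t = 0")
    case True
    then show ?thesis using q(2) by (simp add: poly_eq_0_iff_dvd)
  next
    case False
    then show ?thesis using assms(2)[OF False] by (subst (asm) q(1)) auto
  qed
  then have "constant (poly q)" using fundamental_theorem_of_algebra by blast
  then have "degree q = 0" by (simp add: constant_degree)
  then obtain c where "q = [:c:]" by (rule degree_eq_zeroE)
  then have "p = monom c (order 0 p)"
    by (subst q(1)) (simp add: monom_altdef)
  then show thesis by (rule that)
qed

text \<open>For every \<open>x\<close> the polynomial \<open>F x\<close> is a monomial. The exponent does not jump, since
  the product of two distinct coefficients vanishes identically.\<close>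

lemma bipolynomial_semi_invariant:
  assumes F: "bipolynomial F"
    and zero: "\<And>x t. t \<noteq> 0 \<Longrightarrow> F x t = 0 \<longleftrightarrow> F x 1 = 0"
    and one: "\<And>t. F 1 t = t ^ m * F 1 1" "F 1 1 \<noteq> 0"
  shows "F x t = t ^ m * F x 1"
proof -
  obtain Q where Q: "\<And>x t. F x t = poly (poly Q [:t:]) x"
    using F unfolding bipolynomial_def by blast
  define p where "p x = map_poly (\<lambda>c. poly c x) Q" for x
  have coeff_p: "coeff (p x) k = poly (coeff Q k) x" for x k
    by (simp add: p_def coeff_map_poly)
  have Fp: "F x t = poly (p x) t" for x t
  proof -
    have "poly (poly Q [:t:]) x = (\<Sum>k\<le>degree Q. poly (coeff Q k) x * t ^ k)"
      by (simp add: poly_altdef[of Q] poly_sum)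
    also have "\<dots> = (\<Sum>k\<le>degree (p x). coeff (p x) k * t ^ k)"
    proof -
      have "degree (p x) \<le> degree Q"
        by (intro degree_le allI impI) (simp add: coeff_p coeff_eq_0)
      then show ?thesis unfolding coeff_p[symmetric]
        by (intro sum.mono_neutral_right) (auto simp: coeff_eq_0)
    qed
    finally show ?thesis by (simp add: Q poly_altdef[of "p x"])
  qed
  have single: "coeff (p x) j = 0 \<or> coeff (p x) k = 0" if "j \<noteq> k" for x j k
  proof (cases "p x = 0")
    case False
    \<comment> \<open>By \<open>zero\<close>, a single nonzero root would make every nonzero number
      a root.\<close>
    have "poly (p x) t \<noteq> 0" if t: "t \<noteq> 0" for t
    proof
      assume "poly (p x) t = 0"
      then have "poly (p x) u = 0" if "u \<noteq> 0" for u
        using zero[OF t, of x] zero[OF that, of x] by (simp add: Fp)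
      then have "UNIV - {0} \<subseteq> {u. poly (p x) u = 0}" by auto
      moreover have "infinite (UNIV - {0 :: complex})"
        by (simp add: infinite_UNIV_char_0)
      ultimately have "infinite {u. poly (p x) u = 0}" by (metis finite_subset)
      then show False using poly_roots_finite[OF False] by blast
    qed
    then obtain c l where "p x = monom c l" by (rule poly_no_nonzero_root[OF False])
    then show ?thesis using that by auto
  qed simp
  have "coeff Q j = 0 \<or> coeff Q k = 0" if "j \<noteq> k" for j k
  proof -
    have "poly (coeff Q j * coeff Q k) x = 0" for x
      using single[OF that, of x] by (auto simp: coeff_p)
    then have "coeff Q j * coeff Q k = 0" using poly_all_0_iff_0 by blast
    then show ?thesis by simp
  qed
  moreover have "Q \<noteq> 0" using one(2) by (auto simp: Q)
  ultimately have only: "coeff Q k = 0" if "k \<noteq> degree Q" for k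
    using that leading_coeff_0_iff by blast
  let ?q = "coeff Q (degree Q)"
  have "F x t = (\<Sum>k\<le>degree Q. poly (coeff Q k) x * t ^ k)" for x t
    by (simp add: Q poly_altdef[of Q] poly_sum)
  also have "(\<Sum>k\<le>degree Q. poly (coeff Q k) x * t ^ k) = (\<Sum>k\<in>{degree Q}. poly (coeff Q k) x * t ^ k)" for x t
    using only by (intro sum.mono_neutral_right) auto
  finally have mono: "F x t = poly ?q x * t ^ degree Q" for x t by simp
  have "F 1 1 * 2 ^ degree Q = 2 ^ m * F 1 1"
    using one(1)[of 2] by (simp add: mono)
  then have "(2 :: complex) ^ degree Q = 2 ^ m" using one(2) by simp
  then have "norm ((2 :: complex) ^ degree Q) = norm ((2 :: complex) ^ m)" by simp
  then have "degree Q = m" by (simp add: norm_power)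
  then show ?thesis by (simp add: mono)
qed

section \<open>Chow instability\<close>

definition weight :: "(int ^ 3 \<Rightarrow> nat) \<Rightarrow> nat" where
  "weight \<alpha> = \<alpha> r2 + \<alpha> r3"

text \<open>The sum runs over the lattice points of the moment polytope. Its positivity says that
  their barycenter is not the barycenter of the polytope, where the weight is 4.\<close>

lemma sum_weight: "(\<Sum>\<alpha>\<in>exponents. weight \<alpha>) < 4 * card exponents"
proof -
  define T where "T = [(m0, m1, m2, m3). m0 \<leftarrow> [0..<9], m1 \<leftarrow> [0..<9], m2 \<leftarrow> [0..<9], m3 \<leftarrow> [0..<9],
    m0 + m1 + m2 + m3 = 8 \<and> m2 mod 4 = m3 mod 4]"
  have T: "(m0, m1, m2, m3) \<in> set T \<longleftrightarrow> m0 + m1 + m2 + m3 = 8 \<and> m2 mod 4 = m3 mod 4" for m0 m1 m2 m3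
    by (auto simp: T_def)
  let ?E = "\<lambda>(m0, m1, m2, m3). expo m0 m1 m2 m3"
  have dist: "distinct T" and card: "length T = 45" and sum: "sum_list (map (\<lambda>(m0, m1, m2, m3). m2 + m3) T) = 168"
    unfolding T_def by code_simp+
  have inj: "inj_on ?E (set T)"
  proof (rule inj_onI)
    fix m n assume eq: "?E m = ?E n"
    obtain m0 m1 m2 m3 n0 n1 n2 n3 where "m = (m0, m1, m2, m3)" "n = (n0, n1, n2, n3)"
      by (metis prod_cases4)
    then show "m = n"
      using fun_cong[OF eq, of r0] fun_cong[OF eq, of r1] fun_cong[OF eq, of r2] fun_cong[OF eq, of r3]
      by simp
  qed
  have "exponents = ?E ` set T"
  proof
    show "?E ` set T \<subseteq> exponents" by (auto simp: expo_in_exponents T)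
    show "exponents \<subseteq> ?E ` set T"
    proof
      fix \<alpha> assume \<alpha>: "\<alpha> \<in> exponents"
      then have "\<alpha> = ?E (\<alpha> r0, \<alpha> r1, \<alpha> r2, \<alpha> r3)"
        by (auto simp: expo_def exponents_def rays_def fun_eq_iff)
      moreover have "\<alpha> r0 + \<alpha> r1 + \<alpha> r2 + \<alpha> r3 = 8" "\<alpha> r2 mod 4 = \<alpha> r3 mod 4"
        using \<alpha> by (auto simp: exponents_def sum_rays)
      then have "(\<alpha> r0, \<alpha> r1, \<alpha> r2, \<alpha> r3) \<in> set T" by (simp add: T)
      ultimately show "\<alpha> \<in> ?E ` set T" by (rule image_eqI)
    qed
  qed
  moreover have "card (?E ` set T) = 45"
    by (simp only: card_image[OF inj] distinct_card[OF dist] card)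
  moreover have "(\<Sum>\<alpha>\<in>?E ` set T. weight \<alpha>) = 168"
  proof -
    have "weight (?E m) = (\<lambda>(m0, m1, m2, m3). m2 + m3) m" for m
      by (simp add: weight_def split: prod.split)
    then show ?thesis
      by (simp only: sum.reindex[OF inj] comp_def sum.distinct_set_conv_list[OF dist] sum)
  qed
  ultimately show ?thesis by simp
qed

locale exponents_enumeration =
  fixes N :: nat and e :: "nat \<Rightarrow> int ^ 3 \<Rightarrow> nat"
  assumes e: "bij_betw e {..N} exponents"
begin

section \<open>The image cone and its one-parameter symmetry\<close>

abbreviation image_cone :: "(nat \<Rightarrow> complex) set" where
  "image_cone \<equiv> kodaira_image quotient_fan N (\<lambda>i. monomial_section (e i))"

abbreviation scaled :: "complex \<Rightarrow> (nat \<Rightarrow> nat \<Rightarrow> complex) \<Rightarrow> nat \<Rightarrow> nat \<Rightarrow> complex" where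
  "scaled t A \<equiv> \<lambda>r i. A r i * t ^ weight (e i)"

lemma e_in: "i \<le> N \<Longrightarrow> e i \<in> exponents"
  using e by (auto simp: bij_betw_def)

text \<open>Frees the cone from charts: any Cox vector with a nonzero coordinate \<open>X v\<close>
  can be moved to the chart that misses \<open>v\<close>, and the factor \<open>X v ^ 8\<close> is
  absorbed into the scalar.\<close>

lemma image_coneI:
  assumes "c \<noteq> 0" "v \<in> rays" "X v \<noteq> 0"
  shows "(\<lambda>i. if i \<le> N then c * monomial (e i) X else 0) \<in> image_cone"
proof -
  obtain b where b: "b \<in> charts quotient_fan" "missing b = v"
    using chart_missing_exists[OF assms(2)] by blast
  have "monomial (e i) X = X v ^ 8 * monomial_section (e i) b (affine_point b X)" if "i \<le> N" for i
  proof -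
    have "monomial (e i) X = monomial (e i) (\<lambda>u. X v * chart_point b (affine_point b X) u)"
      using assms(3) b by (intro monomial_cong) (simp add: chart_point_affine_point)
    then show ?thesis
      using b by (simp add: monomial_mult monomial_const[OF e_in[OF that]] monomial_section_def)
  qed
  then have "(\<lambda>i. if i \<le> N then c * monomial (e i) X else 0)
      = (\<lambda>i. if i \<le> N then (c * X v ^ 8) * monomial_section (e i) b (affine_point b X) else 0)"
    by auto
  then show ?thesis
    unfolding kodaira_image_def using assms b(1)
    by (auto intro!: exI[of _ b] exI[of _ "affine_point b X"] exI[of _ "c * X v ^ 8"])
qed

lemma image_coneE:
  assumes "p \<in> image_cone"
  obtains c v X where "c \<noteq> 0" "v \<in> rays" "X v \<noteq> 0"
    "p = (\<lambda>i. if i \<le> N then c * monomial (e i) X else 0)"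
proof -
  obtain b z c where "b \<in> charts quotient_fan" "c \<noteq> 0"
    "p = (\<lambda>i. if i \<le> N then c * monomial_section (e i) b z else 0)"
    using assms unfolding kodaira_image_def by blast
  then show thesis
    using that[of c "missing b" "chart_point b z"] missing_rays
    by (simp add: monomial_section_def cong: if_cong)
qed

text \<open>Multiplying each monomial by \<open>t\<close> to its weight is the effect of multiplying
  the Cox coordinates at \<open>r2\<close> and \<open>r3\<close> by \<open>t\<close>. A common point
  for the scaled forms is thus moved to a common point for \<open>A\<close>, again in the
  image.\<close>

lemma meets_scaled_imp:
  assumes "t \<noteq> 0" "subspace_meets N 3 (scaled t A) image_cone"
  shows "subspace_meets N 3 A image_cone"
proof -
  obtain p where p: "p \<in> image_cone" "\<forall>r\<le>3. (\<Sum>i\<le>N. scaled t A r i * p i) = 0"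
    using assms(2) unfolding subspace_meets_def by blast
  obtain c v X where X: "c \<noteq> 0" "v \<in> rays" "X v \<noteq> 0"
    and p_eq: "p = (\<lambda>i. if i \<le> N then c * monomial (e i) X else 0)"
    by (rule image_coneE[OF p(1)])
  define \<tau> where "\<tau> u = (if u \<in> {r2, r3} then t else 1)" for u
  have \<tau>: "monomial \<alpha> \<tau> = t ^ weight \<alpha>" for \<alpha>
    by (simp add: monomial_def prod_rays \<tau>_def weight_def power_add)
  let ?p = "\<lambda>i. if i \<le> N then c * monomial (e i) (\<lambda>u. \<tau> u * X u) else 0"
  have mem: "?p \<in> image_cone"
    using X assms(1) by (intro image_coneI[of c v]) (auto simp: \<tau>_def)
  have sums: "(\<Sum>i\<le>N. A r i * ?p i) = (\<Sum>i\<le>N. scaled t A r i * p i)" for r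
    unfolding p_eq by (intro sum.cong) (auto simp: monomial_mult \<tau>)
  show ?thesis unfolding subspace_meets_def
  proof (rule bexI[OF _ mem], intro allI impI)
    fix r :: nat assume "r \<le> 3"
    then show "(\<Sum>i\<le>N. A r i * ?p i) = 0" unfolding sums using p(2) by simp
  qed
qed

lemma scaled_inverse:
  assumes "t \<noteq> 0"
  shows "scaled (inverse t) (scaled t A) = A"
  using assms by (simp add: fun_eq_iff power_inverse)

lemma meets_scaled:
  assumes "t \<noteq> 0"
  shows "subspace_meets N 3 (scaled t A) image_cone \<longleftrightarrow> subspace_meets N 3 A image_cone"
  using meets_scaled_imp[OF assms, of A] meets_scaled_imp[of "inverse t" "scaled t A"] assms
  unfolding scaled_inverse[OF assms] by auto

lemma independent_scaled:
  assumes "t \<noteq> 0"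
  shows "independent_forms N n (scaled t A) \<longleftrightarrow> independent_forms N n A"
proof -
  have "(\<Sum>r\<le>n. c r * (A r i * t ^ weight (e i))) = (\<Sum>r\<le>n. c r * A r i) * t ^ weight (e i)" for c i
    by (simp add: sum_distrib_right mult.assoc)
  then show ?thesis using assms by (simp add: independent_forms_def)
qed

text \<open>Linear forms that are single coordinates: on the image cone the r-th one is the monomial
  with exponent \<open>\<gamma> r\<close>.\<close>

definition rows :: "(nat \<Rightarrow> int ^ 3 \<Rightarrow> nat) \<Rightarrow> nat \<Rightarrow> nat \<Rightarrow> complex" where
  "rows \<gamma> r i = of_bool (e i = \<gamma> r)"

lemma sum_rows:
  assumes "\<gamma> r \<in> exponents"
  shows "(\<Sum>i\<le>N. rows \<gamma> r i * (if i \<le> N then c * monomial (e i) X else 0)) = c * monomial (\<gamma> r) X"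
proof -
  have "(\<Sum>i\<le>N. rows \<gamma> r i * (if i \<le> N then c * monomial (e i) X else 0))
      = (\<Sum>i\<le>N. if e i = \<gamma> r then c * monomial (e i) X else 0)"
    by (intro sum.cong) (auto simp: rows_def)
  also have "\<dots> = (\<Sum>\<alpha>\<in>exponents. if \<alpha> = \<gamma> r then c * monomial \<alpha> X else 0)"
    by (rule sum.reindex_bij_betw[OF e])
  finally show ?thesis using assms finite_exponents by simp
qed

lemma independent_rows:
  assumes "inj_on \<gamma> {..n}" "\<gamma> ` {..n} \<subseteq> exponents"
  shows "independent_forms N n (rows \<gamma>)"
  unfolding independent_forms_def
proof (intro allI impI)
  fix c r assume c: "\<forall>i\<le>N. (\<Sum>r\<le>n. c r * rows \<gamma> r i) = 0" and r: "r \<le> n"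
  then have "\<gamma> r \<in> e ` {..N}" using assms(2) e by (auto simp: bij_betw_def)
  then obtain i where i: "i \<le> N" "\<gamma> r = e i" by auto
  have "(\<Sum>k\<le>n. c k * rows \<gamma> k i) = (\<Sum>k\<le>n. if k = r then c k else 0)"
    using assms(1) r by (intro sum.cong) (auto simp: rows_def i(2)[symmetric] inj_on_eq_iff)
  then show "c r = 0" using c i(1) r by simp
qed

definition vertex :: "nat \<Rightarrow> int ^ 3 \<Rightarrow> nat" where
  "vertex r = [expo 8 0 0 0, expo 0 8 0 0, expo 0 0 8 0, expo 0 0 0 8] ! r"

lemma le_3_iff: "r \<le> 3 \<longleftrightarrow> r = 0 \<or> r = 1 \<or> r = 2 \<or> r = (3 :: nat)"
  by auto

lemma vertex_simps [simp]:
  "vertex 0 = expo 8 0 0 0" "vertex (Suc 0) = expo 0 8 0 0"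
  "vertex 2 = expo 0 0 8 0" "vertex 3 = expo 0 0 0 8"
  by (simp_all add: vertex_def)

lemma expo_eq_iff [simp]:
  "expo m0 m1 m2 m3 = expo n0 n1 n2 n3 \<longleftrightarrow> m0 = n0 \<and> m1 = n1 \<and> m2 = n2 \<and> m3 = n3"
  by (metis expo_simps)

lemma independent_vertex_rows: "independent_forms N 3 (rows vertex)"
  by (intro independent_rows) (auto simp: inj_on_def le_3_iff expo_in_exponents)

lemma vertex_rows_not_meet: "\<not> subspace_meets N 3 (rows vertex) image_cone"
proof
  assume "subspace_meets N 3 (rows vertex) image_cone"
  then obtain p where p: "p \<in> image_cone" "\<And>r. r \<le> 3 \<Longrightarrow> (\<Sum>i\<le>N. rows vertex r i * p i) = 0"
    unfolding subspace_meets_def by blast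
  obtain c v X where X: "c \<noteq> 0" "v \<in> rays" "X v \<noteq> 0"
    and p_eq: "p = (\<lambda>i. if i \<le> N then c * monomial (e i) X else 0)"
    by (rule image_coneE[OF p(1)])
  have "monomial (vertex r) X = 0" if "r \<le> 3" for r
  proof -
    have "vertex r \<in> exponents" using that by (auto simp: le_3_iff expo_in_exponents)
    then show ?thesis using p(2)[OF that] X(1) unfolding p_eq by (simp only: sum_rows mult_eq_0_iff) simp
  qed
  from this[of 0] this[of 1] this[of 2] this[of 3] show False
    using X(2,3) by (auto simp: monomial_expo rays_def)
qed

text \<open>Forms that vanish at the torus fixed point with \<open>X r0\<close> as its only nonzero coordinate.\<close>

lemma ex_independent_meeting: "\<exists>A. independent_forms N 3 A \<and> subspace_meets N 3 A image_cone"
proof -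
  \<comment> \<open>The vertex that does not vanish at this fixed point is replaced by the exponent
    \<open>expo 4 4 0 0\<close>, which also involves \<open>r1\<close>.\<close>
  define \<gamma> where "\<gamma> r = [expo 4 4 0 0, expo 0 8 0 0, expo 0 0 8 0, expo 0 0 0 8] ! r" for r
  have \<gamma>: "\<gamma> 0 = expo 4 4 0 0" "\<gamma> (Suc 0) = expo 0 8 0 0" "\<gamma> 2 = expo 0 0 8 0" "\<gamma> 3 = expo 0 0 0 8"
    by (simp_all add: \<gamma>_def)
  have \<gamma>_in: "\<gamma> r \<in> exponents" if "r \<le> 3" for r
    using that by (auto simp: le_3_iff \<gamma> expo_in_exponents)
  define X :: "int ^ 3 \<Rightarrow> complex" where "X v = of_bool (v = r0)" for v
  have "independent_forms N 3 (rows \<gamma>)"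
    using \<gamma>_in by (intro independent_rows) (auto simp: inj_on_def le_3_iff \<gamma>)
  moreover have "subspace_meets N 3 (rows \<gamma>) image_cone"
    unfolding subspace_meets_def
  proof (intro bexI allI impI)
    show "(\<lambda>i. if i \<le> N then 1 * monomial (e i) X else 0) \<in> image_cone"
      by (rule image_coneI[of _ r0]) (simp_all add: X_def)
    fix r :: nat assume r: "r \<le> 3"
    have "monomial (\<gamma> r) X = 0" using r by (auto simp: le_3_iff \<gamma> monomial_expo X_def)
    then show "(\<Sum>i\<le>N. rows \<gamma> r i * (if i \<le> N then 1 * monomial (e i) X else 0)) = 0"
      by (simp only: sum_rows[of \<gamma> r, OF \<gamma>_in[OF r]] mult_zero_right)
  qed
  ultimately show ?thesis by blast
qed

text \<open>The one-parameter subgroup preserves the image of \<open>X\<close>, so it acts on a Chow form by a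
  character. The character is read off at the four forms cutting out the empty set that are
  eigenvectors, the eighth powers of the Cox coordinates.\<close>

lemma section_scaled:
  assumes R: "R \<in> grassmannian_sections N 3 d" and "d > 0"
    and zero: "\<And>A. independent_forms N 3 A \<Longrightarrow> R A = 0 \<longleftrightarrow> subspace_meets N 3 A image_cone"
  shows "R (scaled t A) = t ^ (16 * d) * R A"
proof -
  let ?V = "rows vertex"
  have RV: "R ?V \<noteq> 0"
    using zero[OF independent_vertex_rows] vertex_rows_not_meet by simp
  \<comment> \<open>On independent forms this is invariance of the image; on dependent ones both
    sides vanish.\<close>
  have scaled_zero: "R (scaled t A) = 0 \<longleftrightarrow> R A = 0" if "t \<noteq> 0" for t A
  proof (cases "independent_forms N 3 A")
    case True
    then show ?thesis using that by (simp add: zero independent_scaled meets_scaled)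
  next
    case False
    then show ?thesis using section_dependent_forms[OF R \<open>d > 0\<close>] independent_scaled[OF that] by simp
  qed
  have RVt: "R (scaled t ?V) = t ^ (16 * d) * R ?V" for t
  proof -
    have "scaled t ?V = (\<lambda>r i. t ^ weight (vertex r) * ?V r i)"
    proof (intro ext)
      fix r i
      show "scaled t ?V r i = t ^ weight (vertex r) * ?V r i"
        by (cases "e i = vertex r") (simp_all add: rows_def)
    qed
    then have "R (scaled t ?V) = (\<Prod>r\<le>3. t ^ weight (vertex r)) ^ d * R ?V"
      by (simp only: section_row_scaling[OF R])
    also have "(\<Prod>r\<le>3. t ^ weight (vertex r)) = t ^ 16"
      by (simp add: numeral_3_eq_3 vertex_def weight_def flip: power_add)
    finally show ?thesis by (simp add: power_mult)
  qed
  \<comment> \<open>The pencil runs from \<open>A\<close> at \<open>x = 0\<close> to the four octics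
    at \<open>x = 1\<close>, where the exponent of \<open>t\<close> is known.\<close>
  define F where "F x t = R (scaled t (\<lambda>r i. A r i + x * (?V r i - A r i)))" for x t
  have scaled_1: "scaled 1 B = B" for B by simp
  have F1: "F 1 t = R (scaled t ?V)" for t by (simp add: F_def)
  have "F 0 t = t ^ (16 * d) * F 0 1"
  proof (rule bipolynomial_semi_invariant)
    show "bipolynomial F" unfolding F_def[abs_def]
      by (intro section_bipolynomial[OF R] bipolynomial_mult bipolynomial_add bipolynomial_const
          bipolynomial_fst bipolynomial_power bipolynomial_snd)
    show "F x t = 0 \<longleftrightarrow> F x 1 = 0" if "t \<noteq> 0" for x t
      using scaled_zero[OF that] by (simp add: F_def)
    show "F 1 t = t ^ (16 * d) * F 1 1" for t
      unfolding F1 RVt scaled_1 by simp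
    show "F 1 1 \<noteq> 0" unfolding F1 scaled_1 by (rule RV)
  qed
  then show ?thesis by (simp add: F_def)
qed

text \<open>Normalizing the subgroup to determinant 1 would take a root of order
  \<open>Suc N\<close> of \<open>t ^ L\<close>; putting \<open>t = u ^ Suc N\<close> keeps all
  exponents integral. The resulting exponent \<open>k\<close> of \<open>u\<close> is positive
  because the average weight is below 4.\<close>

lemma orbit_element:
  assumes R: "R \<in> grassmannian_sections N 3 d" "d > 0"
    and zero: "\<And>A. independent_forms N 3 A \<Longrightarrow> R A = 0 \<longleftrightarrow> subspace_meets N 3 A image_cone"
  shows "\<exists>k>0. \<forall>u. u \<noteq> 0 \<longrightarrow> (\<lambda>A. u ^ k * R A) \<in> SL_orbit N R"
proof -
  define L where "L = (\<Sum>i\<le>N. weight (e i))"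
  have L: "L = (\<Sum>\<alpha>\<in>exponents. weight \<alpha>)"
    unfolding L_def by (rule sum.reindex_bij_betw[OF e])
  have card: "card exponents = Suc N"
    using bij_betw_same_card[OF e] by simp
  \<comment> \<open>The first term is the eigenvalue exponent \<open>16 * d\<close> at
    \<open>t = u ^ Suc N\<close>. The second comes from four rows divided by \<open>u ^ L\<close>,
    in degree \<open>d\<close>.\<close>
  define k where "k = 16 * d * Suc N - 4 * d * L"
  have less: "L < 4 * Suc N" using sum_weight by (simp only: L card)
  then have "4 * d * L < 4 * d * (4 * Suc N)"
    using \<open>d > 0\<close> by (intro mult_strict_left_mono) auto
  moreover have "4 * d * (4 * Suc N) = 16 * d * Suc N" by (simp add: algebra_simps)
  ultimately have "4 * d * L < 16 * d * Suc N" by (simp only:)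
  then have k: "k > 0" "16 * d * Suc N = k + 4 * d * L" by (simp_all add: k_def)
  have "(\<lambda>A. u ^ k * R A) \<in> SL_orbit N R" if u: "u \<noteq> 0" for u
  proof -
    define s where "s i = inverse (u ^ L) * (u ^ Suc N) ^ weight (e i)" for i
    let ?g = "\<lambda>j i. of_bool (j = i) * s i"
    have "(\<Prod>i\<le>N. s i) = inverse (u ^ L) ^ Suc N * (u ^ Suc N) ^ L"
      unfolding s_def prod.distrib L_def by (simp add: power_sum)
    also have "\<dots> = 1"
    proof -
      have "(u ^ Suc N) ^ L = (u ^ L) ^ Suc N"
        by (simp only: power_mult[symmetric] mult.commute)
      then have "inverse (u ^ L) ^ Suc N * (u ^ Suc N) ^ L = (inverse (u ^ L) * u ^ L) ^ Suc N"
        by (simp only: power_mult_distrib)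
      then show ?thesis using u by simp
    qed
    finally have "ndet (Suc N) ?g = 1"
      unfolding ndet_diagonal lessThan_Suc_atMost .
    moreover have "R (\<lambda>r i. \<Sum>j\<le>N. A r j * ?g j i) = u ^ k * R A" for A
    proof -
      have "R (\<lambda>r i. \<Sum>j\<le>N. A r j * ?g j i) = R (\<lambda>r i. inverse (u ^ L) * scaled (u ^ Suc N) A r i)"
      proof (rule section_cong[OF R(1)])
        fix r i assume "i \<le> N"
        have "(\<Sum>j\<le>N. A r j * ?g j i) = (\<Sum>j\<le>N. if j = i then A r i * s i else 0)"
          by (intro sum.cong) auto
        then show "(\<Sum>j\<le>N. A r j * ?g j i) = inverse (u ^ L) * scaled (u ^ Suc N) A r i"
          using \<open>i \<le> N\<close> by (simp add: s_def)
      qed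
      also have "\<dots> = (\<Prod>r\<le>3::nat. inverse (u ^ L)) ^ d * ((u ^ Suc N) ^ (16 * d) * R A)"
        by (simp only: section_row_scaling[OF R(1)] section_scaled[OF R zero])
      also have "\<dots> = u ^ k * R A"
      proof -
        have "(u ^ Suc N) ^ (16 * d) = u ^ k * u ^ (4 * d * L)"
          unfolding power_mult[symmetric] power_add[symmetric] k(2)[symmetric] by (simp only: mult_ac)
        moreover have "(\<Prod>r\<le>3::nat. inverse (u ^ L)) ^ d = inverse (u ^ (4 * d * L))"
          by (simp add: power_inverse mult_ac flip: power_mult)
        ultimately show ?thesis using u by simp
      qed
      finally show ?thesis .
    qed
    ultimately show ?thesis
      unfolding SL_orbit_def by (intro CollectI exI[of _ ?g]) auto
  qed
  then show ?thesis using k(1) by blast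
qed

lemma not_chow_semistable: "\<not> chow_semistable N 3 image_cone"
proof
  assume "chow_semistable N 3 image_cone"
  then obtain R where R: "chow_form N 3 image_cone R" and closure: "(\<lambda>A. 0) \<notin> closure (SL_orbit N R)"
    unfolding chow_semistable_def by blast
  obtain d where d: "R \<in> grassmannian_sections N 3 d"
    using R unfolding chow_form_def by blast
  have zero: "R A = 0 \<longleftrightarrow> subspace_meets N 3 A image_cone" if "independent_forms N 3 A" for A
    using R that unfolding chow_form_def by blast
  \<comment> \<open>A section of degree 0 is constant, but \<open>R\<close> vanishes at some
    independent forms and not at \<open>rows vertex\<close>.\<close>
  have "d > 0"
  proof (rule ccontr)
    assume "\<not> d > 0"
    then have R0: "R \<in> grassmannian_sections N 3 0" using d by simp
    obtain A where "independent_forms N 3 A" "subspace_meets N 3 A image_cone"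
      using ex_independent_meeting by blast
    then have "R A = 0" using zero by blast
    then have "R (rows vertex) = 0" using section_degree_0[OF R0, of "rows vertex" A] by simp
    then show False using zero[OF independent_vertex_rows] vertex_rows_not_meet by blast
  qed
  obtain k where k: "k > 0" "\<And>u. u \<noteq> 0 \<Longrightarrow> (\<lambda>A. u ^ k * R A) \<in> SL_orbit N R"
    using orbit_element[OF d \<open>d > 0\<close> zero] by auto
  define f where "f u = (\<lambda>A. u ^ k * R A)" for u :: complex
  \<comment> \<open>Pointwise convergence is convergence in the product topology, which is the
    topology behind \<open>closure\<close> on functions.\<close>
  have "limitin (product_topology (\<lambda>_. euclidean) UNIV) f (\<lambda>A. 0) (at 0)"
    unfolding limitin_componentwise
  proof (intro conjI ballI)
    fix A
    have "((\<lambda>u. u ^ k * R A) \<longlongrightarrow> 0 ^ k * R A) (at 0)"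
      by (intro tendsto_intros)
    then show "limitin euclidean (\<lambda>u. f u A) 0 (at 0)"
      using k(1) by (simp add: f_def zero_power)
  qed auto
  then have lim: "(f \<longlongrightarrow> (\<lambda>A. 0)) (at 0)"
    by (simp add: euclidean_product_topology)
  have "f u \<in> closure (SL_orbit N R)" if "u \<noteq> 0" for u
    using k(2)[OF that] closure_subset unfolding f_def by blast
  then have "\<forall>\<^sub>F u in at 0. f u \<in> closure (SL_orbit N R)"
    by (simp add: eventually_at_filter)
  with lim have "(\<lambda>A. 0) \<in> closure (SL_orbit N R)"
    using Lim_in_closed_set[OF closed_closure] by (metis trivial_limit_at)
  then show False using closure by blast
qed

end

theorem proposition5p2:
  shows "\<exists>\<Sigma> :: 3 fan. toric_fano_orbifold \<Sigma> \<and> kahler_einstein \<Sigma> \<and>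
    chow_unstable_anticanonical \<Sigma> 2"
proof (intro exI conjI)
  show "toric_fano_orbifold quotient_fan"
    unfolding toric_fano_orbifold_def
    using complete_simplicial_quotient_fan very_ample_quotient_fan by (intro conjI exI[of _ 2]) auto
  show "kahler_einstein quotient_fan" by (rule kahler_einstein_quotient_fan)
  obtain N :: nat and e where e: "bij_betw e {..N} exponents"
    using exponents_enumeration by metis
  then interpret exponents_enumeration N e by unfold_locales
  have "CARD(3) = 3" by simp
  then show "chow_unstable_anticanonical quotient_fan 2"
    unfolding chow_unstable_anticanonical_def
    using very_ample_quotient_fan monomial_basis[OF e] not_chow_semistable by metis
qed

end
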